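(* Consider the Brownian stopping problem with the specific reward $f$ described in the context, and its binomial-tree discretization with time step $h=h_n=3^{-2n}$, $n\in\mathbb{N}_+$. Then $S_*=\{1/2\}$ and $V(x)=f_0(x)$ for all $x\in\mathbb{R}$. Meanwhile, $0\in S_*^h$ for all $n\in\mathbb{N}_+$ large enough, and $$\limsup_{n\to\infty}V^{h}(x)<V(x)\qquad\text{for all }x<0.$$
   Context: $\mathbb{N}=\{0,1,\dots\}$, $\mathbb{N}_+=\{1,2,\dots\}$. Continuous-time model: $X$ is a standard one-dimensional Brownian motion started from $x$ under $\mathbb{E}_x$; the discount function is $\delta(t)=\int_1^2e^{-rt}dr$, with $\delta(\infty)f(\cdot):=0$. For closed $S\subset\mathbb{R}$, $\rho_S:=\inf\{t>0:X_t\in S\}$, $J(x,S):=\mathbb{E}_x[\delta(\rho_S)f(X_{\rho_S})]$. A closed set $S$ is a mild equilibrium if $f(x)\le J(x,S)$ for all $x\notin S$ and $f(x)\ge J(x,S)$ for all $x\in S$; $\mathcal{E}$ is the set of mild equilibria, $S_*:=\bigcap_{S\in\mathcal{E}}S$, and $V(x):=\sup_{S\in\mathcal{E}}J(x,S)$. Reward: let $x^*=1/2$, $$f_0(x):=\mathbb{E}_x[\delta(\rho_{\{1/2\}})]=\int_1^2e^{-\sqrt{2r}|x-1/2|}dr\quad(x\in\mathbb{R}),$$ $$f_1(x):=\int_1^2\left(\frac{e^{\sqrt{2r}x}-e^{-\sqrt{2r}x}}{e^{\sqrt{2r}x^*}-e^{-\sqrt{2r}x^*}}+f_0(0)\frac{e^{\sqrt{2r}(x^*-x)}-e^{-\sqrt{2r}(x^*-x)}}{e^{\sqrt{2r}x^*}-e^{-\sqrt{2r}x^*}}\right)dr\quad(x\in[0,x^*]),$$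 and $$f(x):=\begin{cases}e^{x}f_0(0)\,\mathbb{E}_x[\delta(\rho_{\{0\}})]=e^xf_0(0)\int_1^2e^{\sqrt{2r}x}dr,&x\le0,\\ \dfrac{f_1(x)}{1+K_1x(\frac12-x)},&0<x\le x^*,\\ e^{K_2(x^*-x)}f_0(x),&x>x^*,\end{cases}$$ where the constants $K_1,K_2>0$ are chosen such that $f'(0+)=f_1'(0+)-\frac{K_1}{2}f_0(0)\le-17$, $f'(x^*-)=f_1'(x^*-)+\frac{K_1}{2}\ge17$, and $f'(x^*+)=f_0'(x^*+)-K_2<-f'(x^*-)$ (one-sided derivatives). Binomial-tree model with $h=3^{-2n}$: $\mathbb{X}^h=\{k\sqrt h:k\in\mathbb{Z}\}=\{k/3^n:k\in\mathbb{Z}\}$; $X^h$ is the simple symmetric random walk on $\mathbb{X}^h$ (steps $\pm\sqrt h$ with probability $1/2$ each); $\mathbb{E}^h_y$ is expectation given $X^h_0=y$; $\delta^h(k)=\int_1^2(1+rh)^{-k}dr$, with value $0$ at $k=\infty$. For $x\in[k\sqrt h,(k+1)\sqrt h)$, $x(h):=k\sqrt h$. For $S\subset\mathbb{X}^h$ and $x\in\mathbb{R}$: $J^h(x,S):=\mathbb{E}^h_{x(h)}[\delta^h(\rho)f(X^h_\rho)]$ with $\rho=\inf\{k\in\mathbb{N}_+:X^h_k\in S\}$, and $\tilde J^h(x,S):=\mathbb{E}^h_{x(h)}[\delta^h(\tilde\rho)f(X^h_{\tilde\rho})]$ with $\tilde\rho=\inf\{k\in\mathbb{N}:X^h_k\in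 S\}$. A set $S\subset\mathbb{X}^h$ is an equilibrium if $f(x)\le J^h(x,S)$ for $x\in\mathbb{X}^h\setminus S$ and $f(x)\ge J^h(x,S)$ for $x\in S$; $\mathcal{E}^h$ is the set of equilibria, $S_*^h:=\bigcap_{S\in\mathcal{E}^h}S$, and $V^h(x):=\sup_{S\in\mathcal{E}^h}\tilde J^h(x,S)$ for $x\in\mathbb{R}$. *)

theory Defs
  imports "HOL-Probability.Probability"
begin

section \<open>Brownian stopping problem\<close>

text \<open>Continuity and the initial value are required for every sample path, not just almost
  surely, so that hitting times of closed sets are measurable without completing \<open>M\<close>.\<close>

definition standard_brownian_motion :: "'a measure \<Rightarrow> (real \<Rightarrow> 'a \<Rightarrow> real) \<Rightarrow> bool" where
  "standard_brownian_motion M B \<longleftrightarrow>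
     prob_space M \<and>
     (\<forall>t\<ge>0. B t \<in> borel_measurable M) \<and>
     (\<forall>\<omega>\<in>space M. B 0 \<omega> = 0) \<and>
     (\<forall>\<omega>\<in>space M. continuous_on {0..} (\<lambda>t. B t \<omega>)) \<and>
     (\<forall>s t. 0 \<le> s \<and> s < t \<longrightarrow>
        distributed M lborel (\<lambda>\<omega>. B t \<omega> - B s \<omega>) (normal_density 0 (sqrt (t - s)))) \<and>
     (\<forall>t :: nat \<Rightarrow> real. 0 \<le> t 0 \<and> mono t \<longrightarrow>
        prob_space.indep_vars M (\<lambda>_. borel) (\<lambda>i \<omega>. B (t (Suc i)) \<omega> - B (t i) \<omega>) UNIV)"

definition disc :: "ereal \<Rightarrow> real" where
  "disc t = (if t = \<infinity> then 0 else integral {1..2} (\<lambda>r. exp (- r * real_of_ereal t)))"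

text \<open>Under \<open>E\<^sub>x\<close> the process is \<open>X\<^sub>t = x + B\<^sub>t\<close>. The hitting time is \<open>\<infinity>\<close> (the infimum of the
  empty set) if \<open>S\<close> is never hit.\<close>

definition hitting_time :: "(real \<Rightarrow> 'a \<Rightarrow> real) \<Rightarrow> real \<Rightarrow> real set \<Rightarrow> 'a \<Rightarrow> ereal" where
  "hitting_time B x S \<omega> = (INF t\<in>{t. 0 < t \<and> x + B t \<omega> \<in> S}. ereal t)"

text \<open>On the event that the hitting time is \<open>\<infinity>\<close>, \<open>disc\<close> vanishes and the value of
  \<open>real_of_ereal \<infinity>\<close> is irrelevant.\<close>

definition J :: "'a measure \<Rightarrow> (real \<Rightarrow> 'a \<Rightarrow> real) \<Rightarrow> (real \<Rightarrow> real) \<Rightarrow> real \<Rightarrow> real set \<Rightarrow> real" where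
  "J M B f x S =
     (\<integral>\<omega>. disc (hitting_time B x S \<omega>) * f (x + B (real_of_ereal (hitting_time B x S \<omega>)) \<omega>) \<partial>M)"

definition mild_equilibria ::
  "'a measure \<Rightarrow> (real \<Rightarrow> 'a \<Rightarrow> real) \<Rightarrow> (real \<Rightarrow> real) \<Rightarrow> real set set" where
  "mild_equilibria M B f =
     {S. closed S \<and> (\<forall>x. x \<notin> S \<longrightarrow> f x \<le> J M B f x S) \<and> (\<forall>x\<in>S. f x \<ge> J M B f x S)}"

definition S_star :: "'a measure \<Rightarrow> (real \<Rightarrow> 'a \<Rightarrow> real) \<Rightarrow> (real \<Rightarrow> real) \<Rightarrow> real set" where
  "S_star M B f = \<Inter> (mild_equilibria M B f)"

definition V :: "'a measure \<Rightarrow> (real \<Rightarrow> 'a \<Rightarrow> real) \<Rightarrow> (real \<Rightarrow> real) \<Rightarrow> real \<Rightarrow> real" where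
  "V M B f x = (SUP S\<in>mild_equilibria M B f. J M B f x S)"

section \<open>The reward\<close>

text \<open>The expected discount factor \<open>E\<^sub>x[\<delta>(\<rho>\<^bsub>{a}\<^esub>)]\<close>; its closed form is the integral of
  \<open>exp (- sqrt (2 * r) * \<bar>x - a\<bar>)\<close> over \<open>r \<in> {1..2}\<close>.\<close>

definition expected_disc :: "'a measure \<Rightarrow> (real \<Rightarrow> 'a \<Rightarrow> real) \<Rightarrow> real \<Rightarrow> real \<Rightarrow> real" where
  "expected_disc M B a x = (\<integral>\<omega>. disc (hitting_time B x {a} \<omega>) \<partial>M)"

definition f0 :: "'a measure \<Rightarrow> (real \<Rightarrow> 'a \<Rightarrow> real) \<Rightarrow> real \<Rightarrow> real" where
  "f0 M B x = expected_disc M B (1/2) x"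

definition f1 :: "'a measure \<Rightarrow> (real \<Rightarrow> 'a \<Rightarrow> real) \<Rightarrow> real \<Rightarrow> real" where
  "f1 M B x = integral {1..2} (\<lambda>r.
     (exp (sqrt (2 * r) * x) - exp (- sqrt (2 * r) * x)) /
       (exp (sqrt (2 * r) * (1/2)) - exp (- sqrt (2 * r) * (1/2)))
     + f0 M B 0 *
       ((exp (sqrt (2 * r) * (1/2 - x)) - exp (- sqrt (2 * r) * (1/2 - x))) /
        (exp (sqrt (2 * r) * (1/2)) - exp (- sqrt (2 * r) * (1/2)))))"

definition reward :: "'a measure \<Rightarrow> (real \<Rightarrow> 'a \<Rightarrow> real) \<Rightarrow> real \<Rightarrow> real \<Rightarrow> real \<Rightarrow> real" where
  "reward M B K1 K2 x =
     (if x \<le> 0 then exp x * f0 M B 0 * expected_disc M B 0 x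
      else if x \<le> 1/2 then f1 M B x / (1 + K1 * x * (1/2 - x))
      else exp (K2 * (1/2 - x)) * f0 M B x)"

section \<open>Binomial-tree model with time step \<open>h\<close>\<close>

definition grid :: "real \<Rightarrow> real set" where
  "grid h = {of_int k * sqrt h | k :: int. True}"

definition grid_floor :: "real \<Rightarrow> real \<Rightarrow> real" where
  "grid_floor h x = of_int \<lfloor>x / sqrt h\<rfloor> * sqrt h"

definition steps :: "int stream measure" where
  "steps = stream_space (measure_pmf (pmf_of_set {-1, 1}))"

definition walk :: "real \<Rightarrow> real \<Rightarrow> int stream \<Rightarrow> nat \<Rightarrow> real" where
  "walk h y \<omega> k = y + of_int (\<Sum>i<k. \<omega> !! i) * sqrt h"

definition tree_disc :: "real \<Rightarrow> enat \<Rightarrow> real" where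
  "tree_disc h k =
     (case k of enat m \<Rightarrow> integral {1..2} (\<lambda>r. 1 / (1 + r * h) ^ m) | \<infinity> \<Rightarrow> 0)"

text \<open>The first time \<open>k \<ge> m\<close> at which the walk is in \<open>S\<close>: \<open>m = 1\<close> gives \<open>\<rho>\<close> and \<open>m = 0\<close> gives
  the variant in which time 0 counts.\<close>

definition tree_hitting_time :: "nat \<Rightarrow> real \<Rightarrow> real \<Rightarrow> real set \<Rightarrow> int stream \<Rightarrow> enat" where
  "tree_hitting_time m h y S \<omega> = (INF k\<in>{k. m \<le> k \<and> walk h y \<omega> k \<in> S}. enat k)"

definition tree_payoff :: "nat \<Rightarrow> real \<Rightarrow> (real \<Rightarrow> real) \<Rightarrow> real \<Rightarrow> real set \<Rightarrow> real" where
  "tree_payoff m h f y S =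
     (\<integral>\<omega>. tree_disc h (tree_hitting_time m h y S \<omega>) *
           f (walk h y \<omega> (the_enat (tree_hitting_time m h y S \<omega>))) \<partial>steps)"

definition tree_J :: "real \<Rightarrow> (real \<Rightarrow> real) \<Rightarrow> real \<Rightarrow> real set \<Rightarrow> real" where
  "tree_J h f x S = tree_payoff 1 h f (grid_floor h x) S"

definition tree_J0 :: "real \<Rightarrow> (real \<Rightarrow> real) \<Rightarrow> real \<Rightarrow> real set \<Rightarrow> real" where
  "tree_J0 h f x S = tree_payoff 0 h f (grid_floor h x) S"

definition tree_equilibria :: "real \<Rightarrow> (real \<Rightarrow> real) \<Rightarrow> real set set" where
  "tree_equilibria h f =
     {S. S \<subseteq> grid h \<and> (\<forall>x\<in>grid h - S. f x \<le> tree_J h f x S) \<and> (\<forall>x\<in>S. f x \<ge> tree_J h f x S)}"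

definition tree_S_star :: "real \<Rightarrow> (real \<Rightarrow> real) \<Rightarrow> real set" where
  "tree_S_star h f = \<Inter> (tree_equilibria h f)"

definition tree_V :: "real \<Rightarrow> (real \<Rightarrow> real) \<Rightarrow> real \<Rightarrow> real" where
  "tree_V h f x = (SUP S\<in>tree_equilibria h f. tree_J0 h f x S)"

end

theory Submission imports Defs begin

text \<open>A discount function that is an average of exponentials satisfies
  \<open>\<delta>(s) \<delta>(t) \<le> \<delta>(s + t)\<close> by Chebyshev's integral inequality. In continuous time this gives
  \<open>f \<le> f\<^sub>0\<close> and, for every mild equilibrium \<open>S\<close> and \<open>x \<notin> S\<close>, \<open>J(x, S) \<le> f\<^sub>0(x)\<close>, where the
  martingale \<open>exp(c X\<^sub>t - r t)\<close>, \<open>c\<^sup>2 = 2 r\<close>, stopped at \<open>S\<close> replaces the strong Markov property.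
  Since \<open>f(1/2) = 1\<close> and \<open>f\<close> is bounded away from \<open>1\<close> outside every neighbourhood of \<open>1/2\<close>,
  each mild equilibrium contains \<open>1/2\<close>.

  On the grid \<open>1/2\<close> is missing. A walk started at \<open>0\<close> that first visits the positive part of \<open>S\<close>
  at \<open>q\<close> earns at most \<open>f(q)\<close> times the expected discount factor of hitting \<open>q\<close> from \<open>0\<close>, and
  this product is below \<open>f(0)\<close> for every grid point \<open>q > 0\<close>: it is at most
  \<open>f(0) exp(h q) / (1 + K1 q (1/2 - q))\<close> for \<open>q < 1/2\<close>, and \<open>q\<close> has distance at least \<open>\<surd>h / 2\<close>
  from \<open>1/2\<close>. Hence \<open>J\<^sup>h(0, S) < f(0)\<close> for every \<open>S\<close>, so \<open>0\<close> lies in every equilibrium.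
  From \<open>x < 0\<close> the walk must therefore pay for the way to \<open>0\<close> and for \<open>f(0) = f\<^sub>0(0)\<close> separately,
  and the strict Chebyshev inequality separates the two value functions in the limit. As the
  supremum in \<open>V\<^sup>h\<close> is only meaningful if there are equilibria at all, one is exhibited: \<open>0\<close>
  together with one or both grid neighbours of \<open>1/2\<close>.\<close>

section \<open>Averages over the rates\<close>

text \<open>At one fixed rate \<open>r\<close> everything is multiplicative: exponentials are
  martingales, and going on to a further point costs exactly one factor. Only the average over
  \<open>r\<close> destroys this. Hence weights that depend on \<open>r\<close> are carried along,
  and Chebyshev's inequality is applied, where possible, to one fixed path, on which elapsed time
  and position are mere numbers; Fubini then takes the average outside. The inequality reverses when
  one factor increases in \<open>r\<close>, and this reversed form bounds the chance of reaching
  \<open>q\<close> in the tree.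

  The delicate scale is \<open>s = \<surd>h\<close>. The walk decays at an exponent smaller than
  \<open>sqrt (2 * r)\<close> by at most \<open>s\<^sup>2\<close>, so discount factors on the grid
  exceed the continuous ones. The strict inequality at the origin survives because the reward has
  already lost a quantity of order \<open>s\<close> at the neighbours of 1/2.

  The derivative hypotheses at 1/2 enter only through three consequences:
  \<open>27 \<le> K1\<close>, \<open>1 \<le> K2\<close>, and the left neighbour of 1/2 carries at
  least the reward of the right one.\<close>

definition rates :: "real measure" where
  "rates = restrict_space lborel {1..2}"

lemma space_rates [simp]: "space rates = {1..2}"
  by (simp add: rates_def space_restrict_space)

lemma prob_space_rates: "prob_space rates"
  by (rule prob_spaceI) (simp add: rates_def space_restrict_space emeasure_restrict_space)

lemma measurable_rates_eq: "borel_measurable rates = borel_measurable (restrict_space borel {1..2})"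
  by (rule measurable_cong_sets) (auto simp: rates_def sets_restrict_space)

lemma measurable_ratesI: "f \<in> borel_measurable borel \<Longrightarrow> f \<in> borel_measurable rates"
  unfolding measurable_rates_eq by (rule measurable_restrict_space1)

interpretation rates: prob_space rates
  by (rule prob_space_rates)

lemma integrable_rates:
  fixes \<phi> :: "real \<Rightarrow> real"
  assumes "continuous_on {1..2} \<phi>"
  shows "integrable rates \<phi>"
proof -
  have "\<phi> \<in> borel_measurable rates"
    unfolding measurable_rates_eq using assms by (rule borel_measurable_continuous_on_restrict)
  moreover obtain b where "\<And>r. r \<in> {1..2} \<Longrightarrow> norm (\<phi> r) \<le> b"
    using compact_imp_bounded[OF compact_continuous_image[OF assms]]
    unfolding bounded_iff by blast
  ultimately show ?thesis
    by (intro rates.integrable_const_bound[where B=b]) auto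
qed

lemma integral_rates:
  fixes \<phi> :: "real \<Rightarrow> real"
  assumes "continuous_on {1..2} \<phi>"
  shows "integral {1..2} \<phi> = (\<integral>r. \<phi> r \<partial>rates)"
proof -
  have "set_integrable lborel {1..2} \<phi>"
    using borel_integrable_compact[OF _ assms] by (simp add: set_integrable_def indicator_def if_distrib cong: if_cong)
  from set_borel_integral_eq_integral(2)[OF this] show ?thesis
    by (simp add: rates_def integral_restrict_space set_lebesgue_integral_def)
qed

text \<open>By continuity \<open>f\<close> attains its mean at some \<open>t\<close>, so the
  covariance is the mean of \<open>(f r - f t) * (g r - g t)\<close>, nonnegative pointwise because
  both functions decrease. Continuity is asked of \<open>f\<close> only, since \<open>g\<close>
  will, up to sign, also be a hitting value, of which integrability and monotonicity are known. The
  explicit covariance serves the strict version.\<close>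

lemma chebyshev_rates:
  fixes f g :: "real \<Rightarrow> real"
  assumes f: "continuous_on {1..2} f" and f_mono: "\<And>r t. \<lbrakk>1 \<le> r; r \<le> t; t \<le> 2\<rbrakk> \<Longrightarrow> f t \<le> f r"
    and g: "integrable rates g" and g_mono: "\<And>r t. \<lbrakk>1 \<le> r; r \<le> t; t \<le> 2\<rbrakk> \<Longrightarrow> g t \<le> g r"
  shows "integrable rates (\<lambda>r. f r * g r)"
    "(\<integral>r. f r \<partial>rates) * (\<integral>r. g r \<partial>rates) \<le> (\<integral>r. f r * g r \<partial>rates)"
    "\<exists>t\<in>{1..2}. (\<integral>r. f r * g r \<partial>rates) - (\<integral>r. f r \<partial>rates) * (\<integral>r. g r \<partial>rates)
       = (\<integral>r. (f r - f t) * (g r - g t) \<partial>rates)"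
proof -
  note fi = integrable_rates[OF f]
  have bd: "\<bar>g r\<bar> \<le> \<bar>g 1\<bar> + \<bar>g 2\<bar>" if "r \<in> {1..2}" for r
    using g_mono[of 1 r] g_mono[of r 2] that by auto
  show prod: "integrable rates (\<lambda>r. f r * g r)"
  proof (rule Bochner_Integration.integrable_bound)
    show "integrable rates (\<lambda>r. f r * (\<bar>g 1\<bar> + \<bar>g 2\<bar>))"
      using fi by simp
    show "(\<lambda>r. f r * g r) \<in> borel_measurable rates"
      using fi g by measurable
    show "AE r in rates. norm (f r * g r) \<le> norm (f r * (\<bar>g 1\<bar> + \<bar>g 2\<bar>))"
      using bd by (intro AE_I2) (auto simp: abs_mult intro!: mult_left_mono)
  qed
  have "f 2 \<le> (\<integral>r. f r \<partial>rates)"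
    by (rule rates.integral_ge_const[OF fi]) (auto intro!: AE_I2 f_mono)
  moreover have "(\<integral>r. f r \<partial>rates) \<le> f 1"
    by (rule rates.integral_le_const[OF fi]) (auto intro!: AE_I2 f_mono)
  ultimately obtain t where t: "t \<in> {1..2}" "f t = (\<integral>r. f r \<partial>rates)"
    using IVT2'[of f 2 "\<integral>r. f r \<partial>rates" 1] f by auto
  have eq: "(\<integral>r. (f r - f t) * (g r - g t) \<partial>rates)
     = (\<integral>r. f r * g r \<partial>rates) - (\<integral>r. f r \<partial>rates) * (\<integral>r. g r \<partial>rates)"
  proof -
    have "(\<integral>r. (f r - f t) * (g r - g t) \<partial>rates)
        = (\<integral>r. f r * g r - f t * g r - g t * f r + f t * g t \<partial>rates)"
      by (simp add: algebra_simps)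
    also have "\<dots> = (\<integral>r. f r * g r \<partial>rates) - f t * (\<integral>r. g r \<partial>rates) - g t * (\<integral>r. f r \<partial>rates) + f t * g t"
      using prod fi g rates.prob_space by simp
    finally show ?thesis using t by simp
  qed
  have "0 \<le> (\<integral>r. (f r - f t) * (g r - g t) \<partial>rates)"
  proof (rule integral_nonneg_AE, intro AE_I2)
    fix r assume "r \<in> space rates"
    then show "0 \<le> (f r - f t) * (g r - g t)"
      using t f_mono[of r t] f_mono[of t r] g_mono[of r t] g_mono[of t r]
      by (cases "r \<le> t") (auto intro: mult_nonneg_nonneg mult_nonpos_nonpos)
  qed
  with eq show "(\<integral>r. f r \<partial>rates) * (\<integral>r. g r \<partial>rates) \<le> (\<integral>r. f r * g r \<partial>rates)" by simp
  show "\<exists>t\<in>{1..2}. (\<integral>r. f r * g r \<partial>rates) - (\<integral>r. f r \<partial>rates) * (\<integral>r. g r \<partial>rates)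
       = (\<integral>r. (f r - f t) * (g r - g t) \<partial>rates)"
    using t(1) eq[symmetric] by (rule bexI[rotated])
qed

lemma chebyshev_rates_opposite:
  fixes f g :: "real \<Rightarrow> real"
  assumes f: "continuous_on {1..2} f" and f_mono: "\<And>r t. \<lbrakk>1 \<le> r; r \<le> t; t \<le> 2\<rbrakk> \<Longrightarrow> f t \<le> f r"
    and g: "integrable rates g" and g_mono: "\<And>r t. \<lbrakk>1 \<le> r; r \<le> t; t \<le> 2\<rbrakk> \<Longrightarrow> g r \<le> g t"
  shows "integrable rates (\<lambda>r. f r * g r)"
    "(\<integral>r. f r * g r \<partial>rates) \<le> (\<integral>r. f r \<partial>rates) * (\<integral>r. g r \<partial>rates)"
  using chebyshev_rates[OF f f_mono, of "\<lambda>r. - g r"] g g_mono by simp_all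

text \<open>The integrand of the covariance is continuous and positive off \<open>t\<close>. If its
  integral vanished it would be zero at both endpoints, and \<open>t\<close> cannot be both.\<close>

lemma chebyshev_rates_strict:
  fixes f g :: "real \<Rightarrow> real"
  assumes f: "continuous_on {1..2} f" and f_mono: "\<And>r t. \<lbrakk>1 \<le> r; r < t; t \<le> 2\<rbrakk> \<Longrightarrow> f t < f r"
    and g: "continuous_on {1..2} g" and g_mono: "\<And>r t. \<lbrakk>1 \<le> r; r < t; t \<le> 2\<rbrakk> \<Longrightarrow> g t < g r"
  shows "(\<integral>r. f r \<partial>rates) * (\<integral>r. g r \<partial>rates) < (\<integral>r. f r * g r \<partial>rates)"
proof -
  have fw: "\<lbrakk>1 \<le> r; r \<le> t; t \<le> 2\<rbrakk> \<Longrightarrow> f t \<le> f r" for r t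
    using f_mono[of r t] by (cases "r = t") auto
  have gw: "\<lbrakk>1 \<le> r; r \<le> t; t \<le> 2\<rbrakk> \<Longrightarrow> g t \<le> g r" for r t
    using g_mono[of r t] by (cases "r = t") auto
  obtain t where t: "t \<in> {1..2}" and eq: "(\<integral>r. f r * g r \<partial>rates) - (\<integral>r. f r \<partial>rates) * (\<integral>r. g r \<partial>rates)
       = (\<integral>r. (f r - f t) * (g r - g t) \<partial>rates)"
    using chebyshev_rates(3)[OF f fw integrable_rates[OF g] gw] by auto
  let ?p = "\<lambda>r. (f r - f t) * (g r - g t)"
  have cont: "continuous_on {1..2} ?p"
    by (intro continuous_intros f g)
  have pos: "0 < ?p r" if "r \<in> {1..2}" "r \<noteq> t" for r
    using that t f_mono[of r t] f_mono[of t r] g_mono[of r t] g_mono[of t r]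
    by (cases "r < t") (auto intro: mult_pos_pos mult_neg_neg)
  have nn: "0 \<le> ?p r" if "r \<in> {1..2}" for r
    using pos[OF that] by (cases "r = t") auto
  have "integral {1..2} ?p \<noteq> 0"
  proof
    assume "integral {1..2} ?p = 0"
    moreover have "?p integrable_on {1..2}"
      using cont by (rule integrable_continuous_interval)
    ultimately have "(?p has_integral 0) (cbox 1 2)"
      by (metis integrable_integral box_real(2))
    then have "?p r = 0" if "r \<in> {1..2}" for r
      using has_integral_0_cbox_imp_0[of 1 2 ?p r] cont nn that by (auto simp: box_real)
    from this[of 1] this[of 2] pos[of 1] pos[of 2] show False by (cases "t = 1") auto
  qed
  moreover have "0 \<le> (\<integral>r. ?p r \<partial>rates)"
    using nn by (intro integral_nonneg_AE AE_I2) auto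
  ultimately show ?thesis
    using eq integral_rates[OF cont] by linarith
qed


section \<open>Discount factors for Brownian motion reaching a point at distance
  \<open>d\<close>\<close>

definition hit_discount :: "real \<Rightarrow> real" where
  "hit_discount d = (\<integral>r. exp (- sqrt (2 * r) * d) \<partial>rates)"

lemma continuous_hit_integrand: "continuous_on {1..2} (\<lambda>r. exp (- sqrt (2 * r) * d))"
  by (intro continuous_intros)

lemmas integrable_hit_integrand = integrable_rates[OF continuous_hit_integrand]

lemma hit_discount_0 [simp]: "hit_discount 0 = 1"
  by (simp add: hit_discount_def rates.prob_space[simplified])

lemma sqrt_2r_bounds:
  assumes "r \<in> {1..2}" shows "1 \<le> sqrt (2 * r)" "sqrt (2 * r) \<le> 2"
  using assms real_sqrt_le_mono[of "2 * r" "2\<^sup>2"] by auto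

lemma hit_discount_le_exp:
  assumes "0 \<le> d" shows "hit_discount d \<le> exp (- d)"
  unfolding hit_discount_def
proof (rule rates.integral_le_const[OF integrable_hit_integrand], intro AE_I2)
  fix r assume "r \<in> space rates"
  then show "exp (- sqrt (2 * r) * d) \<le> exp (- d)"
    using mult_right_mono[OF sqrt_2r_bounds(1)[of r] assms] by simp
qed

lemma hit_discount_ge_exp:
  assumes "0 \<le> d" shows "exp (- 2 * d) \<le> hit_discount d"
  unfolding hit_discount_def
proof (rule rates.integral_ge_const[OF integrable_hit_integrand], intro AE_I2)
  fix r assume "r \<in> space rates"
  then show "exp (- 2 * d) \<le> exp (- sqrt (2 * r) * d)"
    using mult_right_mono[OF sqrt_2r_bounds(2)[of r] assms] by simp
qed

lemma hit_discount_le_1: "0 \<le> d \<Longrightarrow> hit_discount d \<le> 1"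
  using hit_discount_le_exp[of d] order_trans by fastforce

lemma hit_discount_pos: "0 \<le> d \<Longrightarrow> 0 < hit_discount d"
  using hit_discount_ge_exp[of d] exp_gt_zero[of "- 2 * d"] by linarith

lemma hit_discount_antimono: 
  assumes "d \<le> e" shows "hit_discount e \<le> hit_discount d"
  unfolding hit_discount_def
  by (intro integral_mono integrable_hit_integrand) (use assms in \<open>auto intro: mult_left_mono\<close>)

lemma hit_discount_mult_le:
  assumes "0 \<le> d" "0 \<le> e" shows "hit_discount d * hit_discount e \<le> hit_discount (d + e)"
  using chebyshev_rates(2)[OF continuous_hit_integrand _ integrable_hit_integrand, of d e] assms
  by (simp add: hit_discount_def distrib_left mult_right_mono flip: exp_add)

lemma hit_discount_mult_less:
  assumes "0 < d" "0 < e" shows "hit_discount d * hit_discount e < hit_discount (d + e)"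
  using chebyshev_rates_strict[OF continuous_hit_integrand _ continuous_hit_integrand, of d e] assms
  by (simp add: hit_discount_def distrib_left flip: exp_add)

section \<open>Ratios of hyperbolic sines\<close>

lemma sinh_mult_le:
  fixes x y t1 t2 :: real
  assumes "0 \<le> x" "x \<le> y" "0 \<le> t1" "t1 \<le> t2"
  shows "sinh (x * t2) * sinh (y * t1) \<le> sinh (x * t1) * sinh (y * t2)"
proof -
  \<comment> \<open>This is the sign of the derivative of
    \<open>sinh (y * t) / sinh (x * t)\<close>. The ratio is what is monotone; the product form of
    the claim also covers vanishing denominators.\<close>
  have key: "x * cosh (x * t) * sinh (y * t) \<le> y * sinh (x * t) * cosh (y * t)" if "0 \<le> t" for t
  proof -
    define \<phi> where "\<phi> t = y * sinh (x * t) * cosh (y * t) - x * cosh (x * t) * sinh (y * t)" for t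
    have "\<phi> 0 \<le> \<phi> t"
    proof (rule DERIV_nonneg_imp_nondecreasing[OF that])
      fix z :: real assume z: "0 \<le> z"
      have "(\<phi> has_real_derivative (y\<^sup>2 - x\<^sup>2) * (sinh (x * z) * sinh (y * z))) (at z)"
        unfolding \<phi>_def
        by (auto intro!: derivative_eq_intros simp: power2_eq_square algebra_simps)
      moreover have "0 \<le> (y\<^sup>2 - x\<^sup>2) * (sinh (x * z) * sinh (y * z))"
        using assms z by (auto intro!: mult_nonneg_nonneg power_mono)
      ultimately show "\<exists>D. (\<phi> has_real_derivative D) (at z) \<and> 0 \<le> D" by blast
    qed
    then show ?thesis by (simp add: \<phi>_def)
  qed
  show ?thesis
  proof (cases "x = 0 \<or> t1 = 0")
    case False
    then have pos: "0 < x" "0 < t1" "0 < y" using assms by auto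
    define \<rho> where "\<rho> t = sinh (y * t) / sinh (x * t)" for t
    have "\<rho> t1 \<le> \<rho> t2"
    proof (rule DERIV_nonneg_imp_nondecreasing[OF assms(4)])
      fix z assume z: "t1 \<le> z"
      have sx: "0 < sinh (x * z)" using pos z by simp
      have "(\<rho> has_real_derivative
          (y * cosh (y * z) * sinh (x * z) - sinh (y * z) * (x * cosh (x * z))) / (sinh (x * z) * sinh (x * z))) (at z)"
        unfolding \<rho>_def using sx by (auto intro!: derivative_eq_intros simp: algebra_simps)
      moreover have "0 \<le> (y * cosh (y * z) * sinh (x * z) - sinh (y * z) * (x * cosh (x * z))) / (sinh (x * z) * sinh (x * z))"
        using key[of z] pos z sx by (intro divide_nonneg_nonneg) (auto simp: algebra_simps)
      ultimately show "\<exists>D. (\<rho> has_real_derivative D) (at z) \<and> 0 \<le> D" by blast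
    qed
    moreover have "0 < sinh (x * t1)" "0 < sinh (x * t2)"
      using pos assms by (auto intro!: mult_pos_pos)
    ultimately show ?thesis
      by (simp add: \<rho>_def field_simps)
  qed auto
qed

text \<open>For Brownian motion on the interval from 0 to \<open>y\<close>, killed at rate
  \<open>t\<^sup>2 / 2\<close>, the ratio is the probability of leaving alive at \<open>y\<close>
  from \<open>x\<close>. More killing makes it smaller.\<close>

lemma sinh_divide_antimono:
  fixes x y t1 t2 :: real
  assumes "0 \<le> x" "x \<le> y" "0 < y" "0 < t1" "t1 \<le> t2"
  shows "sinh (x * t2) / sinh (y * t2) \<le> sinh (x * t1) / sinh (y * t1)"
proof -
  have "0 < sinh (y * t1)" "0 < sinh (y * t2)" using assms by auto
  then show ?thesis
    using sinh_mult_le[of x y t1 t2] assms by (simp add: field_simps)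
qed

lemma sinh_le_mult_cosh:
  fixes x :: real assumes "0 \<le> x" shows "sinh x \<le> x * cosh x"
proof -
  have "0 * cosh 0 - sinh (0::real) \<le> x * cosh x - sinh x"
  proof (rule DERIV_nonneg_imp_nondecreasing[OF assms])
    fix z :: real assume "0 \<le> z"
    moreover have "((\<lambda>x. x * cosh x - sinh x) has_real_derivative z * sinh z) (at z)"
      by (auto intro!: derivative_eq_intros)
    ultimately show "\<exists>D. ((\<lambda>x. x * cosh x - sinh x) has_real_derivative D) (at z) \<and> 0 \<le> D"
      by (meson mult_nonneg_nonneg sinh_real_nonneg_iff)
  qed
  then show ?thesis by simp
qed

lemma sinh_ge_self:
  fixes x :: real assumes "0 \<le> x" shows "x \<le> sinh x"
proof -
  have "sinh (0::real) - 0 \<le> sinh x - x"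
  proof (rule DERIV_nonneg_imp_nondecreasing[OF assms])
    fix z :: real
    have "((\<lambda>x. sinh x - x) has_real_derivative cosh z - 1) (at z)"
      by (auto intro!: derivative_eq_intros)
    then show "\<exists>D. ((\<lambda>x. sinh x - x) has_real_derivative D) (at z) \<and> 0 \<le> D"
      using cosh_real_ge_1[of z] by fastforce
  qed
  then show ?thesis by simp
qed

text \<open>Convexity of \<open>sinh\<close> on the positive half-line, that is
  \<open>sinh (c * x) / sinh (c * y) \<le> x / y\<close>, with \<open>c\<close> as the variable so
  that the derivative has an evident sign.\<close>

lemma sinh_mult_le_mult_sinh:
  fixes x y c :: real
  assumes "0 \<le> x" "x \<le> y" "0 \<le> c"
  shows "y * sinh (c * x) \<le> x * sinh (c * y)"
proof -
  define \<phi> where "\<phi> t = x * sinh (t * y) - y * sinh (t * x)" for t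
  have "\<phi> 0 \<le> \<phi> c"
  proof (rule DERIV_nonneg_imp_nondecreasing[OF assms(3)])
    fix z :: real assume z: "0 \<le> z"
    have "(\<phi> has_real_derivative x * y * (cosh (z * y) - cosh (z * x))) (at z)"
      unfolding \<phi>_def by (auto intro!: derivative_eq_intros simp: algebra_simps)
    moreover have "0 \<le> x * y * (cosh (z * y) - cosh (z * x))"
      using assms z by (auto intro!: mult_nonneg_nonneg mult_left_mono simp: cosh_real_nonneg_le_iff)
    ultimately show "\<exists>D. (\<phi> has_real_derivative D) (at z) \<and> 0 \<le> D" by blast
  qed
  then show ?thesis by (simp add: \<phi>_def mult.commute)
qed


text \<open>At a single rate there is equality once \<open>hit_discount (1/2)\<close> is replaced by
  \<open>exp (- sqrt (2 * r) / 2)\<close>: the path reaches 1/2 directly, or first 0 and from there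
  1/2. Averaging that factor separately loses by Chebyshev, since it and the exit weight at 0 both
  decrease in \<open>r\<close>.\<close>

lemma two_sided_le_hit_discount:
  assumes "0 \<le> x" "x < 1/2"
  shows "(\<integral>r. sinh (sqrt (2 * r) * x) / sinh (sqrt (2 * r) / 2)
      + hit_discount (1/2) * (sinh (sqrt (2 * r) * (1/2 - x)) / sinh (sqrt (2 * r) / 2)) \<partial>rates)
    \<le> hit_discount (1/2 - x)"
proof -
  let ?c = "\<lambda>r. sqrt (2 * r)"
  let ?T = "\<lambda>r. sinh (?c r * (1/2 - x)) / sinh (?c r / 2)"
  let ?S = "\<lambda>r. sinh (?c r * x) / sinh (?c r / 2)"
  have pos: "0 < sinh (?c r / 2)" if "r \<in> {1..2}" for r
    using that by simp
  have contT: "continuous_on {1..2} ?T" and contS: "continuous_on {1..2} ?S"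
    using pos by (auto intro!: continuous_intros)
  note intT = integrable_rates[OF contT] and intS = integrable_rates[OF contS]
  have T_mono: "?T t \<le> ?T r" if "1 \<le> r" "r \<le> t" "t \<le> 2" for r t
    using sinh_divide_antimono[of "1/2 - x" "1/2" "?c r" "?c t"] that assms
    by (simp add: mult.commute)
  note ch = chebyshev_rates[OF continuous_hit_integrand _ intT T_mono, of "1/2"]
  have eq: "?S r + exp (- ?c r * (1/2)) * ?T r = exp (- ?c r * (1/2 - x))" if "r \<in> {1..2}" for r
  proof -
    define c where "c = ?c r"
    have "sinh (c * x) + exp (- c * (1/2)) * sinh (c * (1/2 - x)) = exp (- c * (1/2 - x)) * sinh (c / 2)"
      by (simp add: sinh_field_def field_simps flip: exp_add)
    then show ?thesis
      using pos[OF that] unfolding c_def[symmetric] by (simp add: field_simps)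
  qed
  have "(\<integral>r. ?S r + hit_discount (1/2) * ?T r \<partial>rates)
     = (\<integral>r. ?S r \<partial>rates) + hit_discount (1/2) * (\<integral>r. ?T r \<partial>rates)"
    using intS intT by (simp del: times_divide_eq_right)
  also have "\<dots> \<le> (\<integral>r. ?S r \<partial>rates) + (\<integral>r. exp (- ?c r * (1/2)) * ?T r \<partial>rates)"
    using ch(2) by (simp add: hit_discount_def)
  also have "\<dots> = (\<integral>r. ?S r + exp (- ?c r * (1/2)) * ?T r \<partial>rates)"
    using intS ch(1) by simp
  also have "\<dots> = hit_discount (1/2 - x)"
    unfolding hit_discount_def by (intro Bochner_Integration.integral_cong refl) (use eq in simp)
  finally show ?thesis .
qed

text \<open>The exponent \<open>c\<close> with \<open>cosh (c * s) = 1 + r * s\<^sup>2\<close>: it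
  makes \<open>exp (c * x)\<close> and \<open>exp (- c * x)\<close> harmonic for one discounted step
  of size \<open>s\<close>. The half-angle form with \<open>arsinh\<close> can be compared directly
  with the Brownian exponent \<open>sqrt (2 * r)\<close>.\<close>

definition tree_rate :: "real \<Rightarrow> real \<Rightarrow> real" where
  "tree_rate s r = 2 / s * arsinh (s * sqrt (2 * r) / 2)"

lemma cosh_tree_rate:
  assumes "0 < s" "0 \<le> r" shows "cosh (tree_rate s r * s) = 1 + r * s\<^sup>2"
proof -
  have "cosh (2 * arsinh (s * sqrt (2 * r) / 2)) = 1 + 2 * (s * sqrt (2 * r) / 2)\<^sup>2"
    by (simp only: cosh_double cosh_square_eq sinh_arsinh_real)
  then show ?thesis
    using assms by (simp add: tree_rate_def power_mult_distrib power_divide)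
qed

lemma arsinh_le_self:
  fixes z :: real assumes "0 \<le> z" shows "arsinh z \<le> z"
proof (rule ccontr)
  assume "\<not> ?thesis"
  then have "sinh z < sinh (arsinh z)" by (subst sinh_real_less_iff) auto
  then show False using sinh_ge_self[OF assms] by simp
qed

text \<open>Fixes the order of the error: with coefficient 1/2 and
  \<open>sqrt (2 * r) \<le> 2\<close> the grid exponent loses at most \<open>s\<^sup>2\<close>
  against the Brownian one, which is of smaller order than the distance \<open>s / 2\<close> from
  the grid to 1/2.\<close>

lemma arsinh_ge_cubic:
  fixes z :: real assumes "0 \<le> z" shows "z - z ^ 3 / 2 \<le> arsinh z"
proof -
  have "arsinh 0 - (0 - 0 ^ 3 / 2) \<le> arsinh z - (z - z ^ 3 / 2)"
  proof (rule DERIV_nonneg_imp_nondecreasing[OF assms])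
    fix t :: real assume t: "0 \<le> t"
    have "((\<lambda>z. arsinh z - (z - z ^ 3 / 2)) has_real_derivative
        1 / sqrt (t\<^sup>2 + 1) - (1 - 3 * t\<^sup>2 / 2)) (at t)"
      by (auto intro!: derivative_eq_intros)
    moreover have "1 - 3 * t\<^sup>2 / 2 \<le> 1 / sqrt (t\<^sup>2 + 1)"
    proof -
      have "sqrt (t\<^sup>2 + 1) \<le> 1 + t\<^sup>2 / 2"
        by (rule real_le_lsqrt) (auto simp: power2_eq_square algebra_simps mult_nonneg_nonneg t)
      then have "1 / (1 + t\<^sup>2 / 2) \<le> 1 / sqrt (t\<^sup>2 + 1)"
        by (intro divide_left_mono) (auto intro!: mult_pos_pos add_pos_nonneg simp: add_nonneg_pos)
      moreover have "1 - 3 * t\<^sup>2 / 2 \<le> 1 / (1 + t\<^sup>2 / 2)"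
        by (simp add: pos_le_divide_eq add_pos_nonneg) (simp add: algebra_simps)
      ultimately show ?thesis by linarith
    qed
    ultimately show "\<exists>D. ((\<lambda>z. arsinh z - (z - z ^ 3 / 2)) has_real_derivative D) (at t) \<and> 0 \<le> D"
      by (intro exI conjI) auto
  qed
  then show ?thesis by simp
qed

lemma tree_rate_le:
  assumes "0 < s" "0 \<le> r" shows "tree_rate s r \<le> sqrt (2 * r)"
  using arsinh_le_self[of "s * sqrt (2 * r) / 2"] assms
  by (simp add: tree_rate_def field_simps)

lemma tree_rate_ge:
  assumes "0 < s" "r \<in> {1..2}" shows "sqrt (2 * r) - s\<^sup>2 \<le> tree_rate s r"
proof -
  define c where "c = sqrt (2 * r)"
  have c: "0 \<le> c" "c \<le> 2" using sqrt_2r_bounds[OF assms(2)] by (auto simp: c_def)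
  have "c - c ^ 3 * s\<^sup>2 / 8 = 2 / s * (s * c / 2 - (s * c / 2) ^ 3 / 2)"
    using assms by (simp add: field_simps power2_eq_square power3_eq_cube)
  also have "\<dots> \<le> tree_rate s r"
    unfolding tree_rate_def c_def[symmetric]
    using arsinh_ge_cubic[of "s * c / 2"] c assms by (intro mult_left_mono) auto
  finally have "c - c ^ 3 * s\<^sup>2 / 8 \<le> tree_rate s r" .
  moreover have "c ^ 3 * s\<^sup>2 \<le> 2 ^ 3 * s\<^sup>2"
    using c by (intro mult_right_mono power_mono) auto
  ultimately show ?thesis by (simp add: c_def)
qed

lemma tree_rate_pos: "0 < s \<Longrightarrow> 0 < r \<Longrightarrow> 0 < tree_rate s r"
  unfolding tree_rate_def by (intro mult_pos_pos) (auto simp: arsinh_less_iff_real[of 0, simplified])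

lemma tree_rate_mono:
  assumes "0 < s" "r \<le> t" shows "tree_rate s r \<le> tree_rate s t"
proof -
  have "arsinh (s * sqrt (2 * r) / 2) \<le> arsinh (s * sqrt (2 * t) / 2)"
    using assms by (metis (no_types) arsinh_less_iff_real divide_right_mono linorder_not_less mult_left_mono
      real_sqrt_le_iff zero_le_numeral less_imp_le mult_le_cancel_left_pos zero_less_numeral)
  then show ?thesis
    using assms unfolding tree_rate_def by (intro mult_left_mono) auto
qed

lemma continuous_tree_rate [continuous_intros]: "continuous_on A (tree_rate s)"
  unfolding tree_rate_def by (intro continuous_intros) auto

section \<open>Exponential martingales of Brownian motion\<close>

locale brownian =
  fixes M :: "'a measure" and B :: "real \<Rightarrow> 'a \<Rightarrow> real"
  assumes brownian: "standard_brownian_motion M B"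
begin

sublocale prob_space M
  using brownian by (simp add: standard_brownian_motion_def)

lemma B_measurable [measurable]: "0 \<le> t \<Longrightarrow> B t \<in> borel_measurable M"
  using brownian by (simp add: standard_brownian_motion_def)

lemma B_0 [simp]: "\<omega> \<in> space M \<Longrightarrow> B 0 \<omega> = 0"
  using brownian by (simp add: standard_brownian_motion_def)

lemma continuous_B: "\<omega> \<in> space M \<Longrightarrow> continuous_on {0..} (\<lambda>t. B t \<omega>)"
  using brownian by (simp add: standard_brownian_motion_def)

lemma increment_distributed:
  "0 \<le> s \<Longrightarrow> s < t \<Longrightarrow>
    distributed M lborel (\<lambda>\<omega>. B t \<omega> - B s \<omega>) (normal_density 0 (sqrt (t - s)))"
  using brownian by (simp add: standard_brownian_motion_def)

lemma increments_indep:
  "0 \<le> t 0 \<Longrightarrow> mono t \<Longrightarrow>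
    indep_vars (\<lambda>_. borel) (\<lambda>i \<omega>. B (t (Suc i)) \<omega> - B (t i) \<omega>) UNIV"
  using brownian by (simp add: standard_brownian_motion_def)

text \<open>Exponential tilting: the factor only moves the mean from 0 to
  \<open>c * \<sigma>\<^sup>2\<close>, so expectations of the exponential reduce to the total mass
  of a normal density.\<close>

lemma normal_density_exp:
  assumes "0 < \<sigma>"
  shows "normal_density 0 \<sigma> z * exp (c * z - c\<^sup>2 / 2 * \<sigma>\<^sup>2) = normal_density (c * \<sigma>\<^sup>2) \<sigma> z"
proof -
  have "- z\<^sup>2 / (2 * \<sigma>\<^sup>2) + (c * z - c\<^sup>2 / 2 * \<sigma>\<^sup>2) = - (z - c * \<sigma>\<^sup>2)\<^sup>2 / (2 * \<sigma>\<^sup>2)"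
    using assms by (simp add: field_simps power2_eq_square)
  then show ?thesis
    unfolding normal_density_def by (simp flip: exp_add)
qed

lemma exp_increment:
  assumes "0 \<le> s" "s < t"
  shows "integrable M (\<lambda>\<omega>. exp (c * (B t \<omega> - B s \<omega>) - c\<^sup>2 / 2 * (t - s)))"
    and "expectation (\<lambda>\<omega>. exp (c * (B t \<omega> - B s \<omega>) - c\<^sup>2 / 2 * (t - s))) = 1"
proof -
  let ?\<sigma> = "sqrt (t - s)"
  note D = increment_distributed[OF assms]
  have eq: "normal_density 0 ?\<sigma> z * exp (c * z - c\<^sup>2 / 2 * (t - s)) = normal_density (c * (t - s)) ?\<sigma> z" for z
    using normal_density_exp[of ?\<sigma> z c] assms by simp
  have "integrable lborel (\<lambda>z. normal_density 0 ?\<sigma> z * exp (c * z - c\<^sup>2 / 2 * (t - s)))"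
    unfolding eq using assms by simp
  then show "integrable M (\<lambda>\<omega>. exp (c * (B t \<omega> - B s \<omega>) - c\<^sup>2 / 2 * (t - s)))"
    using distributed_integrable[OF D, of "\<lambda>z. exp (c * z - c\<^sup>2 / 2 * (t - s))"] by simp
  have "(\<integral>z. normal_density 0 ?\<sigma> z * exp (c * z - c\<^sup>2 / 2 * (t - s)) \<partial>lborel) = 1"
    unfolding eq using assms by simp
  then show "expectation (\<lambda>\<omega>. exp (c * (B t \<omega> - B s \<omega>) - c\<^sup>2 / 2 * (t - s))) = 1"
    using distributed_integral[OF D, of "\<lambda>z. exp (c * z - c\<^sup>2 / 2 * (t - s))"] by simp
qed

definition exp_mart :: "real \<Rightarrow> real \<Rightarrow> 'a \<Rightarrow> real" where
  "exp_mart c t \<omega> = exp (c * B t \<omega> - c\<^sup>2 / 2 * t)"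

lemma exp_mart_measurable [measurable]: "0 \<le> t \<Longrightarrow> exp_mart c t \<in> borel_measurable M"
  unfolding exp_mart_def by measurable

lemma exp_mart_pos [simp]: "0 < exp_mart c t \<omega>"
  by (simp add: exp_mart_def)

definition grid_hit :: "real \<Rightarrow> real \<Rightarrow> real set \<Rightarrow> nat \<Rightarrow> 'a \<Rightarrow> bool" where
  "grid_hit d x C k \<omega> \<longleftrightarrow> (\<exists>j\<le>k. x + B (real j * d) \<omega> \<in> C)"

text \<open>The first index of a visit to \<open>C\<close>, capped at \<open>k\<close>. With the
  recursion on the cap, raising it from \<open>k\<close> to \<open>k + 1\<close> changes the stopped
  process only while no visit has occurred, and then by one increment.\<close>

primrec grid_stop :: "real \<Rightarrow> real \<Rightarrow> real set \<Rightarrow> nat \<Rightarrow> 'a \<Rightarrow> nat" where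
  "grid_stop d x C 0 \<omega> = 0"
| "grid_stop d x C (Suc k) \<omega> = (if grid_hit d x C k \<omega> then grid_stop d x C k \<omega> else Suc k)"

lemma grid_hit_mono: "grid_hit d x C j \<omega> \<Longrightarrow> j \<le> k \<Longrightarrow> grid_hit d x C k \<omega>"
  unfolding grid_hit_def using le_trans by blast

lemma grid_stop_eq: "\<not> grid_hit d x C k \<omega> \<Longrightarrow> grid_stop d x C k \<omega> = k"
  using grid_hit_mono[of d x C "k - 1" \<omega> k] by (cases k) auto

lemma grid_hit_measurable:
  assumes [measurable]: "C \<in> sets borel" and "0 \<le> d"
  shows "Measurable.pred M (grid_hit d x C k)"
proof -
  have "{\<omega> \<in> space M. x + B (real j * d) \<omega> \<in> C} \<in> events" for j
  proof -
    have [measurable]: "B (real j * d) \<in> borel_measurable M"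
      using assms(2) by (intro B_measurable) simp
    show ?thesis by measurable
  qed
  then have "(\<Union>j\<in>{..k}. {\<omega> \<in> space M. x + B (real j * d) \<omega> \<in> C}) \<in> events"
    by (intro sets.finite_UN) auto
  also have "(\<Union>j\<in>{..k}. {\<omega> \<in> space M. x + B (real j * d) \<omega> \<in> C}) = {\<omega> \<in> space M. grid_hit d x C k \<omega>}"
    by (auto simp: grid_hit_def)
  finally show ?thesis unfolding pred_def .
qed

lemma exp_mart_grid_integrable:
  assumes "0 < d" shows "integrable M (exp_mart c (real k * d))"
proof (cases "k = 0")
  case True
  have "integrable M (exp_mart c 0) \<longleftrightarrow> integrable M (\<lambda>_. 1 :: real)"
    by (intro Bochner_Integration.integrable_cong) (auto simp: exp_mart_def)
  then show ?thesis using True by simp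
next
  case False
  then have "integrable M (\<lambda>\<omega>. exp (c * (B (real k * d) \<omega> - B 0 \<omega>) - c\<^sup>2 / 2 * (real k * d - 0)))"
    using assms by (intro exp_increment) auto
  then show ?thesis
    by (rule Bochner_Integration.integrable_cong[THEN iffD1, rotated 2]) (auto simp: exp_mart_def)
qed

text \<open>Having missed \<open>C\<close> so far and the present value of the martingale depend on
  the first \<open>k\<close> increments, \<open>R k\<close> on the next one. Independence factorises
  the expectation, and \<open>R k\<close> has mean zero.\<close>

lemma alive_increment:
  fixes x c d :: real
  assumes [measurable]: "C \<in> sets borel" and d: "0 < d"
  defines "U \<equiv> \<lambda>k \<omega>. if grid_hit d x C k \<omega> then 0 else exp_mart c (real k * d) \<omega>"
    and "R \<equiv> \<lambda>k \<omega>. exp (c * (B (real (Suc k) * d) \<omega> - B (real k * d) \<omega>) - c\<^sup>2 / 2 * d) - 1"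
  shows "integrable M (\<lambda>\<omega>. U k \<omega> * R k \<omega>)" "expectation (\<lambda>\<omega>. U k \<omega> * R k \<omega>) = 0"
proof -
  let ?t = "\<lambda>k. real k * d"
  define \<Delta> where "\<Delta> = (\<lambda>i \<omega>. B (?t (Suc i)) \<omega> - B (?t i) \<omega>)"
  have ind: "indep_vars (\<lambda>_. borel) \<Delta> UNIV"
    unfolding \<Delta>_def using d by (intro increments_indep) (auto simp: mono_def mult_right_mono)
  \<comment> \<open>Independence is available for increments only, so \<open>F\<close> rebuilds the
    alive event and the martingale from them; partial sums recover the path because \<open>B\<close>
    starts at 0.\<close>
  define F where "F v = (if \<exists>j\<le>k. x + (\<Sum>i<j. v i) \<in> C then 0 else exp (c * (\<Sum>i<k. v i) - c\<^sup>2 / 2 * ?t k))" for v :: "nat \<Rightarrow> real"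
  define G where "G v = exp (c * v k - c\<^sup>2 / 2 * d) - 1" for v :: "nat \<Rightarrow> real"
  have [measurable]: "F \<in> borel_measurable (PiM {..<k} (\<lambda>_. borel))"
  proof -
    have *: "(\<lambda>v. \<Sum>i<j. v i) \<in> borel_measurable (PiM {..<k} (\<lambda>_. borel :: real measure))" if "j \<le> k" for j
      using that by (intro borel_measurable_sum measurable_component_singleton) (auto dest: less_le_trans)
    have **: "{v \<in> space (PiM {..<k} (\<lambda>_. borel)). x + (\<Sum>i<j. v i) \<in> C} \<in> sets (PiM {..<k} (\<lambda>_. borel :: real measure))"
      if "j \<le> k" for j
      using *[OF that] by measurable
    have "(\<Union>j\<in>{..k}. {v \<in> space (PiM {..<k} (\<lambda>_. borel)). x + (\<Sum>i<j. v i) \<in> C})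
       \<in> sets (PiM {..<k} (\<lambda>_. borel :: real measure))"
      by (intro sets.finite_UN **) auto
    also have "(\<Union>j\<in>{..k}. {v \<in> space (PiM {..<k} (\<lambda>_. borel)). x + (\<Sum>i<j. v i) \<in> C})
       = {v \<in> space (PiM {..<k} (\<lambda>_. borel)). \<exists>j\<le>k. x + (\<Sum>i<j. v i) \<in> C}" by auto
    finally have [measurable]: "Measurable.pred (PiM {..<k} (\<lambda>_. borel)) (\<lambda>v. \<exists>j\<le>k. x + (\<Sum>i<j. v i) \<in> C)"
      unfolding pred_def .
    note [measurable] = *[OF order_refl]
    show ?thesis unfolding F_def by measurable
  qed
  have [measurable]: "G \<in> borel_measurable (PiM {k} (\<lambda>_. borel))"
  proof -
    have [measurable]: "(\<lambda>v. v k) \<in> borel_measurable (PiM {k} (\<lambda>_. borel :: real measure))"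
      by (rule measurable_component_singleton) simp
    show ?thesis unfolding G_def by measurable
  qed
  have "indep_var (PiM {..<k} (\<lambda>_. borel)) (\<lambda>\<omega>. restrict (\<lambda>i. \<Delta> i \<omega>) {..<k})
    (PiM {k} (\<lambda>_. borel)) (\<lambda>\<omega>. restrict (\<lambda>i. \<Delta> i \<omega>) {k})"
    by (rule indep_var_restrict[OF ind]) auto
  then have ind2: "indep_var borel (F \<circ> (\<lambda>\<omega>. restrict (\<lambda>i. \<Delta> i \<omega>) {..<k}))
    borel (G \<circ> (\<lambda>\<omega>. restrict (\<lambda>i. \<Delta> i \<omega>) {k}))"
    by (rule indep_var_compose) measurable
  have sum: "(\<Sum>i<j. \<Delta> i \<omega>) = B (?t j) \<omega>" if "\<omega> \<in> space M" for j \<omega>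
    unfolding \<Delta>_def using that by (induction j) auto
  have F: "(F \<circ> (\<lambda>\<omega>. restrict (\<lambda>i. \<Delta> i \<omega>) {..<k})) \<omega> = U k \<omega>" if "\<omega> \<in> space M" for \<omega>
  proof -
    let ?v = "restrict (\<lambda>i. \<Delta> i \<omega>) {..<k}"
    have v: "(\<Sum>i<j. ?v i) = B (?t j) \<omega>" if "j \<le> k" for j
    proof -
      have "(\<Sum>i<j. ?v i) = (\<Sum>i<j. \<Delta> i \<omega>)"
        by (rule sum.cong) (use \<open>j \<le> k\<close> in auto)
      then show ?thesis using sum[OF \<open>\<omega> \<in> space M\<close>] by simp
    qed
    have "(\<exists>j\<le>k. x + (\<Sum>i<j. ?v i) \<in> C) \<longleftrightarrow> grid_hit d x C k \<omega>"
      unfolding grid_hit_def using v by metis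
    then show ?thesis
      unfolding o_def F_def U_def exp_mart_def v[OF order_refl] by (simp only:)
  qed
  have G: "(G \<circ> (\<lambda>\<omega>. restrict (\<lambda>i. \<Delta> i \<omega>) {k})) \<omega> = R k \<omega>" for \<omega>
    by (simp add: G_def R_def \<Delta>_def)
  have [measurable]: "Measurable.pred M (grid_hit d x C k)"
    using d by (intro grid_hit_measurable) auto
  have U: "integrable M (U k)"
  proof (rule Bochner_Integration.integrable_bound[OF exp_mart_grid_integrable[OF d]])
    show "U k \<in> borel_measurable M"
    proof -
      have [measurable]: "exp_mart c (real k * d) \<in> borel_measurable M"
        using d by (intro exp_mart_measurable) auto
      show ?thesis unfolding U_def by measurable
    qed
    show "AE \<omega> in M. norm (U k \<omega>) \<le> norm (exp_mart c (real k * d) \<omega>)"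
      by (auto simp: U_def)
  qed
  have incr: "?t (Suc k) - ?t k = d" by (simp add: algebra_simps)
  have R: "integrable M (R k)" "expectation (R k) = 0"
    using exp_increment[of "?t k" "?t (Suc k)" c, unfolded incr] d prob_space
    unfolding R_def by auto
  have G': "G \<circ> (\<lambda>\<omega>. restrict (\<lambda>i. \<Delta> i \<omega>) {k}) = R k"
    using G by blast
  have U': "integrable M (F \<circ> (\<lambda>\<omega>. restrict (\<lambda>i. \<Delta> i \<omega>) {..<k}))"
    using U by (rule Bochner_Integration.integrable_cong[THEN iffD1, rotated 2]) (simp_all only: F)
  note ind3 = ind2[unfolded G']
  have eq: "U k \<omega> * R k \<omega> = (F \<circ> (\<lambda>\<omega>. restrict (\<lambda>i. \<Delta> i \<omega>) {..<k})) \<omega> * R k \<omega>" if "\<omega> \<in> space M" for \<omega>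
    using F[OF that] by simp
  show "integrable M (\<lambda>\<omega>. U k \<omega> * R k \<omega>)"
    using indep_var_integrable[OF ind3 U' R(1)]
    by (rule Bochner_Integration.integrable_cong[THEN iffD1, rotated 2]) (simp_all only: eq)
  have "expectation (\<lambda>\<omega>. U k \<omega> * R k \<omega>)
      = expectation (\<lambda>\<omega>. (F \<circ> (\<lambda>\<omega>. restrict (\<lambda>i. \<Delta> i \<omega>) {..<k})) \<omega> * R k \<omega>)"
    by (rule Bochner_Integration.integral_cong) (simp_all only: eq)
  also have "\<dots> = 0"
    using indep_var_lebesgue_integral[OF ind3 U' R(1)] R(2) by simp
  finally show "expectation (\<lambda>\<omega>. U k \<omega> * R k \<omega>) = 0" .
qed

lemma optional_stopping_grid:
  assumes C: "C \<in> sets borel" and d: "0 < d"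
  shows "integrable M (\<lambda>\<omega>. exp_mart c (real (grid_stop d x C k \<omega>) * d) \<omega>)"
    "expectation (\<lambda>\<omega>. exp_mart c (real (grid_stop d x C k \<omega>) * d) \<omega>) = 1"
proof (induction k)
  case 0
  have eq: "exp_mart c (real (grid_stop d x C 0 \<omega>) * d) \<omega> = 1" if "\<omega> \<in> space M" for \<omega>
    using that by (simp add: exp_mart_def)
  { case 1
    show ?case
      by (rule Bochner_Integration.integrable_cong[THEN iffD2, OF refl, of _ _ "\<lambda>_. 1"]) (auto simp: eq simp del: grid_stop.simps) }
  { case 2
    have "expectation (\<lambda>\<omega>. exp_mart c (real (grid_stop d x C 0 \<omega>) * d) \<omega>) = expectation (\<lambda>_. 1)"
      by (intro Bochner_Integration.integral_cong) (auto simp: eq simp del: grid_stop.simps)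
    then show ?case by (simp add: prob_space) }
next
  case (Suc k)
  let ?W = "\<lambda>\<omega>. (if grid_hit d x C k \<omega> then 0 else exp_mart c (real k * d) \<omega>)
    * (exp (c * (B (real (Suc k) * d) \<omega> - B (real k * d) \<omega>) - c\<^sup>2 / 2 * d) - 1)"
  have eq: "exp_mart c (real (grid_stop d x C (Suc k) \<omega>) * d) \<omega>
    = exp_mart c (real (grid_stop d x C k \<omega>) * d) \<omega> + ?W \<omega>" for \<omega>
  proof (cases "grid_hit d x C k \<omega>")
    case False
    have "exp_mart c (real k * d) \<omega> * exp (c * (B (real (Suc k) * d) \<omega> - B (real k * d) \<omega>) - c\<^sup>2 / 2 * d)
       = exp_mart c (real (Suc k) * d) \<omega>"
      by (simp add: exp_mart_def algebra_simps flip: exp_add)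
    with False show ?thesis by (simp add: grid_stop_eq algebra_simps)
  qed simp
  note W = alive_increment[OF C d, of x k c]
  { case 1
    show ?case unfolding eq using Suc.IH(1) W(1) by (rule Bochner_Integration.integrable_add) }
  { case 2
    show ?case unfolding eq using Suc.IH W by simp }
qed

lemma grid_stop_le: "grid_stop d x C k \<omega> \<le> k"
  by (induction k) auto

lemma grid_stop_le_hit: "x + B (real j * d) \<omega> \<in> C \<Longrightarrow> grid_stop d x C k \<omega> \<le> j"
proof (induction k)
  case (Suc k)
  then show ?case by (auto simp: grid_hit_def not_less_eq_eq)
qed simp

lemma grid_stop_hit:
  assumes "grid_stop d x C k \<omega> < k" shows "x + B (real (grid_stop d x C k \<omega>) * d) \<omega> \<in> C"
proof -
  have "grid_stop d x C k \<omega> = k \<or> x + B (real (grid_stop d x C k \<omega>) * d) \<omega> \<in> C"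
  proof (induction k)
    case (Suc k)
    show ?case
    proof (cases "grid_hit d x C k \<omega>")
      case True
      then obtain j where "j \<le> k" "x + B (real j * d) \<omega> \<in> C"
        by (auto simp: grid_hit_def)
      with grid_stop_le_hit[of x j d \<omega> C k] have "x + B (real k * d) \<omega> \<in> C" if "grid_stop d x C k \<omega> = k"
        using that by simp
      with Suc True show ?thesis by auto
    qed simp
  qed simp
  with assms show ?thesis by auto
qed

section \<open>Hitting times of continuous paths\<close>

lemma hitting_time_eq:
  assumes "hitting_time B x S \<omega> \<noteq> \<infinity>"
  shows "{t. 0 < t \<and> x + B t \<omega> \<in> S} \<noteq> {}"
    and "hitting_time B x S \<omega> = ereal (Inf {t. 0 < t \<and> x + B t \<omega> \<in> S})"
proof -
  show *: "{t. 0 < t \<and> x + B t \<omega> \<in> S} \<noteq> {}"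
  proof
    assume "{t. 0 < t \<and> x + B t \<omega> \<in> S} = {}"
    then have "hitting_time B x S \<omega> = \<infinity>"
      unfolding hitting_time_def by (simp only: image_empty Inf_empty top_ereal_def)
    with assms show False by simp
  qed
  show "hitting_time B x S \<omega> = ereal (Inf {t. 0 < t \<and> x + B t \<omega> \<in> S})"
    unfolding hitting_time_def using * by (intro ereal_Inf'[symmetric] bdd_belowI[of _ 0]) auto
qed

lemma hitting_time_nonneg: "0 \<le> hitting_time B x S \<omega>"
  unfolding hitting_time_def by (intro INF_greatest) auto

lemma before_hitting_time:
  assumes "0 < t" "ereal t < hitting_time B x S \<omega>" shows "x + B t \<omega> \<notin> S"
proof
  assume "x + B t \<omega> \<in> S"
  then have "hitting_time B x S \<omega> \<le> ereal t"
    unfolding hitting_time_def using assms by (intro INF_lower) auto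
  with assms show False by simp
qed

lemma at_hitting_time:
  assumes "\<omega> \<in> space M" "closed S" "hitting_time B x S \<omega> \<noteq> \<infinity>"
  shows "x + B (real_of_ereal (hitting_time B x S \<omega>)) \<omega> \<in> S"
proof -
  let ?P = "{t. 0 < t \<and> x + B t \<omega> \<in> S}"
  \<comment> \<open>Time 0 is included here because the infimum of positive hitting times may be
    0.\<close>
  have "closed ({0..} \<inter> (\<lambda>t. x + B t \<omega>) -` S)"
    using continuous_B[OF assms(1)] assms(2)
    by (intro continuous_closed_preimage continuous_intros) auto
  moreover have "Inf ?P \<in> closure ?P"
    using hitting_time_eq(1)[OF assms(3)] by (intro closure_contains_Inf bdd_belowI[of _ 0]) auto
  moreover have "?P \<subseteq> {0..} \<inter> (\<lambda>t. x + B t \<omega>) -` S" by auto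
  ultimately have "Inf ?P \<in> {0..} \<inter> (\<lambda>t. x + B t \<omega>) -` S"
    using closure_minimal by blast
  then show ?thesis
    using hitting_time_eq(2)[OF assms(3)] by simp
qed

end

text \<open>\<open>N\<close> refines a time grid and \<open>m\<close> shrinks a neighbourhood of
  \<open>S\<close>. How fine the grid must be depends on \<open>m\<close> and on the path, so there
  is no joint limit; the inner limit need not exist either, only eventual closeness.\<close>

definition iterated_lim :: "(nat \<Rightarrow> nat \<Rightarrow> real) \<Rightarrow> real \<Rightarrow> bool" where
  "iterated_lim Z z \<longleftrightarrow> (\<forall>e>0. \<forall>\<^sub>F m in sequentially. \<forall>\<^sub>F N in sequentially. \<bar>Z m N - z\<bar> < e)"

lemma iterated_lim_compose:
  assumes "iterated_lim t \<rho>" "\<And>m N. t m N \<in> A" "\<rho> \<in> A" "continuous_on A g"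
  shows "iterated_lim (\<lambda>m N. g (t m N)) (g \<rho>)"
  unfolding iterated_lim_def
proof (intro allI impI)
  fix e :: real assume "0 < e"
  then obtain d where d: "0 < d" "\<And>y. y \<in> A \<Longrightarrow> dist y \<rho> < d \<Longrightarrow> dist (g y) (g \<rho>) < e"
    using assms(3,4) unfolding continuous_on_iff by metis
  from assms(1) d(1) have "\<forall>\<^sub>F m in sequentially. \<forall>\<^sub>F N in sequentially. \<bar>t m N - \<rho>\<bar> < d"
    unfolding iterated_lim_def by blast
  then show "\<forall>\<^sub>F m in sequentially. \<forall>\<^sub>F N in sequentially. \<bar>g (t m N) - g \<rho>\<bar> < e"
    by (elim eventually_mono) (use d(2) assms(2) in \<open>auto simp: dist_real_def\<close>)
qed

lemma le_liminf_iterated_lim: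
  assumes "iterated_lim Z z" "\<And>m N. 0 \<le> Z m N" "0 \<le> z"
  shows "ennreal z \<le> liminf (\<lambda>m. liminf (\<lambda>N. ennreal (Z m N)))"
proof (rule ennreal_le_epsilon)
  fix e :: real assume "0 < e"
  with assms(1) have ev: "\<forall>\<^sub>F m in sequentially. \<forall>\<^sub>F N in sequentially. \<bar>Z m N - z\<bar> < e"
    unfolding iterated_lim_def by blast
  have "ennreal (z - e) \<le> liminf (\<lambda>m. liminf (\<lambda>N. ennreal (Z m N)))"
  proof (rule Liminf_bounded, rule eventually_mono[OF ev])
    fix m assume "\<forall>\<^sub>F N in sequentially. \<bar>Z m N - z\<bar> < e"
    then show "ennreal (z - e) \<le> liminf (\<lambda>N. ennreal (Z m N))"
      by (intro Liminf_bounded) (auto elim!: eventually_mono intro!: ennreal_leI)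
  qed
  then have "ennreal (z - e) + ennreal e \<le> liminf (\<lambda>m. liminf (\<lambda>N. ennreal (Z m N))) + ennreal e"
    by (rule add_right_mono)
  moreover have "ennreal z \<le> ennreal (z - e) + ennreal e"
    using \<open>0 < e\<close> by (cases "e \<le> z") (auto simp: ennreal_leI ennreal_neg simp flip: ennreal_plus)
  ultimately show "ennreal z \<le> liminf (\<lambda>m. liminf (\<lambda>N. ennreal (Z m N))) + ennreal e"
    by (rule order_trans[rotated])
qed

text \<open>Fatou's lemma, once for each index.\<close>

lemma nn_integral_iterated_lim_le:
  assumes [measurable]: "\<And>m N. Z m N \<in> borel_measurable M"
    and lim: "\<And>\<omega>. \<omega> \<in> space M \<Longrightarrow> iterated_lim (\<lambda>m N. Z m N \<omega>) (z \<omega>)"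
    and nn: "\<And>m N \<omega>. 0 \<le> Z m N \<omega>" "\<And>\<omega>. 0 \<le> z \<omega>"
    and b: "\<And>m N. (\<integral>\<^sup>+\<omega>. ennreal (Z m N \<omega>) \<partial>M) \<le> b"
  shows "(\<integral>\<^sup>+\<omega>. ennreal (z \<omega>) \<partial>M) \<le> b"
proof -
  have "(\<integral>\<^sup>+\<omega>. ennreal (z \<omega>) \<partial>M) \<le> (\<integral>\<^sup>+\<omega>. liminf (\<lambda>m. liminf (\<lambda>N. ennreal (Z m N \<omega>))) \<partial>M)"
    by (intro nn_integral_mono le_liminf_iterated_lim lim nn) auto
  also have "\<dots> \<le> liminf (\<lambda>m. \<integral>\<^sup>+\<omega>. liminf (\<lambda>N. ennreal (Z m N \<omega>)) \<partial>M)"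
    by (intro nn_integral_liminf) measurable
  also have "\<dots> \<le> liminf (\<lambda>m. liminf (\<lambda>N. \<integral>\<^sup>+\<omega>. ennreal (Z m N \<omega>) \<partial>M))"
    by (intro Liminf_mono always_eventually allI nn_integral_liminf) measurable
  also have "\<dots> \<le> liminf (\<lambda>m. liminf (\<lambda>N::nat. b))"
    by (intro Liminf_mono always_eventually allI b)
  also have "\<dots> = b" by (simp add: Liminf_const)
  finally show ?thesis .
qed

text \<open>No single sequence converges to \<open>z\<close>, so the event that \<open>z\<close>
  exceeds \<open>a\<close> is written with countably many quantifiers. Processes evaluated at a
  hitting time get their measurability from here.\<close>

lemma measurable_iterated_lim:
  assumes [measurable]: "\<And>m N. Z m N \<in> borel_measurable M"
    and lim: "\<And>\<omega>. \<omega> \<in> space M \<Longrightarrow> iterated_lim (\<lambda>m N. Z m N \<omega>) (z \<omega>)"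
  shows "z \<in> borel_measurable M"
  unfolding borel_measurable_iff_greater
proof
  fix a :: real
  let ?Q = "\<lambda>\<omega>. \<exists>k m0. \<forall>m\<ge>m0. \<exists>N0. \<forall>N\<ge>N0. a + 1 / real (Suc k) \<le> Z m N \<omega>"
  have "a < z \<omega> \<longleftrightarrow> ?Q \<omega>" if "\<omega> \<in> space M" for \<omega>
  proof
    assume "a < z \<omega>"
    then obtain k where k: "1 / real (Suc k) < z \<omega> - a"
      using nat_approx_posE[of "z \<omega> - a"] by auto
    with lim[OF that] have "\<forall>\<^sub>F m in sequentially. \<forall>\<^sub>F N in sequentially.
        \<bar>Z m N \<omega> - z \<omega>\<bar> < z \<omega> - a - 1 / real (Suc k)"
      unfolding iterated_lim_def by (metis diff_gt_0_iff_gt)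
    then have "\<forall>\<^sub>F m in sequentially. \<forall>\<^sub>F N in sequentially. a + 1 / real (Suc k) \<le> Z m N \<omega>"
      by (elim eventually_mono) auto
    then show "?Q \<omega>" unfolding eventually_sequentially by blast
  next
    assume "?Q \<omega>"
    then obtain k where k: "\<forall>\<^sub>F m in sequentially. \<forall>\<^sub>F N in sequentially. a + 1 / real (Suc k) \<le> Z m N \<omega>"
      unfolding eventually_sequentially by blast
    have "\<forall>\<^sub>F m in sequentially. \<forall>\<^sub>F N in sequentially. \<bar>Z m N \<omega> - z \<omega>\<bar> < 1 / real (Suc k)"
      using lim[OF that] unfolding iterated_lim_def by simp
    with k have "\<forall>\<^sub>F m in sequentially. \<forall>\<^sub>F N in sequentially. a < z \<omega>"
    proof eventually_elim
      case (elim m)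
      then show ?case by eventually_elim linarith
    qed
    then show "a < z \<omega>" by simp
  qed
  then have "{\<omega> \<in> space M. a < z \<omega>} = {\<omega> \<in> space M. ?Q \<omega>}" by auto
  also have "\<dots> \<in> sets M" by measurable
  finally show "{\<omega> \<in> space M. a < z \<omega>} \<in> sets M" .
qed

text \<open>A path sampled on a time grid usually misses \<open>S\<close> itself, but on a fine grid
  it cannot miss a neighbourhood of a visited point.\<close>

definition near :: "real set \<Rightarrow> nat \<Rightarrow> real set" where
  "near S m = {y. infdist y S \<le> 1 / real (Suc m)}"

lemma near_borel: "near S m \<in> sets borel"
  unfolding near_def by (intro borel_closed closed_Collect_le continuous_intros)

section \<open>Approximation of a hitting time by stopping on time grids\<close>

context brownian
begin

lemma hitting_time_pos:
  assumes "\<omega> \<in> space M" "closed S" "x \<notin> S" shows "0 < hitting_time B x S \<omega>"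
proof (rule ccontr)
  assume "\<not> ?thesis"
  then have "hitting_time B x S \<omega> = 0" using hitting_time_nonneg[of x S \<omega>] by simp
  with at_hitting_time[OF assms(1,2), of x] assms show False by simp
qed

lemma exp_mart_nonneg [simp]: "0 \<le> exp_mart c t \<omega>"
  by (simp add: exp_mart_def)

definition hit_min :: "real \<Rightarrow> real set \<Rightarrow> real \<Rightarrow> 'a \<Rightarrow> real" where
  "hit_min x S T \<omega> = real_of_ereal (min (hitting_time B x S \<omega>) (ereal T))"

lemma hit_min_cases:
  assumes "0 \<le> T"
  obtains "ereal T \<le> hitting_time B x S \<omega>" "hit_min x S T \<omega> = T"
  | t where "hitting_time B x S \<omega> = ereal t" "0 \<le> t" "t < T" "hit_min x S T \<omega> = t"
proof (cases "ereal T \<le> hitting_time B x S \<omega>")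
  case True
  then show ?thesis using that(1) by (simp add: hit_min_def min_absorb2)
next
  case False
  then obtain t where t: "hitting_time B x S \<omega> = ereal t"
    using hitting_time_nonneg[of x S \<omega>] by (cases "hitting_time B x S \<omega>") auto
  then have "hit_min x S T \<omega> = t" using False by (simp add: hit_min_def min_absorb1)
  with t False that(2) hitting_time_nonneg[of x S \<omega>] show ?thesis by simp
qed

lemma hit_min_bounds:
  assumes "0 \<le> T" shows "0 \<le> hit_min x S T \<omega>" "hit_min x S T \<omega> \<le> T"
  using assms by (cases rule: hit_min_cases[OF assms, of x S \<omega>]; simp)+

lemma hit_min_le: "0 \<le> T \<Longrightarrow> ereal (hit_min x S T \<omega>) \<le> hitting_time B x S \<omega>"
  by (cases rule: hit_min_cases[of T x S \<omega>]) auto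

text \<open>Mesh \<open>T / (N + 1)\<close> and cap \<open>N + 1\<close>, so that an unsuccessful
  search ends exactly at \<open>T\<close>.\<close>

definition approx_time :: "real \<Rightarrow> real set \<Rightarrow> real \<Rightarrow> nat \<Rightarrow> nat \<Rightarrow> 'a \<Rightarrow> real" where
  "approx_time x S T m N \<omega> =
     real (grid_stop (T / real (Suc N)) x (near S m) (Suc N) \<omega>) * (T / real (Suc N))"

lemma approx_time_bounds:
  assumes "0 \<le> T" shows "0 \<le> approx_time x S T m N \<omega>" "approx_time x S T m N \<omega> \<le> T"
proof -
  show "0 \<le> approx_time x S T m N \<omega>" using assms by (simp add: approx_time_def)
  have "approx_time x S T m N \<omega> \<le> real (Suc N) * (T / real (Suc N))"
    unfolding approx_time_def using assms
    by (intro mult_right_mono of_nat_mono grid_stop_le divide_nonneg_nonneg) auto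
  then show "approx_time x S T m N \<omega> \<le> T" by simp
qed

text \<open>Until shortly before the hitting time the path keeps a positive distance from
  \<open>S\<close>, so small neighbourhoods are not visited and the approximation cannot stop too
  early. If the hit comes before \<open>T\<close>, the path is close to \<open>S\<close> at the last
  grid time before it, so on a fine grid the approximation cannot stop late.\<close>

lemma approx_time_lim:
  assumes \<omega>: "\<omega> \<in> space M" and S: "closed S" "S \<noteq> {}" "x \<notin> S" and T: "0 < T"
  shows "iterated_lim (\<lambda>m N. approx_time x S T m N \<omega>) (hit_min x S T \<omega>)"
  unfolding iterated_lim_def
proof (intro allI impI)
  fix e :: real assume e: "0 < e"
  let ?\<rho> = "hit_min x S T \<omega>" and ?g = "\<lambda>t. infdist (x + B t \<omega>) S"
  have cont: "continuous_on {0..} ?g"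
    using continuous_B[OF \<omega>] by (intro continuous_intros)
  have off: "x + B t \<omega> \<notin> S" if "0 \<le> t" "t < ?\<rho>" for t
  proof (cases "t = 0")
    case False
    have "ereal t < hitting_time B x S \<omega>"
      using that hit_min_le[of T x S \<omega>] T by (meson ereal_less_eq(3) less_le_trans less_ereal.simps(1) less_imp_le)
    then show ?thesis using before_hitting_time[of t x S \<omega>] that False by auto
  qed (use \<omega> S in simp)
  \<comment> \<open>A lower bound for the distance to \<open>S\<close> up to time
    \<open>?\<rho> - e / 2\<close>; if that time is negative, any positive value serves.\<close>
  obtain b where b: "0 < b" "\<And>t. 0 \<le> t \<Longrightarrow> t \<le> ?\<rho> - e / 2 \<Longrightarrow> b \<le> ?g t"
  proof (cases "0 \<le> ?\<rho> - e / 2")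
    case True
    have "continuous_on {0..?\<rho> - e / 2} ?g"
      by (rule continuous_on_subset[OF cont]) auto
    then obtain t where t: "t \<in> {0..?\<rho> - e / 2}" "\<And>s. s \<in> {0..?\<rho> - e / 2} \<Longrightarrow> ?g t \<le> ?g s"
      using continuous_attains_inf[of "{0..?\<rho> - e / 2}" ?g] True by auto
    have "0 < ?g t"
      using off[of t] t(1) e S by (intro infdist_pos_not_in_closed) auto
    with t(2) that[of "?g t"] show ?thesis by auto
  next
    case False
    then show ?thesis using that[of 1] by auto
  qed
  obtain m0 where m0: "1 / real (Suc m0) < b"
    using b(1) nat_approx_posE by blast
  show "\<forall>\<^sub>F m in sequentially. \<forall>\<^sub>F N in sequentially. \<bar>approx_time x S T m N \<omega> - ?\<rho>\<bar> < e"
    using eventually_ge_at_top[of m0]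
  proof eventually_elim
    case (elim m)
    have m: "1 / real (Suc m) < b"
      using m0 elim by (smt (verit) frac_le of_nat_0_less_iff of_nat_mono Suc_le_mono zero_less_Suc)
    have lower: "?\<rho> - e < approx_time x S T m N \<omega>" for N
    proof (rule ccontr)
      assume *: "\<not> ?thesis"
      let ?d = "T / real (Suc N)"
      let ?k = "grid_stop ?d x (near S m) (Suc N) \<omega>"
      have d: "0 < ?d" using T by simp
      have "real ?k * ?d < T"
        using * e hit_min_bounds(2)[of T x S \<omega>] T by (simp add: approx_time_def)
      then have "?k < Suc N"
        by (metis T d grid_stop_le le_neq_implies_less less_irrefl nonzero_mult_div_cancel_left
            of_nat_0_less_iff times_divide_eq_right zero_less_Suc less_numeral_extra(3))
      then have "x + B (real ?k * ?d) \<omega> \<in> near S m"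
        by (rule grid_stop_hit)
      then have "?g (approx_time x S T m N \<omega>) < b"
        using m by (simp add: near_def approx_time_def)
      moreover have "b \<le> ?g (approx_time x S T m N \<omega>)"
        using * e T approx_time_bounds(1)[of T] by (intro b(2)) auto
      ultimately show False by simp
    qed
    have "\<forall>\<^sub>F N in sequentially. approx_time x S T m N \<omega> \<le> ?\<rho>"
    proof (cases rule: hit_min_cases[OF less_imp_le[OF T], of x S \<omega>])
      case 1
      then show ?thesis using approx_time_bounds(2)[of T x S m] T by simp
    next
      case (2 t)
      have tS: "x + B t \<omega> \<in> S" using at_hitting_time[OF \<omega> S(1), of x] 2 by simp
      have "0 < t" using hitting_time_pos[OF \<omega> S(1,3)] 2 by simp
      obtain \<eta> where \<eta>: "0 < \<eta>" "\<And>s. 0 \<le> s \<Longrightarrow> dist s t < \<eta> \<Longrightarrow> dist (?g s) (?g t) < 1 / real (Suc m)"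
        using cont \<open>0 < t\<close> unfolding continuous_on_iff
        by (metis atLeast_iff divide_pos_pos less_imp_le of_nat_0_less_iff zero_less_Suc zero_less_one)
      obtain N0 where N0: "T / real (Suc N0) < \<eta>"
      proof -
        obtain N0 where "1 / real (Suc N0) < \<eta> / T" using \<eta>(1) T nat_approx_posE[of "\<eta> / T"] by auto
        then show ?thesis using that[of N0] T by (simp add: field_simps)
      qed
      show ?thesis
        using eventually_ge_at_top[of N0]
      proof eventually_elim
        case (elim N)
        let ?d = "T / real (Suc N)"
        have d: "0 < ?d" "?d < \<eta>"
        proof -
          show "0 < ?d" using T by simp
          have "?d \<le> T / real (Suc N0)" using T elim by (intro divide_left_mono) auto
          then show "?d < \<eta>" using N0 by simp
        qed
        \<comment> \<open>The last grid time up to \<open>t\<close>: stopping there is at most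
          \<open>t\<close>, not merely close to it.\<close>
        define j where "j = nat \<lfloor>t / ?d\<rfloor>"
        have j: "real j \<le> t / ?d" "t / ?d < real j + 1"
        proof -
          have "0 \<le> t / ?d" using divide_pos_pos[OF \<open>0 < t\<close> d(1)] by simp
          then show "real j \<le> t / ?d" "t / ?d < real j + 1"
            unfolding j_def by linarith+
        qed
        have jd: "real j * ?d \<le> t" "t < real j * ?d + ?d"
          using j unfolding pos_le_divide_eq[OF d(1)] pos_divide_less_eq[OF d(1)]
          by (simp_all only: distrib_right mult_1)
        have "dist (?g (real j * ?d)) (?g t) < 1 / real (Suc m)"
          using jd d \<open>0 < t\<close> T by (intro \<eta>(2)) (auto simp: dist_real_def)
        then have "x + B (real j * ?d) \<omega> \<in> near S m"
          using tS by (simp add: near_def dist_real_def)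
        then have "grid_stop ?d x (near S m) (Suc N) \<omega> \<le> j"
          by (rule grid_stop_le_hit)
        then have "approx_time x S T m N \<omega> \<le> real j * ?d"
          unfolding approx_time_def using d by (intro mult_right_mono) auto
        then show ?case using jd 2 by simp
      qed
    qed
    then show ?case
    proof eventually_elim
      case (elim N)
      then show ?case using lower[of N] e by simp
    qed
  qed
qed

text \<open>The sign of \<open>c\<close> tells on which side of \<open>x\<close> the point
  \<open>a\<close> lies. To get beyond \<open>a\<close> the path has to cross it strictly earlier,
  and \<open>a\<close> belongs to \<open>S\<close>.\<close>

lemma below_level:
  assumes \<omega>: "\<omega> \<in> space M" and a: "a \<in> S" "0 < c * (a - x)"
    and t: "0 \<le> t" "ereal t \<le> hitting_time B x S \<omega>"
  shows "c * B t \<omega> \<le> c * (a - x)"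
proof (rule ccontr)
  assume *: "\<not> ?thesis"
  have "continuous_on {0..t} (\<lambda>s. c * B s \<omega>)"
    using continuous_on_subset[OF continuous_B[OF \<omega>], of "{0..t}"] by (intro continuous_intros) auto
  then obtain s where s: "0 \<le> s" "s \<le> t" "c * B s \<omega> = c * (a - x)"
    using IVT'[of "\<lambda>s. c * B s \<omega>" 0 "c * (a - x)" t] * a \<omega> t(1) by auto
  have "s \<noteq> t" "s \<noteq> 0" using s * a \<omega> by auto
  then have "ereal s < ereal t" "0 < s" using s by auto
  then have "x + B s \<omega> \<notin> S"
    using t(2) less_le_trans by (intro before_hitting_time) blast+
  moreover have "B s \<omega> = a - x" using s(3) a(2) by auto
  ultimately show False using a(1) by simp
qed

section \<open>Optional stopping at the hitting time of a closed set\<close>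

context
  fixes S :: "real set" and a x c :: real
  assumes S: "closed S" "a \<in> S" "x \<notin> S" and c: "0 < c * (a - x)"
begin

lemma exp_mart_hit_min_le:
  assumes "\<omega> \<in> space M" "0 \<le> T"
  shows "exp_mart c (hit_min x S T \<omega>) \<omega> \<le> exp (c * (a - x))"
proof -
  have "c * B (hit_min x S T \<omega>) \<omega> \<le> c * (a - x)"
    using hit_min_bounds[OF assms(2)] hit_min_le[OF assms(2)] by (intro below_level[OF assms(1) S(2) c])
  moreover have "0 \<le> c\<^sup>2 / 2 * hit_min x S T \<omega>"
    using hit_min_bounds[OF assms(2)] by simp
  ultimately show ?thesis by (simp add: exp_mart_def)
qed

lemma approx_exp_mart:
  assumes "0 < T"
  shows "integrable M (\<lambda>\<omega>. exp_mart c' (approx_time x S T m N \<omega>) \<omega>)"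
    "expectation (\<lambda>\<omega>. exp_mart c' (approx_time x S T m N \<omega>) \<omega>) = 1"
  unfolding approx_time_def using assms
  by (intro optional_stopping_grid near_borel divide_pos_pos; simp)+

lemma exp_mart_lim:
  assumes "\<omega> \<in> space M" "0 < T"
  shows "iterated_lim (\<lambda>m N. exp_mart c' (approx_time x S T m N \<omega>) \<omega>) (exp_mart c' (hit_min x S T \<omega>) \<omega>)"
proof (rule iterated_lim_compose[where g = "\<lambda>t. exp_mart c' t \<omega>" and A = "{0..}"])
  show "iterated_lim (\<lambda>m N. approx_time x S T m N \<omega>) (hit_min x S T \<omega>)"
    using S assms by (intro approx_time_lim) auto
  show "continuous_on {0..} (\<lambda>t. exp_mart c' t \<omega>)"
    unfolding exp_mart_def by (intro continuous_intros continuous_B assms)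
qed (use assms hit_min_bounds approx_time_bounds in auto)

lemma exp_mart_hit_min_measurable:
  assumes "0 < T" shows "(\<lambda>\<omega>. exp_mart c' (hit_min x S T \<omega>) \<omega>) \<in> borel_measurable M"
proof (rule measurable_iterated_lim)
  show "(\<lambda>\<omega>. exp_mart c' (approx_time x S T m N \<omega>) \<omega>) \<in> borel_measurable M" for m N
    by (rule borel_measurable_integrable[OF approx_exp_mart(1)[OF assms]])
qed (rule exp_mart_lim[OF _ assms])

lemma exp_mart_hit_min_integrable:
  assumes "0 < T" shows "integrable M (\<lambda>\<omega>. exp_mart c (hit_min x S T \<omega>) \<omega>)"
  using exp_mart_hit_min_le[of _ T] assms
  by (intro integrable_const_bound[where B = "exp (c * (a - x))"] exp_mart_hit_min_measurable)
     (auto simp: less_imp_le)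

text \<open>Fatou yields this half only. The sampled process can overshoot \<open>a\<close> by any
  amount, so there is no common bound for dominated convergence.\<close>

lemma expectation_exp_mart_hit_min_le:
  assumes "0 < T" shows "expectation (\<lambda>\<omega>. exp_mart c (hit_min x S T \<omega>) \<omega>) \<le> 1"
proof -
  have "(\<integral>\<^sup>+\<omega>. ennreal (exp_mart c (hit_min x S T \<omega>) \<omega>) \<partial>M) \<le> ennreal 1"
  proof (rule nn_integral_iterated_lim_le[OF borel_measurable_integrable[OF approx_exp_mart(1)[OF assms]]
        exp_mart_lim[OF _ assms]])
    fix m N
    show "(\<integral>\<^sup>+\<omega>. ennreal (exp_mart c (approx_time x S T m N \<omega>) \<omega>) \<partial>M) \<le> ennreal 1"
      using approx_exp_mart[OF assms, of c m N]
      by (subst nn_integral_eq_integral) (auto intro: less_imp_le)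
  qed (auto intro: less_imp_le)
  then show ?thesis
    using exp_mart_hit_min_integrable[OF assms]
    by (subst (asm) nn_integral_eq_integral) (auto intro: less_imp_le)
qed

text \<open>The overshoot of the approximating stopped processes is controlled by their second moment:
  truncation at level \<open>K\<close> costs at most \<open>exp (c\<^sup>2 T) / K\<close>.\<close>

lemma expectation_exp_mart_hit_min_ge:
  assumes T: "0 < T" and K: "exp (c * (a - x)) \<le> K"
  shows "1 - exp (c\<^sup>2 * T) / K \<le> expectation (\<lambda>\<omega>. exp_mart c (hit_min x S T \<omega>) \<omega>)"
proof -
  have "0 < K" using K exp_gt_zero less_le_trans by blast
  let ?Z = "\<lambda>m N \<omega>. exp_mart c (approx_time x S T m N \<omega>) \<omega>"
  let ?z = "\<lambda>\<omega>. exp_mart c (hit_min x S T \<omega>) \<omega>"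
  \<comment> \<open>The square of the martingale with parameter \<open>c\<close> is the one with
    parameter \<open>2 * c\<close>, whose stopped mean is again 1, times a factor bounded up to time
    \<open>T\<close>.\<close>
  have sq: "(?Z m N \<omega>)\<^sup>2 \<le> exp_mart (2 * c) (approx_time x S T m N \<omega>) \<omega> * exp (c\<^sup>2 * T)" for m N \<omega>
  proof -
    let ?t = "approx_time x S T m N \<omega>"
    have "(?Z m N \<omega>)\<^sup>2 = exp_mart (2 * c) ?t \<omega> * exp (c\<^sup>2 * ?t)"
      by (simp add: exp_mart_def power2_eq_square algebra_simps flip: exp_add)
    also have "\<dots> \<le> exp_mart (2 * c) ?t \<omega> * exp (c\<^sup>2 * T)"
      using approx_time_bounds[of T x S m N \<omega>] T
      by (intro mult_left_mono) (auto intro: mult_left_mono less_imp_le)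
    finally show ?thesis .
  qed
  \<comment> \<open>Truncating at \<open>K\<close> changes \<open>z\<close> only where
    \<open>z\<close> exceeds \<open>K\<close>, and there
    \<open>z \<le> z\<^sup>2 / K\<close>.\<close>
  have trunc: "K - min K z \<le> K - z + z\<^sup>2 / K" if "0 < z" for z
  proof (cases "z \<le> K")
    case False
    then have "z * K \<le> z * z" using that by (intro mult_left_mono) auto
    then have "z \<le> z\<^sup>2 / K" using \<open>0 < K\<close> by (simp add: field_simps power2_eq_square)
    then show ?thesis using False \<open>0 < K\<close> by simp
  qed (use \<open>0 < K\<close> in simp)
  have "(\<integral>\<^sup>+\<omega>. ennreal (K - min K (?z \<omega>)) \<partial>M) \<le> ennreal (K - 1 + exp (c\<^sup>2 * T) / K)"
  proof (rule nn_integral_iterated_lim_le[where Z = "\<lambda>m N \<omega>. K - min K (?Z m N \<omega>)"])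
    fix m N
    note [measurable] = borel_measurable_integrable[OF approx_exp_mart(1)[OF T]]
    show meas: "(\<lambda>\<omega>. K - min K (?Z m N \<omega>)) \<in> borel_measurable M" by measurable
    have int: "integrable M (\<lambda>\<omega>. K - min K (?Z m N \<omega>))"
      using \<open>0 < K\<close>
      by (intro integrable_const_bound[where B = K] meas) (auto simp: min_def less_imp_le)
    let ?U = "\<lambda>\<omega>. K - ?Z m N \<omega> + exp_mart (2 * c) (approx_time x S T m N \<omega>) \<omega> * (exp (c\<^sup>2 * T) / K)"
    have intU: "integrable M ?U"
      using approx_exp_mart[OF T] by (intro Bochner_Integration.integrable_add Bochner_Integration.integrable_diff integrable_mult_left) auto
    have "expectation (\<lambda>\<omega>. K - min K (?Z m N \<omega>)) \<le> expectation ?U"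
    proof (rule integral_mono[OF int intU])
      fix \<omega>
      have "(?Z m N \<omega>)\<^sup>2 / K \<le> exp_mart (2 * c) (approx_time x S T m N \<omega>) \<omega> * exp (c\<^sup>2 * T) / K"
        using sq \<open>0 < K\<close> by (intro divide_right_mono) auto
      with trunc[of "?Z m N \<omega>"] show "K - min K (?Z m N \<omega>) \<le> ?U \<omega>" by simp
    qed
    also have "expectation ?U = K - 1 + exp (c\<^sup>2 * T) / K"
      using approx_exp_mart[OF T] by (simp add: prob_space del: times_divide_eq_right)
    finally show "(\<integral>\<^sup>+\<omega>. ennreal (K - min K (?Z m N \<omega>)) \<partial>M) \<le> ennreal (K - 1 + exp (c\<^sup>2 * T) / K)"
      using int by (subst nn_integral_eq_integral) (auto intro: ennreal_leI)
  next
    fix \<omega> assume "\<omega> \<in> space M"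
    from iterated_lim_compose[OF exp_mart_lim[OF this T, of c], where A = UNIV and g = "\<lambda>y. K - min K y"]
    show "iterated_lim (\<lambda>m N. K - min K (?Z m N \<omega>)) (K - min K (?z \<omega>))"
      by (simp add: continuous_on_diff continuous_on_min)
  qed auto
  \<comment> \<open>In the limit there is no overshoot: the stopped martingale is at most
    \<open>exp (c * (a - x)) \<le> K\<close>, so the truncation disappears.\<close>
  moreover have "(\<integral>\<^sup>+\<omega>. ennreal (K - min K (?z \<omega>)) \<partial>M) = (\<integral>\<^sup>+\<omega>. ennreal (K - ?z \<omega>) \<partial>M)"
    using exp_mart_hit_min_le[of _ T] K T by (intro nn_integral_cong) (force simp: min_def)
  moreover have "(\<integral>\<^sup>+\<omega>. ennreal (K - ?z \<omega>) \<partial>M) = ennreal (expectation (\<lambda>\<omega>. K - ?z \<omega>))"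
    using exp_mart_hit_min_integrable[OF T] exp_mart_hit_min_le[of _ T] K T
    by (intro nn_integral_eq_integral) (auto intro!: AE_I2 intro: order_trans)
  moreover have "expectation (\<lambda>\<omega>. K - ?z \<omega>) = K - expectation ?z"
    using exp_mart_hit_min_integrable[OF T] by (simp add: prob_space)
  moreover have "0 \<le> K - 1 + exp (c\<^sup>2 * T) / K"
    using K c \<open>0 < K\<close> by (smt (verit) divide_nonneg_pos exp_ge_zero one_le_exp_iff)
  ultimately show ?thesis by (simp add: ennreal_le_iff)
qed

lemma expectation_exp_mart_hit_min:
  assumes "0 < T" shows "expectation (\<lambda>\<omega>. exp_mart c (hit_min x S T \<omega>) \<omega>) = 1"
proof (rule antisym[OF expectation_exp_mart_hit_min_le[OF assms]])
  have "((\<lambda>K. 1 - exp (c\<^sup>2 * T) / K) \<longlongrightarrow> 1 - 0) at_top"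
    by (intro tendsto_intros tendsto_divide_0[OF tendsto_const] filterlim_at_top_imp_at_infinity filterlim_ident)
  then show "1 \<le> expectation (\<lambda>\<omega>. exp_mart c (hit_min x S T \<omega>) \<omega>)"
    using tendsto_upperbound[of "\<lambda>K. 1 - exp (c\<^sup>2 * T) / K" 1 at_top
        "expectation (\<lambda>\<omega>. exp_mart c (hit_min x S T \<omega>) \<omega>)"]
      eventually_mono[OF eventually_ge_at_top[of "exp (c * (a - x))"] expectation_exp_mart_hit_min_ge[OF assms]]
    by simp
qed

text \<open>The value 0 on paths that never hit \<open>S\<close> is the true limit: there
  \<open>c * B\<close> stays below \<open>c * (a - x)\<close> while
  \<open>- c\<^sup>2 / 2 * t\<close> tends to minus infinity.\<close>

definition exp_mart_hit :: "'a \<Rightarrow> real" where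
  "exp_mart_hit \<omega> = (if hitting_time B x S \<omega> = \<infinity> then 0
     else exp_mart c (real_of_ereal (hitting_time B x S \<omega>)) \<omega>)"

lemma exp_mart_hit_min_tendsto:
  assumes "\<omega> \<in> space M"
  shows "(\<lambda>n. exp_mart c (hit_min x S (real (Suc n)) \<omega>) \<omega>) \<longlonglongrightarrow> exp_mart_hit \<omega>"
proof (cases "hitting_time B x S \<omega>")
  case (real t)
  have "\<forall>\<^sub>F n in sequentially. t < real (Suc n)"
    using eventually_gt_at_top[of "nat \<lceil>t\<rceil>"] by eventually_elim linarith
  then have "\<forall>\<^sub>F n in sequentially. exp_mart c (hit_min x S (real (Suc n)) \<omega>) \<omega> = exp_mart_hit \<omega>"
    by eventually_elim (use real in \<open>simp add: exp_mart_hit_def hit_min_def min_absorb1\<close>)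
  then show ?thesis by (rule tendsto_eventually)
next
  case PInf
  have "c \<noteq> 0" using c by auto
  have lim: "(\<lambda>n. exp (c * (a - x)) * exp (- (c\<^sup>2 / 2)) ^ Suc n) \<longlonglongrightarrow> exp (c * (a - x)) * 0"
    using \<open>c \<noteq> 0\<close> by (intro tendsto_intros LIMSEQ_Suc LIMSEQ_power_zero) auto
  have le: "exp_mart c (hit_min x S (real (Suc n)) \<omega>) \<omega> \<le> exp (c * (a - x)) * exp (- (c\<^sup>2 / 2)) ^ Suc n" for n
  proof -
    have "hit_min x S (real (Suc n)) \<omega> = real (Suc n)"
      using PInf by (simp add: hit_min_def min_absorb2)
    moreover have "c * B (real (Suc n)) \<omega> \<le> c * (a - x)"
      using PInf by (intro below_level[OF assms S(2) c]) auto
    moreover have "exp_mart c (real (Suc n)) \<omega> = exp (c * B (real (Suc n)) \<omega>) * exp (real (Suc n) * - (c\<^sup>2 / 2))"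
      unfolding exp_mart_def exp_add[symmetric] by (rule arg_cong[where f = exp]) (simp add: algebra_simps)
    ultimately show ?thesis
      unfolding exp_of_nat_mult by simp
  qed
  have "(\<lambda>n. exp_mart c (hit_min x S (real (Suc n)) \<omega>) \<omega>) \<longlonglongrightarrow> 0"
  proof (rule tendsto_sandwich[OF _ _ tendsto_const lim[unfolded mult_zero_right]])
    show "\<forall>\<^sub>F n in sequentially. 0 \<le> exp_mart c (hit_min x S (real (Suc n)) \<omega>) \<omega>" by simp
  qed (rule always_eventually[OF allI[OF le]])
  then show ?thesis
    unfolding exp_mart_hit_def PInf by simp
next
  case MInf
  then show ?thesis using hitting_time_nonneg[of x S \<omega>] by simp
qed

lemma exp_mart_hit:
  shows exp_mart_hit_integrable: "integrable M exp_mart_hit"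
    and "expectation exp_mart_hit = 1"
proof -
  note meas = exp_mart_hit_min_measurable[of "real (Suc n)" c for n, OF of_nat_0_less_iff[THEN iffD2, OF zero_less_Suc]]
  have meas': "exp_mart_hit \<in> borel_measurable M"
    by (rule borel_measurable_LIMSEQ_real[OF exp_mart_hit_min_tendsto meas])
  have bd: "AE \<omega> in M. norm (exp_mart c (hit_min x S (real (Suc n)) \<omega>) \<omega>) \<le> exp (c * (a - x))" for n
    using exp_mart_hit_min_le[of _ "real (Suc n)"] by (intro AE_I2) simp
  have lim: "AE \<omega> in M. (\<lambda>n. exp_mart c (hit_min x S (real (Suc n)) \<omega>) \<omega>) \<longlonglongrightarrow> exp_mart_hit \<omega>"
    by (intro AE_I2 exp_mart_hit_min_tendsto)
  show "integrable M exp_mart_hit"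
    by (rule integrable_dominated_convergence[OF meas' meas _ lim bd]) simp
  have "(\<lambda>n. expectation (\<lambda>\<omega>. exp_mart c (hit_min x S (real (Suc n)) \<omega>) \<omega>)) \<longlonglongrightarrow> expectation exp_mart_hit"
    by (rule integral_dominated_convergence[OF meas' meas _ lim bd]) simp
  then show "expectation exp_mart_hit = 1"
    using LIMSEQ_unique expectation_exp_mart_hit_min by (simp add: tendsto_const_iff del: of_nat_Suc)
qed

end

end

section \<open>Expected discount factors\<close>

lemma continuous_disc_integrand: "continuous_on {1..2} (\<lambda>r. exp (- r * t :: real))"
  by (intro continuous_intros)

lemma disc_eq: "disc (ereal t) = (\<integral>r. exp (- r * t) \<partial>rates)"
  by (simp add: disc_def integral_rates[OF continuous_disc_integrand, simplified])

lemma disc_infinity [simp]: "disc \<infinity> = 0"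
  by (simp add: disc_def)

lemma disc_0 [simp]: "disc 0 = 1"
  using disc_eq[of 0] rates.prob_space by (simp add: zero_ereal_def)

lemma disc_nonneg [simp]: "0 \<le> disc t"
  unfolding disc_def using continuous_disc_integrand
  by (auto intro!: integral_nonneg integrable_continuous_interval)

lemma disc_measurable: "disc \<in> borel_measurable borel"
proof -
  have id: "(\<lambda>r. r) \<in> borel_measurable rates" by (rule measurable_ratesI) simp
  have [measurable]: "(snd :: ereal \<times> real \<Rightarrow> real) \<in> borel_measurable (borel \<Otimes>\<^sub>M rates)"
    by (rule measurable_compose[OF measurable_snd id])
  have "disc t = (if t = \<infinity> then 0 else (\<integral>r. exp (- r * real_of_ereal t) \<partial>rates))" for t
    by (simp add: disc_def integral_rates[OF continuous_disc_integrand, simplified])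
  then have "disc = (\<lambda>t. if t = \<infinity> then 0 else (\<integral>r. exp (- r * real_of_ereal t) \<partial>rates))" by blast
  also have "\<dots> \<in> borel_measurable borel"
    by measurable
  finally show ?thesis .
qed

lemma disc_le_exp:
  assumes "ereal s \<le> t" "0 \<le> s" shows "disc t \<le> exp (- s)"
proof (cases t)
  case (real u)
  have "(\<integral>r. exp (- r * u) \<partial>rates) \<le> exp (- s)"
  proof (rule rates.integral_le_const[OF integrable_rates[OF continuous_disc_integrand]], intro AE_I2)
    fix r assume "r \<in> space rates"
    then have "1 * s \<le> r * u" using assms real by (intro mult_mono) auto
    then show "exp (- r * u) \<le> exp (- s)" by simp
  qed
  then show ?thesis using real by (simp add: disc_eq)
qed (use assms in auto)

lemma disc_le_1: "0 \<le> t \<Longrightarrow> disc t \<le> 1"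
  using disc_le_exp[of 0 t] by (simp flip: zero_ereal_def)

section \<open>Measurability and Laplace transforms of hitting times\<close>

context brownian
begin

text \<open>The time is below \<open>a\<close> iff the path visits \<open>S\<close> during some
  interval with rational endpoints \<open>0 < p < q\<close>, \<open>q < a\<close>. By compactness
  and continuity such a visit means that the distance to \<open>S\<close> comes arbitrarily close to
  0 at rational times of the interval, a countable condition.\<close>

lemma hitting_time_measurable:
  assumes S: "closed S" "S \<noteq> {}" shows "hitting_time B x S \<in> borel_measurable M"
  unfolding borel_measurable_ereal_iff_Iio
proof
  fix a :: ereal
  let ?g = "\<lambda>\<omega> t. infdist (x + B t \<omega>) S"
  let ?I = "{pq. 0 < fst pq \<and> fst pq < snd pq \<and> ereal (of_rat (snd pq)) < a}"
  let ?Q = "\<lambda>p q \<omega>. \<forall>n. \<exists>u\<in>{u. of_rat p \<le> (of_rat u :: real) \<and> (of_rat u :: real) \<le> of_rat q}.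
    ?g \<omega> (of_rat u) < 1 / real (Suc n)"
  have path: "(\<exists>t\<in>{of_rat p..of_rat q}. x + B t \<omega> \<in> S) \<longleftrightarrow> ?Q p q \<omega>"
    if \<omega>: "\<omega> \<in> space M" and pq: "0 < p" "p < q" for \<omega> p q
  proof -
    have "(0::real) < of_rat p" "(of_rat p :: real) < of_rat q" using pq by (auto simp: of_rat_less)
    note pq' = this
    have cont: "continuous_on {of_rat p..of_rat q} (?g \<omega>)"
      using pq' by (intro continuous_intros continuous_on_subset[OF continuous_B[OF \<omega>]]) auto
    show ?thesis
    proof
      assume "\<exists>t\<in>{of_rat p..of_rat q}. x + B t \<omega> \<in> S"
      then obtain t where t: "t \<in> {of_rat p..of_rat q}" "x + B t \<omega> \<in> S" by blast
      show "?Q p q \<omega>"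
      proof
        fix n
        have "0 < 1 / real (Suc n)" by simp
        then obtain \<eta> where \<eta>: "0 < \<eta>"
          "\<And>u. u \<in> {of_rat p..of_rat q} \<Longrightarrow> dist u t < \<eta> \<Longrightarrow> dist (?g \<omega> u) (?g \<omega> t) < 1 / real (Suc n)"
          using cont t(1) unfolding continuous_on_iff by meson
        have "max (of_rat p) (t - \<eta>) < min (of_rat q) (t + \<eta>)"
          using t(1) \<eta>(1) pq' by auto
        then obtain u where u: "max (of_rat p) (t - \<eta>) < of_rat u" "of_rat u < min (of_rat q) (t + \<eta>)"
          using of_rat_dense by blast
        have "dist (?g \<omega> (of_rat u)) (?g \<omega> t) < 1 / real (Suc n)"
          using u by (intro \<eta>(2)) (auto simp: dist_real_def)
        then have "?g \<omega> (of_rat u) < 1 / real (Suc n)"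
          using t(2) by (simp add: dist_real_def)
        with u show "\<exists>u\<in>{u. of_rat p \<le> (of_rat u :: real) \<and> (of_rat u :: real) \<le> of_rat q}.
            ?g \<omega> (of_rat u) < 1 / real (Suc n)"
          by (intro bexI[of _ u]) auto
      qed
    next
      assume Q: "?Q p q \<omega>"
      obtain t where t: "t \<in> {of_rat p..of_rat q}" "\<And>s. s \<in> {of_rat p..of_rat q} \<Longrightarrow> ?g \<omega> t \<le> ?g \<omega> s"
        using continuous_attains_inf[OF _ _ cont] pq' by auto
      have "x + B t \<omega> \<in> S"
      proof (rule ccontr)
        assume "x + B t \<omega> \<notin> S"
        then have "0 < ?g \<omega> t" using S by (intro infdist_pos_not_in_closed) auto
        then obtain n where "1 / real (Suc n) < ?g \<omega> t" using nat_approx_posE by blast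
        moreover obtain u where "of_rat p \<le> (of_rat u :: real)" "(of_rat u :: real) \<le> of_rat q"
          "?g \<omega> (of_rat u) < 1 / real (Suc n)" using Q by blast
        ultimately show False using t(2)[of "of_rat u"] by simp
      qed
      with t(1) show "\<exists>t\<in>{of_rat p..of_rat q}. x + B t \<omega> \<in> S" by blast
    qed
  qed
  have "hitting_time B x S -` {..<a} \<inter> space M = (\<Union>pq\<in>?I. {\<omega> \<in> space M. ?Q (fst pq) (snd pq) \<omega>})"
  proof (intro set_eqI iffI)
    fix \<omega> assume "\<omega> \<in> hitting_time B x S -` {..<a} \<inter> space M"
    then obtain t where t: "\<omega> \<in> space M" "0 < t" "x + B t \<omega> \<in> S" "ereal t < a"
      unfolding hitting_time_def by (auto simp: INF_less_iff)
    from ereal_dense3[OF t(4)] obtain q where q: "ereal t < ereal (of_rat q)" "ereal (of_rat q) < a" by blast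
    obtain p where p: "0 < (of_rat p :: real)" "of_rat p < t"
      using of_rat_dense[OF t(2)] by blast
    have "(of_rat p :: real) < of_rat q" using p q by simp
    then have "(p, q) \<in> ?I" using p(1) q(2) by (simp add: of_rat_less)
    moreover have "?Q p q \<omega>"
      using path[OF t(1), of p q] calculation t p q by (auto intro!: bexI[of _ t])
    ultimately show "\<omega> \<in> (\<Union>pq\<in>?I. {\<omega> \<in> space M. ?Q (fst pq) (snd pq) \<omega>})"
      using t(1) by (intro UN_I[of "(p, q)"]) auto
  next
    fix \<omega> assume "\<omega> \<in> (\<Union>pq\<in>?I. {\<omega> \<in> space M. ?Q (fst pq) (snd pq) \<omega>})"
    then obtain p q where pq: "0 < p" "p < q" "ereal (of_rat q) < a" "\<omega> \<in> space M" "?Q p q \<omega>" by auto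
    with path[OF pq(4,1,2)] obtain t where t: "of_rat p \<le> t" "t \<le> of_rat q" "x + B t \<omega> \<in> S" by auto
    have "0 < t" using pq(1) t(1) by (meson less_le_trans zero_less_of_rat_iff)
    moreover have "ereal t < a" using t(2) pq(3) by (meson ereal_less_eq(3) le_less_trans)
    ultimately show "\<omega> \<in> hitting_time B x S -` {..<a} \<inter> space M"
      using t pq(4) unfolding hitting_time_def by (auto simp: INF_less_iff)
  qed
  also have "\<dots> \<in> sets M"
  proof (intro sets.countable_UN'' countableI_type)
    fix pq assume "pq \<in> ?I"
    then have nn: "0 \<le> (of_rat u :: real)" if "of_rat (fst pq) \<le> (of_rat u :: real)" for u
      using that by (smt (verit) mem_Collect_eq zero_less_of_rat_iff)
    have "{\<omega> \<in> space M. ?g \<omega> (of_rat u) < 1 / real (Suc n)} \<in> sets M"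
      if "of_rat (fst pq) \<le> (of_rat u :: real)" for u n
    proof -
      have [measurable]: "B (of_rat u) \<in> borel_measurable M" by (rule B_measurable[OF nn[OF that]])
      have [measurable]: "(\<lambda>y. infdist y S) \<in> borel_measurable borel"
        by (intro borel_measurable_continuous_onI continuous_intros)
      show ?thesis by measurable
    qed
    then show "{\<omega> \<in> space M. ?Q (fst pq) (snd pq) \<omega>} \<in> sets M"
      by (intro sets.sets_Collect_countable_All sets.sets_Collect_countable_Ex') (auto intro: countableI_type)
  qed
  finally show "hitting_time B x S -` {..<a} \<inter> space M \<in> sets M" .
qed

context
  fixes S :: "real set" and a x :: real
  assumes S: "closed S" "a \<in> S" "x \<notin> S"
begin

text \<open>When \<open>S\<close> is first hit the path has not passed \<open>a\<close>, so the
  signed displacement is exactly the decrease of the distance to \<open>a\<close>.\<close>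

lemma same_side:
  assumes "\<omega> \<in> space M" "hitting_time B x S \<omega> \<noteq> \<infinity>"
  defines "b \<equiv> B (real_of_ereal (hitting_time B x S \<omega>)) \<omega>"
  shows "sgn (a - x) * b - \<bar>a - x\<bar> = - \<bar>x + b - a\<bar>"
proof -
  have "a \<noteq> x" using S by auto
  then have "0 < sgn (a - x) * (a - x)" by (simp add: sgn_if)
  from below_level[OF assms(1) S(2) this, of "real_of_ereal (hitting_time B x S \<omega>)"]
  have "sgn (a - x) * b \<le> sgn (a - x) * (a - x)"
    using hitting_time_nonneg[of x S \<omega>] assms(2) unfolding b_def
    by (cases "hitting_time B x S \<omega>") auto
  then show ?thesis using \<open>a \<noteq> x\<close> by (auto simp: sgn_if abs_if split: if_splits)
qed

text \<open>\<open>H\<close> is what remains to be earned by going on from the hitting point of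
  \<open>S\<close> to \<open>a\<close>. With \<open>c = sqrt (2 * r) * sgn (a - x)\<close>, the
  martingale at the hitting time times \<open>exp (- sqrt (2 * r) * \<bar>x - a\<bar>)\<close> is
  precisely the integrand at rate \<open>r\<close>, so optional stopping and Fubini give its
  mean.\<close>

lemma hit_discount_martingale:
  defines "\<tau> \<equiv> hitting_time B x S"
  defines "H \<equiv> \<lambda>\<omega>. if \<tau> \<omega> = \<infinity> then 0 else
    (\<integral>r. exp (- r * real_of_ereal (\<tau> \<omega>)) *
          exp (- sqrt (2 * r) * \<bar>x + B (real_of_ereal (\<tau> \<omega>)) \<omega> - a\<bar>) \<partial>rates)"
  shows "integrable M H" "expectation H = hit_discount \<bar>x - a\<bar>"
proof -
  define \<sigma> where "\<sigma> = sgn (a - x)"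
  have ax: "a \<noteq> x" using S by auto
  have \<sigma>: "\<sigma>\<^sup>2 = 1" "\<sigma> * (a - x) = \<bar>x - a\<bar>" "0 < \<bar>x - a\<bar>"
    using ax by (auto simp: \<sigma>_def sgn_if)
  have pos: "0 < (sqrt (2 * r) * \<sigma>) * (a - x)" if "r \<in> {1..2}" for r
    using that \<sigma>(2,3) by (simp add: mult.assoc)
  have [measurable]: "\<tau> \<in> borel_measurable M"
    unfolding \<tau>_def by (rule hitting_time_measurable) (use S in auto)
  define b where "b \<omega> = (if \<tau> \<omega> = \<infinity> then 0 else B (real_of_ereal (\<tau> \<omega>)) \<omega>)" for \<omega>
  \<comment> \<open>The position at the hitting time is recovered as a logarithm of the stopped
    exponential martingale, already known to be measurable.\<close>
  have [measurable]: "b \<in> borel_measurable M"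
  proof -
    have [measurable]: "exp_mart_hit S x \<sigma> \<in> borel_measurable M"
      using exp_mart_hit_integrable[OF S, of \<sigma>] \<sigma> by simp
    have "0 < \<sigma> * (a - x)" "\<sigma> \<noteq> 0" using \<sigma> by auto
    then have "b \<omega> = (if \<tau> \<omega> = \<infinity> then 0 else
        (ln (exp_mart_hit S x \<sigma> \<omega>) + \<sigma>\<^sup>2 / 2 * real_of_ereal (\<tau> \<omega>)) / \<sigma>)" for \<omega>
      by (simp add: b_def exp_mart_hit_def[OF S \<open>0 < \<sigma> * (a - x)\<close>] exp_mart_def \<tau>_def)
    then have "b = (\<lambda>\<omega>. if \<tau> \<omega> = \<infinity> then 0 else
        (ln (exp_mart_hit S x \<sigma> \<omega>) + \<sigma>\<^sup>2 / 2 * real_of_ereal (\<tau> \<omega>)) / \<sigma>)" by blast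
    also have "\<dots> \<in> borel_measurable M" by measurable
    finally show ?thesis .
  qed
  define G where "G r \<omega> = (if \<tau> \<omega> = \<infinity> then 0 else
    exp (- r * real_of_ereal (\<tau> \<omega>)) * exp (- sqrt (2 * r) * \<bar>x + b \<omega> - a\<bar>))" for r \<omega>
  have H: "H \<omega> = (\<integral>r. G r \<omega> \<partial>rates)" for \<omega>
    by (simp add: H_def G_def b_def)
  have EG: "expectation (G r) = exp (- sqrt (2 * r) * \<bar>x - a\<bar>)" if r: "r \<in> {1..2}" for r
  proof -
    let ?c = "sqrt (2 * r) * \<sigma>"
    have c2: "?c\<^sup>2 / 2 = r" using r \<sigma>(1) by (simp add: power_mult_distrib)
    have "G r \<omega> = exp_mart_hit S x ?c \<omega> * exp (- sqrt (2 * r) * \<bar>x - a\<bar>)" if "\<omega> \<in> space M" for \<omega>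
    proof (cases "\<tau> \<omega> = \<infinity>")
      case False
      have "?c * b \<omega> - sqrt (2 * r) * \<bar>x - a\<bar> = sqrt (2 * r) * (\<sigma> * b \<omega> - \<bar>a - x\<bar>)"
        by (simp add: algebra_simps abs_minus_commute)
      also have "\<dots> = - sqrt (2 * r) * \<bar>x + b \<omega> - a\<bar>"
        using same_side[OF that] False by (simp add: b_def \<tau>_def \<sigma>_def)
      finally have "?c * b \<omega> - sqrt (2 * r) * \<bar>x - a\<bar> = - sqrt (2 * r) * \<bar>x + b \<omega> - a\<bar>" .
      then have "exp (- r * real_of_ereal (\<tau> \<omega>)) * exp (- sqrt (2 * r) * \<bar>x + b \<omega> - a\<bar>)
        = exp (?c * b \<omega> - ?c\<^sup>2 / 2 * real_of_ereal (\<tau> \<omega>)) * exp (- sqrt (2 * r) * \<bar>x - a\<bar>)"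
        unfolding c2 exp_add[symmetric] by simp
      moreover have "exp_mart_hit S x ?c \<omega> = exp (?c * b \<omega> - ?c\<^sup>2 / 2 * real_of_ereal (\<tau> \<omega>))"
        using False by (simp add: exp_mart_hit_def[OF S pos[OF r]] exp_mart_def \<tau>_def b_def)
      ultimately show ?thesis
        using False by (simp only: G_def if_False)
    qed (simp add: G_def exp_mart_hit_def[OF S pos[OF r]] \<tau>_def)
    then have "expectation (G r) = expectation (\<lambda>\<omega>. exp_mart_hit S x ?c \<omega> * exp (- sqrt (2 * r) * \<bar>x - a\<bar>))"
      by (intro Bochner_Integration.integral_cong) auto
    then show ?thesis
      using exp_mart_hit[OF S pos[OF r]] by simp
  qed
  interpret P: pair_prob_space M rates ..
  have bound: "norm (G r \<omega>) \<le> 1" if "r \<in> {1..2}" for r \<omega>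
    using that hitting_time_nonneg[of x S \<omega>]
    by (auto simp: G_def \<tau>_def real_of_ereal_pos intro!: mult_le_one)
  have meas: "case_prod (\<lambda>\<omega> r. G r \<omega>) \<in> borel_measurable (M \<Otimes>\<^sub>M rates)"
  proof -
    have [measurable]: "(\<lambda>r. r) \<in> borel_measurable rates" by (rule measurable_ratesI) simp
    have [measurable]: "snd \<in> borel_measurable (M \<Otimes>\<^sub>M rates)"
      using measurable_compose[OF measurable_snd \<open>(\<lambda>r. r) \<in> borel_measurable rates\<close>] by simp
    show ?thesis unfolding G_def case_prod_beta by measurable
  qed
  have int: "integrable (M \<Otimes>\<^sub>M rates) (case_prod (\<lambda>\<omega> r. G r \<omega>))"
    using bound by (intro P.integrable_const_bound[where B = 1] meas AE_I2) (auto simp: space_pair_measure)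
  show "integrable M H"
    using P.integrable_fst'[OF int] by (simp add: H[abs_def])
  have "expectation H = (\<integral>\<omega>. (\<integral>r. G r \<omega> \<partial>rates) \<partial>M)" unfolding H[abs_def] ..
  also have "\<dots> = (\<integral>r. expectation (G r) \<partial>rates)"
    using P.Fubini_integral[OF int] by simp
  also have "\<dots> = hit_discount \<bar>x - a\<bar>"
    unfolding hit_discount_def by (intro Bochner_Integration.integral_cong) (auto simp: EG)
  finally show "expectation H = hit_discount \<bar>x - a\<bar>" .
qed

end

lemma disc_hitting_time_point:
  assumes "x \<noteq> a"
  shows "integrable M (\<lambda>\<omega>. disc (hitting_time B x {a} \<omega>))"
    and "expected_disc M B a x = hit_discount \<bar>x - a\<bar>"
proof -
  have S: "closed {a}" "a \<in> {a}" "x \<notin> {a}" using assms by auto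
  note H = hit_discount_martingale[OF S]
  have eq: "(if hitting_time B x {a} \<omega> = \<infinity> then 0 else
    (\<integral>r. exp (- r * real_of_ereal (hitting_time B x {a} \<omega>)) *
          exp (- sqrt (2 * r) * \<bar>x + B (real_of_ereal (hitting_time B x {a} \<omega>)) \<omega> - a\<bar>) \<partial>rates))
     = disc (hitting_time B x {a} \<omega>)" if "\<omega> \<in> space M" for \<omega>
    using at_hitting_time[OF that S(1), of x] hitting_time_nonneg[of x "{a}" \<omega>]
    by (cases "hitting_time B x {a} \<omega>") (auto simp: disc_eq)
  show "integrable M (\<lambda>\<omega>. disc (hitting_time B x {a} \<omega>))"
    using H(1) by (subst Bochner_Integration.integrable_cong[OF refl eq[symmetric]])
  show "expected_disc M B a x = hit_discount \<bar>x - a\<bar>"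
    unfolding expected_disc_def H(2)[symmetric]
    by (rule Bochner_Integration.integral_cong[OF refl eq[symmetric]])
qed

text \<open>As the targets approach \<open>x\<close>, the expected discount factor tends to 1. On
  the event that every target takes at least \<open>1 / (j + 1)\<close>, the factor stays below a
  constant less than 1, so this event is null.\<close>

lemma hits_near_immediately:
  assumes "\<sigma> \<noteq> 0"
  shows "AE \<omega> in M. \<exists>k. hitting_time B x {x + \<sigma> / real (Suc k)} \<omega> < ereal (1 / real (Suc j))"
proof -
  let ?D = "\<lambda>k \<omega>. disc (hitting_time B x {x + \<sigma> / real (Suc k)} \<omega>)"
  let ?\<epsilon> = "1 / real (Suc j)"
  let ?E = "{\<omega> \<in> space M. \<forall>k. ereal ?\<epsilon> \<le> hitting_time B x {x + \<sigma> / real (Suc k)} \<omega>}"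
  have ne: "x \<noteq> x + \<sigma> / real (Suc k)" for k using assms by simp
  have [measurable]: "hitting_time B x {x + \<sigma> / real (Suc k)} \<in> borel_measurable M" for k
    by (rule hitting_time_measurable) auto
  have E [measurable]: "?E \<in> events" by measurable
  have le: "hit_discount (\<bar>\<sigma>\<bar> / real (Suc k)) \<le> 1 - (1 - exp (- ?\<epsilon>)) * prob ?E" for k
  proof -
    have "hit_discount (\<bar>\<sigma>\<bar> / real (Suc k)) = expectation (?D k)"
      using disc_hitting_time_point(2)[OF ne[of k]] by (simp add: expected_disc_def)
    also have "\<dots> \<le> expectation (\<lambda>\<omega>. 1 - (1 - exp (- ?\<epsilon>)) * indicator ?E \<omega>)"
    proof (rule integral_mono[OF disc_hitting_time_point(1)[OF ne]])
      show "integrable M (\<lambda>\<omega>. 1 - (1 - exp (- ?\<epsilon>)) * indicator ?E \<omega>)" 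
        by (intro Bochner_Integration.integrable_diff integrable_mult_right integrable_const integrable_real_indicator E) (simp add: emeasure_eq_measure)
      fix \<omega> assume "\<omega> \<in> space M"
      show "?D k \<omega> \<le> 1 - (1 - exp (- ?\<epsilon>)) * indicator ?E \<omega>"
        using disc_le_1[OF hitting_time_nonneg, of x _ \<omega>] disc_le_exp[of ?\<epsilon>]
        by (cases "\<omega> \<in> ?E") (auto simp del: of_nat_Suc)
    qed
    also have "\<dots> = 1 - (1 - exp (- ?\<epsilon>)) * prob ?E"
    proof -
      have "expectation (\<lambda>\<omega>. 1 - c * indicator A \<omega>) = 1 - c * prob A" if "A \<in> events" for A and c :: real
        using that by (simp add: prob_space emeasure_eq_measure)
      from this[OF E] show ?thesis .
    qed
    finally show ?thesis .
  qed
  have "1 \<le> 1 - (1 - exp (- ?\<epsilon>)) * prob ?E"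
  proof (rule LIMSEQ_le_const2)
    have "(\<lambda>k. exp (- 2 * (\<bar>\<sigma>\<bar> * (1 / real (Suc k))))) \<longlonglongrightarrow> exp (- 2 * (\<bar>\<sigma>\<bar> * 0))"
      by (intro tendsto_intros LIMSEQ_Suc lim_1_over_n)
    then show "(\<lambda>k. exp (- 2 * (\<bar>\<sigma>\<bar> / real (Suc k)))) \<longlonglongrightarrow> 1" by simp
    show "\<exists>N. \<forall>k\<ge>N. exp (- 2 * (\<bar>\<sigma>\<bar> / real (Suc k))) \<le> 1 - (1 - exp (- ?\<epsilon>)) * prob ?E"
    proof (intro exI[of _ 0] allI impI)
      show "exp (- 2 * (\<bar>\<sigma>\<bar> / real (Suc k))) \<le> 1 - (1 - exp (- ?\<epsilon>)) * prob ?E" for k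
        by (rule order_trans[OF hit_discount_ge_exp le]) simp
    qed
  qed
  then have "\<not> 0 < (1 - exp (- ?\<epsilon>)) * prob ?E" by linarith
  moreover have "0 < 1 - exp (- ?\<epsilon>)" by simp
  ultimately have "\<not> 0 < prob ?E" using mult_pos_pos by blast
  then have "prob ?E = 0" using measure_nonneg[of M ?E] by linarith
  then have "AE \<omega> in M. \<omega> \<notin> ?E"
    by (intro AE_not_in null_setsI E) (simp add: emeasure_eq_measure)
  then show ?thesis
    by (rule AE_mp) (auto simp: not_le)
qed

lemma hitting_time_lessD:
  assumes "hitting_time B x S \<omega> < ereal e"
  obtains t where "0 < t" "t < e" "x + B t \<omega> \<in> S"
  using assms unfolding hitting_time_def INF_less_iff by auto

text \<open>Only positive times count, so this is regularity of a point for itself: almost every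
  path takes both signs before any positive time and hence vanishes in between.\<close>

lemma hitting_time_start: "AE \<omega> in M. hitting_time B x {x} \<omega> = 0"
proof -
  have "AE \<omega> in M. \<forall>j. (\<exists>k. hitting_time B x {x + 1 / real (Suc k)} \<omega> < ereal (1 / real (Suc j))) \<and>
     (\<exists>k. hitting_time B x {x + (-1) / real (Suc k)} \<omega> < ereal (1 / real (Suc j)))"
    unfolding AE_all_countable by (intro allI AE_conjI hits_near_immediately) auto
  with AE_space show ?thesis
  proof eventually_elim
    case (elim \<omega>)
    have small: "hitting_time B x {x} \<omega> < ereal (1 / real (Suc j))" for j
    proof -
      from elim(2) obtain k k' where "hitting_time B x {x + 1 / real (Suc k)} \<omega> < ereal (1 / real (Suc j))"
        "hitting_time B x {x + (-1) / real (Suc k')} \<omega> < ereal (1 / real (Suc j))" by blast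
      note k = this
      obtain s where s: "0 < s" "s < 1 / real (Suc j)" "0 < B s \<omega>"
        using k(1) by (rule hitting_time_lessD) auto
      obtain t where t: "0 < t" "t < 1 / real (Suc j)" "B t \<omega> < 0"
        using k(2) by (rule hitting_time_lessD) auto
      have cont: "continuous_on {min s t..max s t} (\<lambda>t. B t \<omega>)"
        using s t by (intro continuous_on_subset[OF continuous_B[OF elim(1)]]) auto
      have "\<exists>u. min s t \<le> u \<and> u \<le> max s t \<and> B u \<omega> = 0"
      proof (cases "s \<le> t")
        case True
        then show ?thesis using IVT2'[of "\<lambda>t. B t \<omega>" t 0 s] cont s t by (auto simp: min_def max_def)
      next
        case False
        then show ?thesis using IVT'[of "\<lambda>t. B t \<omega>" t 0 s] cont s t by (auto simp: min_def max_def)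
      qed
      then obtain u where u: "min s t \<le> u" "u \<le> max s t" "B u \<omega> = 0" by blast
      have "0 < u" "u < 1 / real (Suc j)" using u(1,2) s(1,2) t(1,2) by linarith+
      note u = this u(3)
      then show ?thesis
        unfolding hitting_time_def INF_less_iff by auto
    qed
    show ?case
    proof (rule ccontr)
      assume "hitting_time B x {x} \<omega> \<noteq> 0"
      then have "0 < hitting_time B x {x} \<omega>" using hitting_time_nonneg[of x "{x}" \<omega>] by simp
      from ereal_dense2[OF this] obtain e where e: "0 < e" "ereal e < hitting_time B x {x} \<omega>" by auto
      obtain j where "1 / real (Suc j) < e" using e(1) nat_approx_posE by blast
      then have "ereal (1 / real (Suc j)) < ereal e" by simp
      from less_trans[OF less_trans[OF small this] e(2)] show False by simp
    qed
  qed
qed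

lemma expected_disc_eq: "expected_disc M B a x = hit_discount \<bar>x - a\<bar>"
proof (cases "x = a")
  case True
  have "expected_disc M B a a = expectation (\<lambda>_. 1)"
    unfolding expected_disc_def
  proof (rule integral_cong_AE)
    have "hitting_time B a {a} \<in> borel_measurable M" by (rule hitting_time_measurable) auto
    then have "(\<lambda>\<omega>. disc (hitting_time B a {a} \<omega>)) \<in> borel_measurable M"
      by (rule measurable_compose[OF _ disc_measurable])
    then show "(\<lambda>\<omega>. disc (hitting_time B a {a} \<omega>)) \<in> borel_measurable M" .
    show "AE \<omega> in M. disc (hitting_time B a {a} \<omega>) = 1"
      using hitting_time_start[of a] by eventually_elim simp
  qed simp
  with True show ?thesis by (simp add: prob_space)
qed (rule disc_hitting_time_point(2))

end

section \<open>The mild equilibria\<close>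

text \<open>The function \<open>f1\<close> in hyperbolic form: at each rate, the value of leaving
  the interval from 0 to 1/2 with payment 1 at 1/2 and \<open>f0 M B 0\<close> at 0.\<close>

definition two_sided :: "real \<Rightarrow> real" where
  "two_sided x = (\<integral>r. sinh (sqrt (2 * r) * x) / sinh (sqrt (2 * r) / 2)
      + hit_discount (1/2) * (sinh (sqrt (2 * r) * (1/2 - x)) / sinh (sqrt (2 * r) / 2)) \<partial>rates)"

lemma continuous_sinh_ratio:
  assumes "0 < y" shows "continuous_on {1..2} (\<lambda>r. sinh (sqrt (2 * r) * x) / sinh (sqrt (2 * r) * y))"
  using assms by (auto intro!: continuous_intros)

lemma continuous_two_sided:
  "continuous_on {1..2} (\<lambda>r. sinh (sqrt (2 * r) * x) / sinh (sqrt (2 * r) / 2)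
      + b * (sinh (sqrt (2 * r) * (1/2 - x)) / sinh (sqrt (2 * r) / 2)))"
  using continuous_sinh_ratio[of "1/2"] by (intro continuous_intros) simp_all

lemma two_sided_nonneg:
  assumes "0 \<le> x" "x \<le> 1/2" shows "0 \<le> two_sided x"
  unfolding two_sided_def using assms hit_discount_pos[of "1/2"]
  by (intro integral_nonneg_AE AE_I2 add_nonneg_nonneg mult_nonneg_nonneg divide_nonneg_nonneg) auto

lemma two_sided_half [simp]: "two_sided (1/2) = 1"
proof -
  have "two_sided (1/2) = (\<integral>r. 1 \<partial>rates)"
    unfolding two_sided_def by (intro Bochner_Integration.integral_cong) auto
  then show ?thesis using rates.prob_space by simp
qed

text \<open>The reward without reference to the probability space, as required on the tree
  side.\<close>

definition explicit_reward :: "real \<Rightarrow> real \<Rightarrow> real \<Rightarrow> real" where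
  "explicit_reward K1 K2 x =
     (if x \<le> 0 then exp x * hit_discount (1/2) * hit_discount (- x)
      else if x \<le> 1/2 then two_sided x / (1 + K1 * x * (1/2 - x))
      else exp (K2 * (1/2 - x)) * hit_discount (x - 1/2))"

context
  fixes K1 K2 :: real
  assumes K: "0 < K1" "0 < K2"
begin

lemma explicit_reward_half [simp]: "explicit_reward K1 K2 (1/2) = 1"
  by (simp add: explicit_reward_def)

lemma explicit_reward_nonneg: "0 \<le> explicit_reward K1 K2 x"
  using K two_sided_nonneg hit_discount_pos[THEN less_imp_le]
  by (auto simp: explicit_reward_def intro!: divide_nonneg_nonneg mult_nonneg_nonneg add_nonneg_nonneg)

lemma two_sided_le:
  assumes "0 \<le> x" "x \<le> 1/2" shows "two_sided x \<le> hit_discount (1/2 - x)"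
proof (cases "x = 1/2")
  case False
  then show ?thesis
    unfolding two_sided_def using assms by (intro two_sided_le_hit_discount) auto
qed (simp only: two_sided_half diff_self hit_discount_0)

lemma explicit_reward_le_hit_discount: "explicit_reward K1 K2 x \<le> hit_discount \<bar>x - 1/2\<bar>"
proof -
  consider "x \<le> 0" | "0 < x" "x \<le> 1/2" | "1/2 < x" by linarith
  then show ?thesis
  proof cases
    case 1
    have "exp x * (hit_discount (1/2) * hit_discount (- x)) \<le> 1 * hit_discount (1/2 + - x)"
      using 1 hit_discount_pos[of "1/2"] hit_discount_pos[of "- x"]
      by (intro mult_mono hit_discount_mult_le) auto
    then show ?thesis using 1 by (simp add: explicit_reward_def mult.assoc abs_if)
  next
    case 2
    have "two_sided x / (1 + K1 * x * (1/2 - x)) \<le> two_sided x / 1"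
      using 2 K two_sided_nonneg by (intro divide_left_mono) (auto intro!: mult_nonneg_nonneg add_pos_nonneg)
    also have "\<dots> \<le> hit_discount (1/2 - x)" using two_sided_le 2 by simp
    finally have "explicit_reward K1 K2 x \<le> hit_discount (1/2 - x)" using 2 by (simp add: explicit_reward_def)
    moreover have "\<bar>x - 1/2\<bar> = 1/2 - x" using 2 by simp
    ultimately show ?thesis by (simp only:)
  next
    case 3
    have "exp (K2 * (1/2 - x)) * hit_discount (x - 1/2) \<le> 1 * hit_discount (x - 1/2)"
      using 3 K hit_discount_pos[of "x - 1/2"] by (intro mult_right_mono) (auto simp: mult_le_0_iff)
    then show ?thesis using 3 by (simp add: explicit_reward_def)
  qed
qed

lemma explicit_reward_le_1: "explicit_reward K1 K2 x \<le> 1"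
  using explicit_reward_le_hit_discount[of x] hit_discount_le_1[of "\<bar>x - 1/2\<bar>"] by simp

end

section \<open>Values of mild equilibria\<close>

context brownian
begin

lemma f0_eq: "f0 M B x = hit_discount \<bar>x - 1/2\<bar>"
  by (simp add: f0_def expected_disc_eq)

lemma f1_eq: "f1 M B x = two_sided x"
proof -
  have f0: "f0 M B 0 = hit_discount (1/2)" by (simp add: f0_eq)
  have ratio: "(exp y - exp (- y)) / (exp z - exp (- z)) = sinh y / sinh z" for y z :: real
  proof -
    have "a / b = (a / 2) / (b / 2)" for a b :: real by simp
    then show ?thesis unfolding sinh_field_def .
  qed
  have "f1 M B x = integral {1..2} (\<lambda>r. sinh (sqrt (2 * r) * x) / sinh (sqrt (2 * r) / 2)
      + hit_discount (1/2) * (sinh (sqrt (2 * r) * (1/2 - x)) / sinh (sqrt (2 * r) / 2)))"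
    unfolding f1_def f0 by (simp only: mult_minus_left ratio) simp
  then show ?thesis
    unfolding two_sided_def integral_rates[OF continuous_two_sided] .
qed

lemma reward_eq: "reward M B K1 K2 = explicit_reward K1 K2"
  by (auto simp: fun_eq_iff reward_def explicit_reward_def f1_eq f0_eq expected_disc_eq)

lemma J_point:
  "J M B f x {a} = f a * expected_disc M B a x"
proof -
  have "disc (hitting_time B x {a} \<omega>) * f (x + B (real_of_ereal (hitting_time B x {a} \<omega>)) \<omega>)
     = f a * disc (hitting_time B x {a} \<omega>)" if "\<omega> \<in> space M" for \<omega>
    using at_hitting_time[OF that, of "{a}" x] by (cases "hitting_time B x {a} \<omega> = \<infinity>") auto
  then have "J M B f x {a} = expectation (\<lambda>\<omega>. f a * disc (hitting_time B x {a} \<omega>))"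
    unfolding J_def by (intro Bochner_Integration.integral_cong) auto
  then show ?thesis by (simp add: expected_disc_def)
qed

text \<open>The integral of a nonintegrable function is 0, whence the last hypothesis. In this form
  payoffs can be estimated without first proving that they are measurable.\<close>

lemma integral_le_integral:
  fixes f g :: "'a \<Rightarrow> real"
  assumes "integrable M g" "\<And>\<omega>. \<omega> \<in> space M \<Longrightarrow> f \<omega> \<le> g \<omega>" "0 \<le> expectation g"
  shows "expectation f \<le> expectation g"
proof (cases "integrable M f")
  case True
  show ?thesis by (rule Bochner_Integration.integral_mono[OF True assms(1) assms(2)])
qed (use assms(3) in \<open>simp add: not_integrable_integral_eq\<close>)

context
  fixes K1 K2 :: real and f :: "real \<Rightarrow> real"
  assumes K: "0 < K1" "0 < K2" and f: "f = explicit_reward K1 K2"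
begin

lemma J_half: "J M B f x {1/2} = hit_discount \<bar>x - 1/2\<bar>"
  by (simp add: J_point expected_disc_eq f explicit_reward_half[OF K])

lemma half_equilibrium: "{1/2} \<in> mild_equilibria M B f"
  unfolding mild_equilibria_def
  by (auto simp: J_half simp del: f) (auto simp: f explicit_reward_half[OF K] intro: explicit_reward_le_hit_discount[OF K])

lemma half_in_equilibrium:
  assumes "S \<in> mild_equilibria M B f" shows "1/2 \<in> S"
proof (rule ccontr)
  assume nS: "1/2 \<notin> S"
  have S: "closed S" and le: "f (1/2) \<le> J M B f (1/2) S"
    using assms nS by (auto simp: mild_equilibria_def)
  have "open (- S)" using S by (rule open_Compl)
  then have "\<forall>y\<in>- S. \<exists>e>0. ball y e \<subseteq> - S" by (simp only: open_contains_ball)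
  moreover have "1/2 \<in> - S" using nS by (rule ComplI[OF notE])
  ultimately obtain \<epsilon> where \<epsilon>: "0 < \<epsilon>" "ball (1/2) \<epsilon> \<subseteq> - S" by blast
  have f_le: "f y \<le> hit_discount \<epsilon>" if "y \<in> S" for y
  proof -
    have "y \<notin> ball (1/2) \<epsilon>" using that \<epsilon>(2) by blast
    then have "\<epsilon> \<le> \<bar>y - 1/2\<bar>" by (simp add: dist_real_def abs_minus_commute)
    from order_trans[OF explicit_reward_le_hit_discount[OF K] hit_discount_antimono[OF this]]
    show ?thesis unfolding f .
  qed
  have "J M B f (1/2) S \<le> expectation (\<lambda>_. hit_discount \<epsilon>)"
    unfolding J_def
  proof (rule integral_le_integral)
    fix \<omega> assume \<omega>: "\<omega> \<in> space M"
    let ?\<tau> = "hitting_time B (1/2) S \<omega>" and ?X = "1/2 + B (real_of_ereal (hitting_time B (1/2) S \<omega>)) \<omega>"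
    show "disc ?\<tau> * f ?X \<le> hit_discount \<epsilon>"
    proof (cases "?\<tau> = \<infinity>")
      case False
      have "f ?X \<le> hit_discount \<epsilon>"
        by (rule f_le[OF at_hitting_time[OF \<omega> S False]])
      then have "disc ?\<tau> * f ?X \<le> 1 * hit_discount \<epsilon>"
        using explicit_reward_nonneg[OF K] f disc_le_1[OF hitting_time_nonneg] by (intro mult_mono) auto
      then show ?thesis by simp
    qed (use hit_discount_pos[of \<epsilon>] \<epsilon>(1) in simp)
  qed (use \<epsilon>(1) hit_discount_pos[of \<epsilon>] in auto)
  also have "\<dots> \<le> exp (- \<epsilon>)" using \<epsilon>(1) hit_discount_le_exp[of \<epsilon>] by (simp add: prob_space)
  also have "\<dots> < 1" using \<epsilon>(1) by simp
  finally show False using le f explicit_reward_half[OF K] by simp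
qed

lemma J_le_hit_discount:
  assumes "S \<in> mild_equilibria M B f" shows "J M B f x S \<le> hit_discount \<bar>x - 1/2\<bar>"
proof (cases "x \<in> S")
  case True
  then have "J M B f x S \<le> f x" using assms by (auto simp: mild_equilibria_def)
  also have "\<dots> \<le> hit_discount \<bar>x - 1/2\<bar>" using explicit_reward_le_hit_discount[OF K] f by simp
  finally show ?thesis .
next
  case False
  have S: "closed S" "1/2 \<in> S" using assms half_in_equilibrium by (auto simp: mild_equilibria_def)
  note H = hit_discount_martingale[OF S False]
  show ?thesis
    unfolding H(2)[symmetric] J_def
  proof (rule integral_le_integral[OF H(1)])
    fix \<omega> assume \<omega>: "\<omega> \<in> space M"
    define t where "t = real_of_ereal (hitting_time B x S \<omega>)"
    define d where "d = \<bar>x + B t \<omega> - 1/2\<bar>"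
    have "disc (ereal t) * f (x + B t \<omega>) \<le> disc (ereal t) * hit_discount d"
      using explicit_reward_le_hit_discount[OF K] f by (auto simp: d_def intro!: mult_left_mono)
    \<comment> \<open>On the fixed path \<open>t\<close> and \<open>d\<close> are constants, and
      both exponentials decrease in \<open>r\<close>.\<close>
    also have "\<dots> \<le> (\<integral>r. exp (- r * t) * exp (- sqrt (2 * r) * d) \<partial>rates)"
      unfolding disc_eq hit_discount_def
    proof (rule chebyshev_rates(2)[OF continuous_disc_integrand _ integrable_hit_integrand])
      have "0 \<le> t" unfolding t_def by (intro real_of_ereal_pos hitting_time_nonneg)
      then show "exp (- s * t) \<le> exp (- r * t)" if "r \<le> s" for r s
        using that by (simp add: mult_right_mono)
      show "exp (- sqrt (2 * s) * d) \<le> exp (- sqrt (2 * r) * d)" if "r \<le> s" for r s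
        using that by (auto simp: d_def intro: mult_right_mono)
    qed
    finally show "disc (hitting_time B x S \<omega>) * f (x + B (real_of_ereal (hitting_time B x S \<omega>)) \<omega>)
      \<le> (if hitting_time B x S \<omega> = \<infinity> then 0
          else \<integral>r. exp (- r * real_of_ereal (hitting_time B x S \<omega>)) *
               exp (- sqrt (2 * r) * \<bar>x + B (real_of_ereal (hitting_time B x S \<omega>)) \<omega> - 1/2\<bar>) \<partial>rates)"
      using hitting_time_nonneg[of x S \<omega>] unfolding d_def t_def by (cases "hitting_time B x S \<omega>") auto
  qed (simp add: H(2) hit_discount_pos less_imp_le)
qed

lemma S_star_eq: "S_star M B f = {1/2}"
  unfolding S_star_def using half_equilibrium half_in_equilibrium by blast

lemma V_eq: "V M B f x = hit_discount \<bar>x - 1/2\<bar>"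
  unfolding V_def
proof (rule cSup_eq_maximum)
  show "hit_discount \<bar>x - 1/2\<bar> \<in> (\<lambda>S. J M B f x S) ` mild_equilibria M B f"
    using half_equilibrium J_half[of x] by (metis (no_types, lifting) imageI)
qed (use J_le_hit_discount in auto)

end

end

section \<open>Hitting values of the random walk\<close>

definition walk_pos :: "int \<Rightarrow> int stream \<Rightarrow> nat \<Rightarrow> int" where
  "walk_pos k \<omega> j = k + (\<Sum>i<j. \<omega> !! i)"

text \<open>The payoff at one rate, on the integer lattice. Discounting by powers of
  \<open>b\<close> admits a one-step recursion, which the payoff averaged over rates does not. As in
  the tree model, \<open>m\<close> decides whether time 0 counts.\<close>

definition hit_pay :: "nat \<Rightarrow> real \<Rightarrow> (int \<Rightarrow> real) \<Rightarrow> int set \<Rightarrow> int \<Rightarrow> int stream \<Rightarrow> real" where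
  "hit_pay m b G A k \<omega> =
     (if \<exists>j\<ge>m. walk_pos k \<omega> j \<in> A
      then b ^ (LEAST j. m \<le> j \<and> walk_pos k \<omega> j \<in> A) * G (walk_pos k \<omega> (LEAST j. m \<le> j \<and> walk_pos k \<omega> j \<in> A))
      else 0)"

definition hit_value :: "nat \<Rightarrow> real \<Rightarrow> (int \<Rightarrow> real) \<Rightarrow> int set \<Rightarrow> int \<Rightarrow> real" where
  "hit_value m b G A k = (\<integral>\<omega>. hit_pay m b G A k \<omega> \<partial>steps)"

lemma prob_space_steps: "prob_space steps"
  unfolding steps_def by (rule prob_space.prob_space_stream_space[OF measure_pmf.prob_space_axioms])

interpretation steps: prob_space steps
  by (rule prob_space_steps)

lemma space_steps [simp]: "space steps = UNIV"
  by (simp add: steps_def space_stream_space)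

lemma snth_measurable: "(\<lambda>\<omega>. \<omega> !! i) \<in> steps \<rightarrow>\<^sub>M count_space UNIV"
proof -
  have "(\<lambda>\<omega>. \<omega> !! i) \<in> steps \<rightarrow>\<^sub>M measure_pmf (pmf_of_set {-1, 1})"
    unfolding steps_def by (rule measurable_snth)
  then show ?thesis by simp
qed

lemma walk_pos_measurable [measurable]: "(\<lambda>\<omega>. walk_pos k \<omega> j) \<in> steps \<rightarrow>\<^sub>M count_space UNIV"
proof (induction j)
  case (Suc j)
  note [measurable] = Suc snth_measurable
  have "walk_pos k \<omega> (Suc j) = walk_pos k \<omega> j + \<omega> !! j" for \<omega> by (simp add: walk_pos_def)
  then show ?case by simp
qed (simp add: walk_pos_def)

lemma walk_pos_0 [simp]: "walk_pos k \<omega> 0 = k"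
  by (simp add: walk_pos_def)

lemma walk_pos_Stream: "walk_pos k (x ## \<omega>) (Suc j) = walk_pos (k + x) \<omega> j"
  by (simp add: walk_pos_def sum.lessThan_Suc_shift del: sum.lessThan_Suc)

lemma hit_pay_Stream_1: "hit_pay 1 b G A k (x ## \<omega>) = b * hit_pay 0 b G A (k + x) \<omega>"
proof (cases "\<exists>j. walk_pos (k + x) \<omega> j \<in> A")
  case True
  then obtain j where "walk_pos (k + x) \<omega> j \<in> A" by blast
  then have ex: "1 \<le> Suc j \<and> walk_pos k (x ## \<omega>) (Suc j) \<in> A" by (simp add: walk_pos_Stream)
  have "(LEAST j. 1 \<le> j \<and> walk_pos k (x ## \<omega>) j \<in> A) = Suc (LEAST j. 1 \<le> Suc j \<and> walk_pos k (x ## \<omega>) (Suc j) \<in> A)"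
    by (rule Least_Suc[of "\<lambda>j. 1 \<le> j \<and> walk_pos k (x ## \<omega>) j \<in> A", OF ex]) simp
  also have "\<dots> = Suc (LEAST j. walk_pos (k + x) \<omega> j \<in> A)" by (simp add: walk_pos_Stream)
  finally have L: "(LEAST j. 1 \<le> j \<and> walk_pos k (x ## \<omega>) j \<in> A) = Suc (LEAST j. walk_pos (k + x) \<omega> j \<in> A)" .
  have "\<exists>j\<ge>1. walk_pos k (x ## \<omega>) j \<in> A" using ex by blast
  then show ?thesis
    using True unfolding hit_pay_def L by (simp add: walk_pos_Stream mult.assoc)
next
  case False
  have "\<not> (\<exists>j\<ge>1. walk_pos k (x ## \<omega>) j \<in> A)"
  proof safe
    fix j :: nat assume "1 \<le> j" "walk_pos k (x ## \<omega>) j \<in> A"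
    with False show False by (cases j) (auto simp: walk_pos_Stream)
  qed
  then have "hit_pay 1 b G A k (x ## \<omega>) = 0" unfolding hit_pay_def by (rule if_not_P)
  moreover have "hit_pay 0 b G A (k + x) \<omega> = 0" using False by (simp add: hit_pay_def)
  ultimately show ?thesis by simp
qed

lemma hit_pay_at: "k \<in> A \<Longrightarrow> hit_pay 0 b G A k \<omega> = G k"
proof -
  assume "k \<in> A"
  then have "(LEAST j. walk_pos k \<omega> j \<in> A) = 0" by (intro Least_equality) auto
  moreover have "\<exists>j. walk_pos k \<omega> j \<in> A" using \<open>k \<in> A\<close> by (intro exI[of _ 0]) simp
  ultimately show ?thesis by (simp add: hit_pay_def)
qed

lemma hit_pay_off:
  assumes "k \<notin> A" shows "hit_pay 0 b G A k \<omega> = hit_pay 1 b G A k \<omega>"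
proof -
  have "(0 \<le> j \<and> walk_pos k \<omega> j \<in> A) = (1 \<le> j \<and> walk_pos k \<omega> j \<in> A)" for j
    using assms by (cases j) auto
  then show ?thesis unfolding hit_pay_def by presburger
qed

lemma hit_pay_bounds:
  assumes "0 \<le> b" "b \<le> 1" "\<And>y. y \<in> A \<Longrightarrow> 0 \<le> G y \<and> G y \<le> C" "0 \<le> C"
  shows "0 \<le> hit_pay m b G A k \<omega>" "hit_pay m b G A k \<omega> \<le> C"
proof -
  have "0 \<le> b ^ j * G y \<and> b ^ j * G y \<le> C" if "y \<in> A" for j y
    using assms that mult_mono[of "b ^ j" 1 "G y" C] by (simp add: power_le_one)
  moreover have "walk_pos k \<omega> (LEAST j. m \<le> j \<and> walk_pos k \<omega> j \<in> A) \<in> A" if "\<exists>j\<ge>m. walk_pos k \<omega> j \<in> A"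
    using LeastI_ex[of "\<lambda>j. m \<le> j \<and> walk_pos k \<omega> j \<in> A"] that by blast
  ultimately show "0 \<le> hit_pay m b G A k \<omega>" "hit_pay m b G A k \<omega> \<le> C"
    using assms(4) by (auto simp: hit_pay_def)
qed

lemma hit_pay_measurable:
  assumes [measurable]: "b \<in> borel_measurable N" "\<And>y. (\<lambda>r. G r y) \<in> borel_measurable N"
  shows "(\<lambda>(\<omega>, r). hit_pay m (b r) (G r) A k \<omega>) \<in> borel_measurable (steps \<Otimes>\<^sub>M N)"
proof -
  let ?L = "\<lambda>\<omega>. LEAST j. m \<le> j \<and> walk_pos k \<omega> j \<in> A"
  have [measurable]: "?L \<in> steps \<rightarrow>\<^sub>M count_space UNIV" by measurable
  have [measurable]: "(\<lambda>\<omega>. walk_pos k \<omega> (?L \<omega>)) \<in> steps \<rightarrow>\<^sub>M count_space UNIV"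
    by (rule measurable_compose_countable[where g = ?L]) measurable
  have [measurable]: "(\<lambda>p. G (snd p) (walk_pos k (fst p) (?L (fst p)))) \<in> borel_measurable (steps \<Otimes>\<^sub>M N)"
    by (rule measurable_compose_countable[where g = "\<lambda>p. walk_pos k (fst p) (?L (fst p))" and f = "\<lambda>y p. G (snd p) y"]) measurable
  have [measurable]: "(\<lambda>p. b (snd p) ^ ?L (fst p)) \<in> borel_measurable (steps \<Otimes>\<^sub>M N)"
    by (rule measurable_compose_countable[where g = "\<lambda>p. ?L (fst p)" and f = "\<lambda>j p. b (snd p) ^ j"]) measurable
  have [measurable]: "Measurable.pred steps (\<lambda>\<omega>. \<exists>j\<ge>m. walk_pos k \<omega> j \<in> A)" by measurable
  show ?thesis
    unfolding hit_pay_def case_prod_beta by measurable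
qed

lemma hit_pay_measurable_steps: "hit_pay m b G A k \<in> borel_measurable steps"
proof -
  have "(\<lambda>(\<omega>, r). hit_pay m b G A k \<omega>) \<in> borel_measurable (steps \<Otimes>\<^sub>M (count_space UNIV :: unit measure))"
    by (rule hit_pay_measurable[where b = "\<lambda>_. b" and G = "\<lambda>_. G"]) auto
  then have "(\<lambda>\<omega>. (\<lambda>(\<omega>, r). hit_pay m b G A k \<omega>) (\<omega>, ())) \<in> borel_measurable steps"
    by (rule measurable_compose[rotated]) simp
  then show ?thesis by simp
qed

lemma hit_pay_integrable:
  assumes "0 \<le> b" "b \<le> 1" "\<And>y. y \<in> A \<Longrightarrow> 0 \<le> G y \<and> G y \<le> C" "0 \<le> C"
  shows "integrable steps (hit_pay m b G A k)"
  using hit_pay_bounds[OF assms]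
  by (intro steps.integrable_const_bound[where B = C] hit_pay_measurable_steps) auto

lemma integral_steps:
  fixes g :: "int stream \<Rightarrow> real"
  assumes g: "g \<in> borel_measurable steps" "\<And>\<omega>. 0 \<le> g \<omega>" "\<And>\<omega>. g \<omega> \<le> C"
  shows "(\<integral>\<omega>. g \<omega> \<partial>steps) = ((\<integral>\<omega>. g (1 ## \<omega>) \<partial>steps) + (\<integral>\<omega>. g ((-1) ## \<omega>) \<partial>steps)) / 2"
proof -
  have meas: "(\<lambda>\<omega>. g (x ## \<omega>)) \<in> borel_measurable steps" for x
  proof (rule measurable_compose[OF _ g(1)])
    show "(\<lambda>\<omega>. x ## \<omega>) \<in> steps \<rightarrow>\<^sub>M steps"
      unfolding steps_def by measurable
  qed
  have eq: "(\<integral>\<^sup>+\<omega>. ennreal (f \<omega>) \<partial>steps) = ennreal (\<integral>\<omega>. f \<omega> \<partial>steps)"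
    if "f \<in> borel_measurable steps" "\<And>\<omega>. 0 \<le> f \<omega>" "\<And>\<omega>. f \<omega> \<le> C" for f :: "int stream \<Rightarrow> real"
    using that by (intro nn_integral_eq_integral steps.integrable_const_bound[where B = C]) auto
  have "ennreal (\<integral>\<omega>. g \<omega> \<partial>steps) = (\<integral>\<^sup>+\<omega>. ennreal (g \<omega>) \<partial>steps)"
    using g by (intro eq[symmetric])
  also have "\<dots> = (\<integral>\<^sup>+x. (\<integral>\<^sup>+\<omega>. ennreal (g (x ## \<omega>)) \<partial>steps) \<partial>measure_pmf (pmf_of_set {-1, 1}))"
    unfolding steps_def using g(1) by (intro prob_space.nn_integral_stream_space[OF measure_pmf.prob_space_axioms]) (simp add: steps_def)
  also have "\<dots> = (\<integral>\<^sup>+x. ennreal (\<integral>\<omega>. g (x ## \<omega>) \<partial>steps) \<partial>measure_pmf (pmf_of_set {-1, 1}))"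
    using g meas by (intro nn_integral_cong eq) auto
  also have "\<dots> = (\<Sum>x\<in>{-1, 1 :: int}. ennreal (\<integral>\<omega>. g (x ## \<omega>) \<partial>steps)) / 2"
    by (subst nn_integral_pmf_of_set) auto
  also have "\<dots> = ennreal (((\<integral>\<omega>. g (1 ## \<omega>) \<partial>steps) + (\<integral>\<omega>. g ((-1) ## \<omega>) \<partial>steps)) / 2)"
    using g by (simp add: add.commute ennreal_plus[symmetric] divide_ennreal[symmetric] integral_nonneg_AE del: ennreal_plus)
  finally show ?thesis
    using g by (subst (asm) ennreal_inj) (auto intro!: divide_nonneg_nonneg add_nonneg_nonneg integral_nonneg_AE)
qed

section \<open>Comparison of hitting values with super- and subsolutions\<close>

context
  fixes b C :: real and G :: "int \<Rightarrow> real" and A :: "int set"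
  assumes b: "0 \<le> b" "b < 1" and G: "\<And>y. y \<in> A \<Longrightarrow> 0 \<le> G y \<and> G y \<le> C" and C: "0 \<le> C"
begin

lemma hit_value_bounds: "0 \<le> hit_value m b G A k" "hit_value m b G A k \<le> C"
proof -
  note bd = hit_pay_bounds[OF b(1) less_imp_le[OF b(2)] G C]
  show "0 \<le> hit_value m b G A k"
    unfolding hit_value_def using bd(1) by (intro integral_nonneg_AE) auto
  show "hit_value m b G A k \<le> C"
    unfolding hit_value_def
    using bd(2) hit_pay_integrable[OF b(1) less_imp_le[OF b(2)] G C] by (intro steps.integral_le_const) auto
qed

lemma hit_value_1: "hit_value 1 b G A k = b / 2 * (hit_value 0 b G A (k + 1) + hit_value 0 b G A (k - 1))"
proof -
  note bd = hit_pay_bounds[OF b(1) less_imp_le[OF b(2)] G C]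
  show ?thesis
    unfolding hit_value_def
    by (subst integral_steps[OF hit_pay_measurable_steps bd]) (simp_all add: hit_pay_Stream_1[unfolded One_nat_def] distrib_left)
qed

lemma hit_value_at: "k \<in> A \<Longrightarrow> hit_value 0 b G A k = G k"
  by (simp add: hit_value_def hit_pay_at steps.prob_space[simplified])

lemma hit_value_off:
  "k \<notin> A \<Longrightarrow> hit_value 0 b G A k = b / 2 * (hit_value 0 b G A (k + 1) + hit_value 0 b G A (k - 1))"
  unfolding hit_value_1[symmetric] by (simp add: hit_value_def hit_pay_off)

text \<open>Verification by contraction instead of optional stopping: on \<open>A\<close> there is
  no excess over \<open>w\<close>, elsewhere it is at most \<open>b\<close> times the mean excess at
  the two neighbours. After \<open>n\<close> rounds the bound is \<open>b ^ n * C\<close>, which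
  tends to 0.\<close>

lemma hit_value_le_super:
  assumes "\<And>y. 0 \<le> w y" and A: "\<And>y. y \<in> A \<Longrightarrow> G y \<le> w y"
    and super: "\<And>y. y \<notin> A \<Longrightarrow> b / 2 * (w (y + 1) + w (y - 1)) \<le> w y"
  shows "hit_value 0 b G A k \<le> w k"
proof -
  have step: "hit_value 0 b G A k - w k \<le> b ^ n * C" for n k
  proof (induction n arbitrary: k)
    case 0
    show ?case using hit_value_bounds(2)[of 0 k] assms(1)[of k] by simp
  next
    case (Suc n)
    show ?case
    proof (cases "k \<in> A")
      case True
      then show ?thesis using A[OF True] mult_nonneg_nonneg[OF zero_le_power[OF b(1)] C, of "Suc n"]
        by (simp only: hit_value_at)
    next
      case False
      have "hit_value 0 b G A k - w k \<le> b / 2 * ((hit_value 0 b G A (k + 1) - w (k + 1)) + (hit_value 0 b G A (k - 1) - w (k - 1)))"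
        using super[OF False] by (simp add: hit_value_off[OF False] algebra_simps)
      also have "\<dots> \<le> b / 2 * (b ^ n * C + b ^ n * C)"
        using Suc b by (intro mult_left_mono add_mono) auto
      finally show ?thesis by (simp add: mult_ac)
    qed
  qed
  have "(\<lambda>n. b ^ n * C) \<longlonglongrightarrow> 0 * C"
    using b by (intro tendsto_intros LIMSEQ_power_zero) auto
  then have "hit_value 0 b G A k - w k \<le> 0 * C"
    by (rule LIMSEQ_le_const) (use step in blast)
  then show ?thesis by simp
qed

text \<open>The same contraction with the roles exchanged, so the initial bound now comes from
  \<open>w\<close>.\<close>

lemma hit_value_ge_sub:
  assumes "\<And>y. w y \<le> C'" "0 \<le> C'" and A: "\<And>y. y \<in> A \<Longrightarrow> w y \<le> G y"
    and sub: "\<And>y. y \<notin> A \<Longrightarrow> w y \<le> b / 2 * (w (y + 1) + w (y - 1))"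
  shows "w k \<le> hit_value 0 b G A k"
proof -
  have step: "w k - hit_value 0 b G A k \<le> b ^ n * C'" for n k
  proof (induction n arbitrary: k)
    case 0
    show ?case using hit_value_bounds(1)[of 0 k] assms(1)[of k] by simp
  next
    case (Suc n)
    show ?case
    proof (cases "k \<in> A")
      case True
      then show ?thesis using A[OF True] mult_nonneg_nonneg[OF zero_le_power[OF b(1)] assms(2), of "Suc n"]
        by (simp only: hit_value_at)
    next
      case False
      have "w k - hit_value 0 b G A k \<le> b / 2 * ((w (k + 1) - hit_value 0 b G A (k + 1)) + (w (k - 1) - hit_value 0 b G A (k - 1)))"
        using sub[OF False] by (simp add: hit_value_off[OF False] algebra_simps)
      also have "\<dots> \<le> b / 2 * (b ^ n * C' + b ^ n * C')"
        using Suc b by (intro mult_left_mono add_mono) auto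
      finally show ?thesis by (simp add: mult_ac)
    qed
  qed
  have "(\<lambda>n. b ^ n * C') \<longlonglongrightarrow> 0 * C'"
    using b by (intro tendsto_intros LIMSEQ_power_zero) auto
  then have "w k - hit_value 0 b G A k \<le> 0 * C'"
    by (rule LIMSEQ_le_const) (use step in blast)
  then show ?thesis by simp
qed

end

text \<open>The reward may depend on the rate: this is what allows the pathwise use of Chebyshev's
  inequality below.\<close>

lemma hit_value_Fubini:
  assumes b: "b \<in> borel_measurable rates" "\<And>r. r \<in> {1..2} \<Longrightarrow> 0 \<le> b r \<and> b r \<le> 1"
    and G: "\<And>y. (\<lambda>r. G r y) \<in> borel_measurable rates"
      "\<And>r y. r \<in> {1..2} \<Longrightarrow> y \<in> A \<Longrightarrow> 0 \<le> G r y \<and> G r y \<le> C" and C: "0 \<le> C"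
  shows "integrable steps (\<lambda>\<omega>. \<integral>r. hit_pay m (b r) (G r) A k \<omega> \<partial>rates)"
    and "integrable rates (\<lambda>r. hit_value m (b r) (G r) A k)"
    and "(\<integral>\<omega>. (\<integral>r. hit_pay m (b r) (G r) A k \<omega> \<partial>rates) \<partial>steps) = (\<integral>r. hit_value m (b r) (G r) A k \<partial>rates)"
    and "integrable rates (\<lambda>r. hit_pay m (b r) (G r) A k \<omega>)"
proof -
  interpret P: pair_prob_space steps rates ..
  have bound: "norm (hit_pay m (b r) (G r) A k \<omega>) \<le> C" if "r \<in> {1..2}" for r \<omega>
    using hit_pay_bounds[of "b r" A "G r" C m k \<omega>] b(2)[OF that] G(2)[OF that] C by auto
  have int: "integrable (steps \<Otimes>\<^sub>M rates) (\<lambda>(\<omega>, r). hit_pay m (b r) (G r) A k \<omega>)"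
    using bound by (intro P.integrable_const_bound[where B = C] hit_pay_measurable b(1) G(1) AE_I2)
      (auto simp: space_pair_measure)
  show "integrable steps (\<lambda>\<omega>. \<integral>r. hit_pay m (b r) (G r) A k \<omega> \<partial>rates)"
    using P.integrable_fst'[OF int] by simp
  show "integrable rates (\<lambda>r. hit_value m (b r) (G r) A k)"
    unfolding hit_value_def using P.integrable_snd[OF int] by simp
  show "(\<integral>\<omega>. (\<integral>r. hit_pay m (b r) (G r) A k \<omega> \<partial>rates) \<partial>steps) = (\<integral>r. hit_value m (b r) (G r) A k \<partial>rates)"
    unfolding hit_value_def using P.Fubini_integral[OF int] by simp
  have "(\<lambda>r. hit_pay m (b r) (G r) A k \<omega>) \<in> borel_measurable rates"
    using measurable_compose[OF measurable_Pair1'[of \<omega> steps rates] hit_pay_measurable[OF b(1) G(1), where m = m and A = A and k = k]] by simp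
  then show "integrable rates (\<lambda>r. hit_pay m (b r) (G r) A k \<omega>)"
    using bound by (intro rates.integrable_const_bound[where B = C]) auto
qed

definition step_disc :: "real \<Rightarrow> real \<Rightarrow> real" where
  "step_disc s r = 1 / (1 + r * s\<^sup>2)"

text \<open>The counterpart of \<open>hit_discount\<close> for the walk with step size
  \<open>s\<close>: for a grid distance \<open>d\<close>, the expected discount factor of reaching a
  point that far away.\<close>

definition tree_discount :: "real \<Rightarrow> real \<Rightarrow> real" where
  "tree_discount s d = (\<integral>r. exp (- tree_rate s r * d) \<partial>rates)"

lemma step_disc_bounds:
  assumes "s \<noteq> 0" "r \<in> {1..2}"
  shows "0 < step_disc s r" "step_disc s r < 1" "step_disc s r \<le> 1 / (1 + s\<^sup>2)"
proof -
  have p: "0 < s\<^sup>2" "s\<^sup>2 \<le> r * s\<^sup>2" using assms by (simp_all add: mult_le_cancel_right1)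
  then have "1 < 1 + r * s\<^sup>2" by linarith
  then show "0 < step_disc s r" "step_disc s r < 1" by (simp_all add: step_disc_def)
  show "step_disc s r \<le> 1 / (1 + s\<^sup>2)" using p unfolding step_disc_def by (intro divide_left_mono mult_pos_pos) linarith+
qed

lemma step_disc_antimono:
  assumes "s \<noteq> 0" "1 \<le> r" "r \<le> t" shows "step_disc s t \<le> step_disc s r"
  unfolding step_disc_def using assms
  by (intro divide_left_mono add_left_mono mult_right_mono mult_pos_pos add_pos_nonneg mult_nonneg_nonneg) auto

lemma continuous_step_disc:
  assumes "s \<noteq> 0" shows "continuous_on {1..2} (step_disc s)"
  unfolding step_disc_def
proof (intro continuous_intros ballI)
  fix r :: real assume "r \<in> {1..2}"
  then show "1 + r * s\<^sup>2 \<noteq> 0" by (smt (verit) atLeastAtMost_iff mult_nonneg_nonneg zero_le_power2)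
qed

lemma step_disc_measurable: "s \<noteq> 0 \<Longrightarrow> step_disc s \<in> borel_measurable rates"
  by (rule borel_measurable_integrable[OF integrable_rates[OF continuous_step_disc]])

lemma continuous_tree_discount: "continuous_on {1..2} (\<lambda>r. exp (- tree_rate s r * d))"
  by (intro continuous_intros)

lemmas integrable_tree_discount = integrable_rates[OF continuous_tree_discount]

lemma tree_discount_le:
  assumes "0 < s" "0 \<le> d" shows "tree_discount s d \<le> exp (s\<^sup>2 * d) * hit_discount d"
proof -
  have "tree_discount s d \<le> (\<integral>r. exp (s\<^sup>2 * d) * exp (- sqrt (2 * r) * d) \<partial>rates)"
    unfolding tree_discount_def
  proof (rule integral_mono[OF integrable_tree_discount])
    show "integrable rates (\<lambda>r. exp (s\<^sup>2 * d) * exp (- sqrt (2 * r) * d))"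
      using integrable_hit_integrand by simp
    fix r assume "r \<in> space rates"
    then have "(sqrt (2 * r) - s\<^sup>2) * d \<le> tree_rate s r * d"
      using assms by (intro mult_right_mono tree_rate_ge) auto
    then show "exp (- tree_rate s r * d) \<le> exp (s\<^sup>2 * d) * exp (- sqrt (2 * r) * d)"
      by (simp add: algebra_simps flip: exp_add)
  qed
  then show ?thesis by (simp add: hit_discount_def)
qed

lemma tree_discount_ge:
  assumes "0 < s" "0 \<le> d" shows "hit_discount d \<le> tree_discount s d"
  unfolding tree_discount_def hit_discount_def
proof (rule integral_mono[OF integrable_hit_integrand integrable_tree_discount])
  fix r assume "r \<in> space rates"
  then show "exp (- sqrt (2 * r) * d) \<le> exp (- tree_rate s r * d)"
    using mult_right_mono[OF tree_rate_le[of s r] assms(2)] assms(1) by simp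
qed

text \<open>Averaging over the two neighbours multiplies either exponential by
  \<open>cosh c = 1 + r * s\<^sup>2\<close>, and \<open>step_disc\<close> cancels this
  factor.\<close>

lemma step_disc_harmonic:
  assumes "0 < s" "r \<in> {1..2}"
  defines "c \<equiv> tree_rate s r * s"
  shows "step_disc s r / 2 * (exp (c * real_of_int (y + 1)) + exp (c * real_of_int (y - 1))) = exp (c * y)"
    and "step_disc s r / 2 * (exp (- c * real_of_int (y + 1)) + exp (- c * real_of_int (y - 1))) = exp (- c * y)"
proof -
  have pos: "1 + r * s\<^sup>2 \<noteq> 0" using assms by (smt (verit) atLeastAtMost_iff mult_nonneg_nonneg zero_le_power2)
  have cosh: "exp c + exp (- c) = 2 * (1 + r * s\<^sup>2)"
    using cosh_tree_rate[of s r] assms by (simp add: cosh_field_def c_def)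
  have "exp (c * real_of_int (y + 1)) + exp (c * real_of_int (y - 1)) = exp (c * y) * (exp c + exp (- c))"
    by (simp add: algebra_simps flip: exp_add)
  then show "step_disc s r / 2 * (exp (c * real_of_int (y + 1)) + exp (c * real_of_int (y - 1))) = exp (c * y)"
    unfolding cosh using pos by (simp add: step_disc_def field_simps)
  have "exp (- c * real_of_int (y + 1)) + exp (- c * real_of_int (y - 1)) = exp (- c * y) * (exp c + exp (- c))"
    by (simp add: algebra_simps flip: exp_add)
  then show "step_disc s r / 2 * (exp (- c * real_of_int (y + 1)) + exp (- c * real_of_int (y - 1))) = exp (- c * y)"
    unfolding cosh using pos by (simp add: step_disc_def field_simps)
qed

lemma INF_enat_eq: "(INF j\<in>{j. P j}. enat j) = (if \<exists>j. P j then enat (LEAST j. P j) else \<infinity>)"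
proof (cases "\<exists>j. P j")
  case True
  have "(INF j\<in>{j. P j}. enat j) = enat (LEAST j. P j)"
  proof (rule antisym)
    show "(INF j\<in>{j. P j}. enat j) \<le> enat (LEAST j. P j)"
      using LeastI_ex[OF True] by (intro INF_lower) auto
    show "enat (LEAST j. P j) \<le> (INF j\<in>{j. P j}. enat j)"
      by (intro INF_greatest) (auto intro: Least_le)
  qed
  with True show ?thesis by simp
next
  case False
  then have "{j. P j} = {}" by blast
  with False show ?thesis by (simp add: top_enat_def)
qed

text \<open>The average over the rates is kept inside the path integral, so that Chebyshev can be
  used path by path before Fubini.\<close>

lemma tree_payoff_eq:
  assumes s: "0 < s"
  shows "tree_payoff m (s\<^sup>2) f (real_of_int k * s) S =
    (\<integral>\<omega>. (\<integral>r. hit_pay m (step_disc s r) (\<lambda>y. f (real_of_int y * s)) {y. real_of_int y * s \<in> S} k \<omega> \<partial>rates) \<partial>steps)"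
  unfolding tree_payoff_def
proof (rule Bochner_Integration.integral_cong[OF refl])
  fix \<omega>
  let ?A = "{y. real_of_int y * s \<in> S}" and ?F = "\<lambda>y. f (real_of_int y * s)"
  have walk: "walk (s\<^sup>2) (real_of_int k * s) \<omega> j = real_of_int (walk_pos k \<omega> j) * s" for j
    using s by (simp add: walk_def walk_pos_def algebra_simps)
  let ?P = "\<lambda>j. m \<le> j \<and> walk_pos k \<omega> j \<in> ?A"
  have T: "tree_hitting_time m (s\<^sup>2) (real_of_int k * s) S \<omega> = (if \<exists>j. ?P j then enat (LEAST j. ?P j) else \<infinity>)"
    unfolding tree_hitting_time_def INF_enat_eq walk by simp
  show "tree_disc (s\<^sup>2) (tree_hitting_time m (s\<^sup>2) (real_of_int k * s) S \<omega>) *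
      f (walk (s\<^sup>2) (real_of_int k * s) \<omega> (the_enat (tree_hitting_time m (s\<^sup>2) (real_of_int k * s) S \<omega>)))
    = (\<integral>r. hit_pay m (step_disc s r) ?F ?A k \<omega> \<partial>rates)"
  proof (cases "\<exists>j. ?P j")
    case True
    let ?L = "LEAST j. ?P j"
    have "tree_disc (s\<^sup>2) (enat ?L) = integral {1..2} (\<lambda>r. step_disc s r ^ ?L)"
      by (simp add: tree_disc_def step_disc_def power_divide)
    also have "\<dots> = (\<integral>r. step_disc s r ^ ?L \<partial>rates)"
      using s by (intro integral_rates continuous_intros continuous_step_disc) simp
    finally have "tree_disc (s\<^sup>2) (enat ?L) = (\<integral>r. step_disc s r ^ ?L \<partial>rates)" .
    then show ?thesis
      using True unfolding T walk hit_pay_def by simp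
  next
    case False
    then have "hit_pay m b G ?A k \<omega> = 0" for b G unfolding hit_pay_def by (rule if_not_P)
    \<comment> \<open>The walk never arrives: \<open>tree_disc\<close> vanishes, so the position at
      \<open>the_enat\<close> of infinity does not matter.\<close>
    with False show ?thesis unfolding T by (simp only: if_False) (simp add: tree_disc_def)
  qed
qed

text \<open>The index \<open>j\<close> depends on the path alone, so one case distinction serves all
  discounts and rewards at once.\<close>

lemma hit_pay_cases:
  obtains "\<And>b G. hit_pay m b G A k \<omega> = 0"
  | j where "walk_pos k \<omega> j \<in> A" "\<And>b G. hit_pay m b G A k \<omega> = b ^ j * G (walk_pos k \<omega> j)"
proof (cases "\<exists>j\<ge>m. walk_pos k \<omega> j \<in> A")
  case True
  then have "walk_pos k \<omega> (LEAST j. m \<le> j \<and> walk_pos k \<omega> j \<in> A) \<in> A"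
    using LeastI_ex[of "\<lambda>j. m \<le> j \<and> walk_pos k \<omega> j \<in> A"] by blast
  then show ?thesis using that(2) True unfolding hit_pay_def if_P[OF True] by blast
next
  case False
  then show ?thesis using that(1) unfolding hit_pay_def if_not_P[OF False] by blast
qed

lemma hit_pay_add: "hit_pay m b (\<lambda>y. G y + G' y) A k \<omega> = hit_pay m b G A k \<omega> + hit_pay m b G' A k \<omega>"
  by (rule hit_pay_cases[of m A k \<omega>]) (simp_all add: distrib_left)

lemma hit_pay_cmult: "hit_pay m b (\<lambda>y. c * G y) A k \<omega> = c * hit_pay m b G A k \<omega>"
  by (rule hit_pay_cases[of m A k \<omega>]) simp_all

lemma hit_pay_mono:
  assumes "0 \<le> b'" "b' \<le> b" "\<And>y. y \<in> A \<Longrightarrow> 0 \<le> G' y \<and> G' y \<le> G y"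
  shows "hit_pay m b' G' A k \<omega> \<le> hit_pay m b G A k \<omega>"
  by (rule hit_pay_cases[of m A k \<omega>]) (use assms in \<open>auto intro!: mult_mono power_mono\<close>)

lemma hit_value_add:
  assumes "0 \<le> b" "b \<le> 1" "0 \<le> C" "\<And>y. y \<in> A \<Longrightarrow> 0 \<le> G y \<and> G y \<le> C" "\<And>y. y \<in> A \<Longrightarrow> 0 \<le> G' y \<and> G' y \<le> C"
  shows "hit_value m b (\<lambda>y. G y + G' y) A k = hit_value m b G A k + hit_value m b G' A k"
  unfolding hit_value_def hit_pay_add
  by (intro Bochner_Integration.integral_add hit_pay_integrable[where C = C] assms)

lemma hit_value_cmult: "hit_value m b (\<lambda>y. c * G y) A k = c * hit_value m b G A k"
  unfolding hit_value_def hit_pay_cmult by simp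

text \<open>The walk cannot jump over a point of \<open>A\<close>.\<close>

lemma hit_value_beyond:
  assumes b: "0 \<le> b" "b < 1" and G: "\<And>y. y \<in> A \<Longrightarrow> 0 \<le> G y \<and> G y \<le> C" and C: "0 \<le> C"
    and q: "q \<in> A" "k \<le> q"
  shows "hit_value 0 b (\<lambda>y. if y \<le> q then 0 else G y) A k = 0"
proof -
  have bd: "0 \<le> (if y \<le> q then 0 else G y) \<and> (if y \<le> q then 0 else G y) \<le> C" if "y \<in> A" for y
    using G[OF that] C by simp
  have "hit_value 0 b (\<lambda>y. if y \<le> q then 0 else G y) A k \<le> (\<lambda>y. if y \<le> q then 0 else C) k"
  proof (rule hit_value_le_super[OF b bd C])
    fix y assume "y \<notin> A"
    then have "y \<noteq> q" using q by auto
    then show "b / 2 * ((if y + 1 \<le> q then 0 else C) + (if y - 1 \<le> q then 0 else C)) \<le> (if y \<le> q then 0 else C)"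
      using b C mult_left_le_one_le[of C b] mult_left_le_one_le[of C "b / 2"] by (auto simp: algebra_simps)
  qed (use G C in auto)
  with q hit_value_bounds(1)[where A = A and G = "\<lambda>y. if y \<le> q then 0 else G y" and m = 0 and k = k, OF b bd C] show ?thesis by simp
qed

text \<open>Sites above \<open>q\<close> contribute nothing to a walk that starts below it. For
  \<open>m = 1\<close> the condition \<open>k + int m \<le> q\<close> keeps the position after the
  first step at or below \<open>q\<close>.\<close>

lemma hit_value_restrict:
  assumes b: "0 \<le> b" "b < 1" and G: "\<And>y. y \<in> A \<Longrightarrow> 0 \<le> G y \<and> G y \<le> C" and C: "0 \<le> C"
    and q: "q \<in> A" "k + int m \<le> q" and m: "m \<le> 1"
  shows "hit_value m b G A k = hit_value m b (\<lambda>y. if y \<le> q then G y else 0) A k"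
proof -
  have lo: "0 \<le> (if y \<le> q then G y else 0) \<and> (if y \<le> q then G y else 0) \<le> C" if "y \<in> A" for y
    using G[OF that] C by simp
  have hi: "0 \<le> (if y \<le> q then 0 else G y) \<and> (if y \<le> q then 0 else G y) \<le> C" if "y \<in> A" for y
    using G[OF that] C by simp
  have zero: "hit_value 0 b (\<lambda>y. if y \<le> q then G y else 0) A k = hit_value 0 b G A k" if "k \<le> q" for k
  proof -
    have "G = (\<lambda>y. (if y \<le> q then G y else 0) + (if y \<le> q then 0 else G y))" by auto
    then have "hit_value 0 b G A k = hit_value 0 b (\<lambda>y. (if y \<le> q then G y else 0) + (if y \<le> q then 0 else G y)) A k"
      by simp
    also have "\<dots> = hit_value 0 b (\<lambda>y. if y \<le> q then G y else 0) A k + hit_value 0 b (\<lambda>y. if y \<le> q then 0 else G y) A k"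
      using b by (intro hit_value_add[where C = C] lo hi C) auto
    finally show ?thesis using hit_value_beyond[OF b G C q(1) that] by simp
  qed
  show ?thesis
  proof (cases "m = 0")
    case True
    then show ?thesis using zero[of k] q(2) by simp
  next
    case False
    then have "m = 1" using m by simp
    then show ?thesis
      using q(2) by (simp only: hit_value_1[OF b G C] hit_value_1[OF b lo C]) (simp add: zero)
  qed
qed

text \<open>A path determines one index \<open>j\<close> and one site, and
  \<open>step_disc s r ^ j\<close> decreases in \<open>r\<close>. A reward that is only bounded by
  an average over the rates may therefore be replaced by the rate-dependent integrand.\<close>

lemma hit_pay_chebyshev:
  assumes s: "0 < s"
    and g: "\<And>y. y \<in> A \<Longrightarrow> continuous_on {1..2} (\<lambda>r. g r y)"
    and g_mono: "\<And>y r t. \<lbrakk>y \<in> A; 1 \<le> r; r \<le> t; t \<le> 2\<rbrakk> \<Longrightarrow> g t y \<le> g r y"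
    and F: "\<And>y. y \<in> A \<Longrightarrow> F y \<le> (\<integral>r. g r y \<partial>rates)"
  shows "(\<integral>r. hit_pay m (step_disc s r) F A k \<omega> \<partial>rates) \<le> (\<integral>r. hit_pay m (step_disc s r) (g r) A k \<omega> \<partial>rates)"
proof (rule hit_pay_cases[of m A k \<omega>])
  fix j assume y: "walk_pos k \<omega> j \<in> A" and eq: "\<And>b G. hit_pay m b G A k \<omega> = b ^ j * G (walk_pos k \<omega> j)"
  let ?y = "walk_pos k \<omega> j"
  have s0: "s \<noteq> 0" using s by simp
  have cont: "continuous_on {1..2} (\<lambda>r. step_disc s r ^ j)"
    using s0 by (intro continuous_intros continuous_step_disc)
  have "(\<integral>r. step_disc s r ^ j * F ?y \<partial>rates) = (\<integral>r. step_disc s r ^ j \<partial>rates) * F ?y" by simp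
  also have "\<dots> \<le> (\<integral>r. step_disc s r ^ j \<partial>rates) * (\<integral>r. g r ?y \<partial>rates)"
    using step_disc_bounds[OF s0] by (intro mult_left_mono F y integral_nonneg_AE) (auto intro!: AE_I2 less_imp_le)
  also have "\<dots> \<le> (\<integral>r. step_disc s r ^ j * g r ?y \<partial>rates)"
  proof (rule chebyshev_rates(2)[OF cont _ integrable_rates[OF g[OF y]]])
    show "step_disc s t ^ j \<le> step_disc s r ^ j" if "1 \<le> r" "r \<le> t" "t \<le> 2" for r t
      using that s0 step_disc_bounds(1)[OF s0, of t] by (intro power_mono step_disc_antimono) auto
  qed (use g_mono y in auto)
  finally show ?thesis
    by (simp only: eq)
qed simp


lemma hit_value_cong:
  assumes "\<And>y. y \<in> A \<Longrightarrow> G y = G' y" shows "hit_value m b G A k = hit_value m b G' A k"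
proof -
  have "hit_pay m b G A k \<omega> = hit_pay m b G' A k \<omega>" for \<omega>
    by (rule hit_pay_cases[of m A k \<omega>]) (simp_all add: assms)
  then show ?thesis by (simp add: hit_value_def)
qed

lemma grid_floor_grid: "0 < s \<Longrightarrow> grid_floor (s\<^sup>2) (real_of_int k * s) = real_of_int k * s"
  by (simp add: grid_floor_def)

text \<open>At rate \<open>r\<close>, the discount factor of walking from \<open>y\<close> up to 0;
  positive sites carry weight 0.\<close>

definition below_weight :: "real \<Rightarrow> real \<Rightarrow> int \<Rightarrow> real" where
  "below_weight s r y = (if y \<le> 0 then exp (tree_rate s r * s * y) else 0)"

context
  fixes s :: real
  assumes s: "0 < s"
begin

lemma below_weight_bounds: "r \<in> {1..2} \<Longrightarrow> 0 \<le> below_weight s r y \<and> below_weight s r y \<le> 1"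
  using s tree_rate_pos[of s r] by (auto simp: below_weight_def mult_nonneg_nonpos)

lemma below_weight_antimono:
  assumes "r \<le> t" shows "below_weight s t y \<le> below_weight s r y"
proof -
  have "tree_rate s t * s * real_of_int y \<le> tree_rate s r * s * real_of_int y" if "y \<le> 0"
    using that s by (intro mult_right_mono_neg mult_right_mono tree_rate_mono assms) auto
  then show ?thesis by (simp add: below_weight_def)
qed

lemma continuous_below_weight: "continuous_on {1..2} (\<lambda>r. below_weight s r y)"
  unfolding below_weight_def by (cases "y \<le> 0") (auto intro!: continuous_intros)

lemma below_weight_measurable: "(\<lambda>r. below_weight s r y) \<in> borel_measurable rates"
  by (rule borel_measurable_integrable[OF integrable_rates[OF continuous_below_weight]])

lemma integral_below_weight: "y \<le> 0 \<Longrightarrow> (\<integral>r. below_weight s r y \<partial>rates) = tree_discount s (- (real_of_int y * s))"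
  by (simp add: below_weight_def tree_discount_def mult_ac)

lemma step_disc_facts: "s \<noteq> 0" "\<And>r. r \<in> {1..2} \<Longrightarrow> 0 \<le> step_disc s r \<and> step_disc s r \<le> 1"
  "\<And>r. r \<in> {1..2} \<Longrightarrow> 0 \<le> step_disc s r" "\<And>r. r \<in> {1..2} \<Longrightarrow> step_disc s r < 1"
  using s step_disc_bounds[of s] by (auto intro: less_imp_le)

text \<open>Along each path, a reward collected at \<open>y \<le> 0\<close> is exchanged for
  \<open>c\<close>, collected on reaching 0 later.\<close>

lemma below_value_le:
  assumes F: "\<And>y. y \<le> 0 \<Longrightarrow> F y \<le> c * tree_discount s (- (real_of_int y * s))"
    "\<And>y. 0 \<le> F y" "\<And>y. F y \<le> C" and c: "0 \<le> c"
  shows "(\<integral>r. hit_value m (step_disc s r) (\<lambda>y. if y \<le> 0 then F y else 0) A k \<partial>rates)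
    \<le> c * (\<integral>r. hit_value m (step_disc s r) (below_weight s r) A k \<partial>rates)"
proof -
  let ?F = "\<lambda>y. if y \<le> 0 then F y else 0"
  have C: "0 \<le> C" using F(2)[of 0] F(3)[of 0] by simp
  have Fb: "0 \<le> ?F y \<and> ?F y \<le> C" for y using F(2,3) C by simp
  have gb: "0 \<le> c * below_weight s r y \<and> c * below_weight s r y \<le> c" if "r \<in> {1..2}" for r y
    using below_weight_bounds[OF that, of y] c by (simp add: mult_left_le)
  note m = step_disc_measurable[OF step_disc_facts(1)]
  note FF = hit_value_Fubini[OF m step_disc_facts(2) borel_measurable_const Fb C]
  note FG = hit_value_Fubini[OF m step_disc_facts(2) borel_measurable_times[OF borel_measurable_const below_weight_measurable] gb c]
  have "(\<integral>r. hit_value m (step_disc s r) ?F A k \<partial>rates) = (\<integral>\<omega>. (\<integral>r. hit_pay m (step_disc s r) ?F A k \<omega> \<partial>rates) \<partial>steps)"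
    by (rule FF(3)[symmetric])
  also have "\<dots> \<le> (\<integral>\<omega>. (\<integral>r. hit_pay m (step_disc s r) (\<lambda>y. c * below_weight s r y) A k \<omega> \<partial>rates) \<partial>steps)"
  proof (rule integral_mono)
    show "integrable steps (\<lambda>\<omega>. \<integral>r. hit_pay m (step_disc s r) ?F A k \<omega> \<partial>rates)" by (rule FF(1))
    show "integrable steps (\<lambda>\<omega>. \<integral>r. hit_pay m (step_disc s r) (\<lambda>y. c * below_weight s r y) A k \<omega> \<partial>rates)" by (rule FG(1))
    fix \<omega>
    show "(\<integral>r. hit_pay m (step_disc s r) ?F A k \<omega> \<partial>rates)
        \<le> (\<integral>r. hit_pay m (step_disc s r) (\<lambda>y. c * below_weight s r y) A k \<omega> \<partial>rates)"
    proof (rule hit_pay_chebyshev[OF s])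
      fix y
      show "?F y \<le> (\<integral>r. c * below_weight s r y \<partial>rates)"
        using F(1)[of y] by (auto simp: integral_below_weight) (auto simp: below_weight_def)
      show "continuous_on {1..2} (\<lambda>r. c * below_weight s r y)"
        by (intro continuous_intros continuous_below_weight)
      show "c * below_weight s t y \<le> c * below_weight s r y" if "r \<le> t" for r t
        using below_weight_antimono[OF that] c by (rule mult_left_mono)
    qed
  qed
  also have "\<dots> = (\<integral>r. c * hit_value m (step_disc s r) (below_weight s r) A k \<partial>rates)"
    unfolding hit_value_cmult[symmetric] by (rule FG(3))
  finally show ?thesis by simp
qed

text \<open>Supplies the increasing factor \<open>1 - a r\<close> of the reversed Chebyshev
  inequality at the origin.\<close>

lemma below_value_antimono:
  assumes "1 \<le> r" "r \<le> t" "t \<le> 2"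
  shows "hit_value m (step_disc s t) (below_weight s t) A k \<le> hit_value m (step_disc s r) (below_weight s r) A k"
proof -
  have int: "integrable steps (hit_pay m (step_disc s q) (below_weight s q) A k)" if "q \<in> {1..2}" for q
    using step_disc_facts(2)[OF that] below_weight_bounds[OF that]
    by (intro hit_pay_integrable[where C = 1]) auto
  show ?thesis
    unfolding hit_value_def
  proof (rule integral_mono[OF int int])
    show "hit_pay m (step_disc s t) (below_weight s t) A k \<omega> \<le> hit_pay m (step_disc s r) (below_weight s r) A k \<omega>" for \<omega>
      using assms step_disc_facts step_disc_antimono[OF step_disc_facts(1), of r t] below_weight_antimono[of r t] below_weight_bounds[of t]
      by (intro hit_pay_mono) auto
  qed (use assms in auto)
qed

text \<open>Time 0 does not count, so at least one discounted step is made. This is the source of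
  strictness at the origin.\<close>

lemma below_value_1_le:
  assumes "r \<in> {1..2}"
  shows "hit_value 1 (step_disc s r) (below_weight s r) A k \<le> 1 / (1 + s\<^sup>2)"
proof -
  note f = step_disc_facts(3,4)[OF assms] below_weight_bounds[OF assms] zero_le_one
  have "hit_value 1 (step_disc s r) (below_weight s r) A k \<le> step_disc s r / 2 * (1 + 1)"
    unfolding hit_value_1[OF f]
    using hit_value_bounds(2)[OF f] step_disc_facts(3)[OF assms] by (intro mult_left_mono add_mono) auto
  then show ?thesis using step_disc_bounds(3)[OF step_disc_facts(1) assms] by simp
qed

text \<open>The discounted harmonic function \<open>exp (tree_rate s r * s * y)\<close> is 1 at the
  origin; stopped on \<open>A\<close> it pays \<open>below_weight\<close> at sites up to 0 and
  \<open>exp (tree_rate s r * s * q)\<close> at \<open>q\<close>.\<close>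

lemma below_value_plus_hit_le_1:
  assumes r: "r \<in> {1..2}" and q: "0 < q" "q \<in> A"
  shows "hit_value 1 (step_disc s r) (below_weight s r) A 0
    + exp (tree_rate s r * (real_of_int q * s)) * hit_value 1 (step_disc s r) (\<lambda>y. if y = q then 1 else 0) A 0 \<le> 1"
proof -
  define c where "c = tree_rate s r * s"
  have c: "0 < c" using s r tree_rate_pos[of s r] by (simp add: c_def)
  define w where "w y = (if y \<le> q then exp (c * real_of_int y) else exp (c * real_of_int q))" for y
  let ?b = "step_disc s r"
  let ?G = "\<lambda>y. below_weight s r y + exp (c * real_of_int q) * (if y = q then 1 else 0)"
  have b: "0 \<le> ?b" "?b < 1" using step_disc_facts(3,4)[OF r] by auto
  have Cq: "1 \<le> exp (c * real_of_int q)" using c q by simp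
  have G: "0 \<le> ?G y \<and> ?G y \<le> exp (c * real_of_int q)" for y
    using below_weight_bounds[OF r, of y] Cq q by (auto simp: below_weight_def)
  have le: "hit_value 0 ?b ?G A k \<le> w k" for k
  proof (rule hit_value_le_super[OF b G])
    show "?G y \<le> w y" for y
      using q by (auto simp: w_def below_weight_def c_def)
    fix y assume "y \<notin> A"
    then have "y \<noteq> q" using q by auto
    show "?b / 2 * (w (y + 1) + w (y - 1)) \<le> w y"
    proof (cases "y < q")
      case True
      then show ?thesis
        using step_disc_harmonic(1)[OF s r, of y] by (simp add: w_def c_def)
    next
      case False
      have "w z \<le> exp (c * real_of_int q)" for z
        using c by (auto simp: w_def)
      then have "?b / 2 * (w (y + 1) + w (y - 1)) \<le> ?b / 2 * (exp (c * real_of_int q) + exp (c * real_of_int q))"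
        using b by (intro mult_left_mono add_mono) auto
      also have "\<dots> \<le> exp (c * real_of_int q)"
        using b by (simp add: mult_left_le_one_le)
      finally show ?thesis using False \<open>y \<noteq> q\<close> by (simp add: w_def)
    qed
  qed (simp_all add: w_def)
  have "hit_value 1 ?b ?G A 0 \<le> ?b / 2 * (w (0 + 1) + w (0 - 1))"
    using b by (subst hit_value_1[OF b G]) (auto intro!: mult_left_mono add_mono le)
  also have "\<dots> = 1"
    using step_disc_harmonic(1)[OF s r, of 0] q by (simp add: w_def c_def)
  finally have "hit_value 1 ?b ?G A 0 \<le> 1" .
  moreover have "hit_value 1 ?b ?G A 0 = hit_value 1 ?b (below_weight s r) A 0
      + hit_value 1 ?b (\<lambda>y. exp (c * real_of_int q) * (if y = q then 1 else 0)) A 0"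
  proof (rule hit_value_add[where C = "exp (c * real_of_int q)"])
    show "0 \<le> below_weight s r y \<and> below_weight s r y \<le> exp (c * real_of_int q)" for y
      using below_weight_bounds[OF r, of y] Cq by linarith
  qed (use b in auto)
  ultimately show ?thesis
    unfolding hit_value_cmult by (simp add: c_def mult_ac)
qed

text \<open>Chebyshev's inequality is used twice: below the origin it lets the walk continue until it
  returns to the origin, and above the origin it decouples the discount factor of the first point
  \<open>q\<close> of \<open>S\<close> from the event of hitting it.\<close>

lemma tree_J_origin_less:
  assumes f: "\<And>y. 0 \<le> f y" "\<And>y. f y \<le> C" "0 < f 0"
    and below: "\<And>y :: int. y \<le> 0 \<Longrightarrow> f (real_of_int y * s) \<le> f 0 * tree_discount s (- (real_of_int y * s))"
    and above: "\<And>y :: int. 0 < y \<Longrightarrow> f (real_of_int y * s) * tree_discount s (real_of_int y * s) < f 0"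
  shows "tree_J (s\<^sup>2) f 0 S < f 0"
proof -
  define A where "A = {y. real_of_int y * s \<in> S}"
  define F where "F y = f (real_of_int y * s)" for y
  define a where "a r = hit_value 1 (step_disc s r) (below_weight s r) A 0" for r
  define Fl where "Fl y = (if y \<le> 0 then F y else 0)" for y
  have C: "0 \<le> C" using f(1,2)[of 0] by simp
  have Fb: "0 \<le> F y \<and> F y \<le> C" for y using f by (simp add: F_def)
  have Flb: "0 \<le> Fl y \<and> Fl y \<le> C" for y using Fb C by (simp add: Fl_def)
  note m = step_disc_measurable[OF step_disc_facts(1)]
  have a_int: "integrable rates a"
    unfolding a_def using hit_value_Fubini(2)[OF m step_disc_facts(2) below_weight_measurable below_weight_bounds zero_le_one] .
  have a_le: "(\<integral>r. a r \<partial>rates) \<le> 1 / (1 + s\<^sup>2)"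
    using below_value_1_le by (intro rates.integral_le_const[OF a_int]) (auto simp: a_def)
  have "1 / (1 + s\<^sup>2) < 1" using s by (simp add: add_pos_nonneg)
  with a_le have a_less: "(\<integral>r. a r \<partial>rates) < 1" by simp
  have Fl_le: "(\<integral>r. hit_value 1 (step_disc s r) Fl A 0 \<partial>rates) \<le> f 0 * (\<integral>r. a r \<partial>rates)"
    unfolding a_def Fl_def using below Fb f(3) by (intro below_value_le) (auto simp: F_def)
  have J: "tree_J (s\<^sup>2) f 0 S = (\<integral>r. hit_value 1 (step_disc s r) F A 0 \<partial>rates)"
  proof -
    have "tree_J (s\<^sup>2) f 0 S = tree_payoff 1 (s\<^sup>2) f (real_of_int 0 * s) S"
      using grid_floor_grid[OF s, of 0] by (simp add: tree_J_def)
    then show ?thesis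
      unfolding tree_payoff_eq[OF s] F_def[symmetric] A_def[symmetric]
      using hit_value_Fubini(3)[OF m step_disc_facts(2) borel_measurable_const Fb C] by simp
  qed
  show ?thesis
  proof (cases "\<exists>y\<in>A. 0 < y")
    case False
    then have "hit_value 1 (step_disc s r) F A 0 = hit_value 1 (step_disc s r) Fl A 0" for r
      by (intro hit_value_cong) (auto simp: Fl_def)
    then have "tree_J (s\<^sup>2) f 0 S \<le> f 0 * (\<integral>r. a r \<partial>rates)" using J Fl_le by simp
    also have "\<dots> < f 0 * 1" using a_less f(3) by (intro mult_strict_left_mono)
    finally show ?thesis by simp
  next
    case True
    then obtain y0 where y0: "y0 \<in> A" "0 < y0" by blast
    define n where "n = (LEAST n :: nat. 0 < n \<and> int n \<in> A)"
    have n: "0 < n \<and> int n \<in> A"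
      unfolding n_def by (rule LeastI[of _ "nat y0"]) (use y0 in auto)
    define q where "q = int n"
    have q: "0 < q" "q \<in> A" using n by (auto simp: q_def)
    have q_le: "q \<le> y" if "y \<in> A" "0 < y" for y
      using Least_le[of "\<lambda>n. 0 < n \<and> int n \<in> A" "nat y"] that by (simp add: q_def n_def)
    define p where "p r = hit_value 1 (step_disc s r) (\<lambda>y. if y = q then 1 else 0) A 0" for r
    have p_int: "integrable rates p"
      unfolding p_def using hit_value_Fubini(2)[OF m step_disc_facts(2), of "\<lambda>r y. if y = q then 1 else 0" A 1] by simp
    have split: "hit_value 1 (step_disc s r) F A 0 = hit_value 1 (step_disc s r) Fl A 0 + F q * p r"
      if r: "r \<in> {1..2}" for r
    proof -
      note b = step_disc_facts(3,4)[OF r]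
      have "hit_value 1 (step_disc s r) F A 0 = hit_value 1 (step_disc s r) (\<lambda>y. if y \<le> q then F y else 0) A 0"
        using q by (intro hit_value_restrict[OF b Fb C]) auto
      also have "\<dots> = hit_value 1 (step_disc s r) (\<lambda>y. Fl y + F q * (if y = q then 1 else 0)) A 0"
        using q q_le by (intro hit_value_cong) (force simp: Fl_def)
      also have "\<dots> = hit_value 1 (step_disc s r) Fl A 0 + hit_value 1 (step_disc s r) (\<lambda>y. F q * (if y = q then 1 else 0)) A 0"
        using b Flb Fb C by (intro hit_value_add[where C = C]) auto
      finally show ?thesis unfolding hit_value_cmult p_def .
    qed
    let ?D = "tree_discount s (real_of_int q * s)"
    let ?e = "\<lambda>r. exp (- tree_rate s r * (real_of_int q * s))"
    have a1_int: "integrable rates (\<lambda>r. 1 - a r)" using a_int by simp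
    have e_mono: "?e t \<le> ?e r" if "1 \<le> r" "r \<le> t" "t \<le> 2" for r t
      using tree_rate_mono[OF s that(2)] q s by (simp add: mult_right_mono)
    have a_mono: "1 - a r \<le> 1 - a t" if "1 \<le> r" "r \<le> t" "t \<le> 2" for r t
      using below_value_antimono[OF that] by (simp add: a_def)
    note ch = chebyshev_rates_opposite[OF continuous_tree_discount e_mono a1_int a_mono]
    \<comment> \<open>The martingale bound is solved for \<open>p r\<close>. The discount factor
      \<open>?e\<close> decreases in \<open>r\<close> while \<open>1 - a r\<close> increases, so the
      mean of the product is at most the product of the means.\<close>
    have "(\<integral>r. p r \<partial>rates) \<le> (\<integral>r. ?e r * (1 - a r) \<partial>rates)"
    proof (rule integral_mono[OF p_int ch(1)])
      fix r assume "r \<in> space rates"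
      then have "a r + exp (tree_rate s r * (real_of_int q * s)) * p r \<le> 1"
        using below_value_plus_hit_le_1[OF _ q, of r] by (simp add: a_def p_def)
      then have "?e r * (exp (tree_rate s r * (real_of_int q * s)) * p r) \<le> ?e r * (1 - a r)"
        by (intro mult_left_mono) auto
      then show "p r \<le> ?e r * (1 - a r)" by (simp add: mult.assoc[symmetric] flip: exp_add)
    qed
    also have "\<dots> \<le> ?D * (1 - (\<integral>r. a r \<partial>rates))"
      using ch(2) a_int rates.prob_space by (simp add: tree_discount_def)
    finally have p_le: "(\<integral>r. p r \<partial>rates) \<le> ?D * (1 - (\<integral>r. a r \<partial>rates))" .
    have "tree_J (s\<^sup>2) f 0 S = (\<integral>r. hit_value 1 (step_disc s r) Fl A 0 + F q * p r \<partial>rates)"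
      unfolding J by (intro Bochner_Integration.integral_cong refl) (simp only: split space_rates)
    also have "\<dots> = (\<integral>r. hit_value 1 (step_disc s r) Fl A 0 \<partial>rates) + F q * (\<integral>r. p r \<partial>rates)"
      using hit_value_Fubini(2)[OF m step_disc_facts(2) borel_measurable_const Flb C] p_int by simp
    also have "\<dots> \<le> f 0 * (\<integral>r. a r \<partial>rates) + F q * (?D * (1 - (\<integral>r. a r \<partial>rates)))"
      using Fl_le p_le Fb by (intro add_mono mult_left_mono) auto
    \<comment> \<open>The bound mixes \<open>f 0\<close> and \<open>F q * ?D\<close>, which is below
      \<open>f 0\<close>, with weights \<open>a\<close> and \<open>1 - a\<close> for the mean
      \<open>a\<close> of \<open>a r\<close>; the second weight is positive.\<close>
    also have "\<dots> < f 0 * (\<integral>r. a r \<partial>rates) + f 0 * (1 - (\<integral>r. a r \<partial>rates))"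
      using above[OF q(1)] a_less by (simp add: F_def mult.assoc[symmetric])
    finally show ?thesis by (simp add: algebra_simps)
  qed
qed

text \<open>From \<open>k \<le> 0\<close> the walk meets 0, a point of \<open>S\<close>, before any
  positive site, and stopping below 0 is no better than walking on to 0.\<close>

lemma tree_J0_below_le:
  assumes f: "\<And>y. 0 \<le> f y" "\<And>y. f y \<le> C"
    and below: "\<And>y :: int. y \<le> 0 \<Longrightarrow> f (real_of_int y * s) \<le> f 0 * tree_discount s (- (real_of_int y * s))"
    and S: "0 \<in> S" and k: "k \<le> 0"
  shows "tree_payoff 0 (s\<^sup>2) f (real_of_int k * s) S \<le> f 0 * tree_discount s (- (real_of_int k * s))"
proof -
  define A where "A = {y. real_of_int y * s \<in> S}"
  define F where "F y = f (real_of_int y * s)" for y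
  have A: "0 \<in> A" using S by (simp add: A_def)
  have C: "0 \<le> C" using f(1,2)[of 0] by simp
  have Fb: "0 \<le> F y \<and> F y \<le> C" for y using f by (simp add: F_def)
  note m = step_disc_measurable[OF step_disc_facts(1)]
  have "tree_payoff 0 (s\<^sup>2) f (real_of_int k * s) S = (\<integral>r. hit_value 0 (step_disc s r) F A k \<partial>rates)"
    unfolding tree_payoff_eq[OF s] F_def[symmetric] A_def[symmetric]
    using hit_value_Fubini(3)[OF m step_disc_facts(2) borel_measurable_const Fb C] by simp
  also have "\<dots> = (\<integral>r. hit_value 0 (step_disc s r) (\<lambda>y. if y \<le> 0 then F y else 0) A k \<partial>rates)"
    using A k step_disc_facts
    by (intro Bochner_Integration.integral_cong refl hit_value_restrict[OF _ _ Fb C]) auto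
  also have "\<dots> \<le> f 0 * (\<integral>r. hit_value 0 (step_disc s r) (below_weight s r) A k \<partial>rates)"
    using below Fb f(1) by (intro below_value_le) (auto simp: F_def)
  also have "\<dots> \<le> f 0 * tree_discount s (- (real_of_int k * s))"
  proof (rule mult_left_mono[OF _ f(1)], unfold tree_discount_def, rule integral_mono)
    show "integrable rates (\<lambda>r. hit_value 0 (step_disc s r) (below_weight s r) A k)"
      using hit_value_Fubini(2)[OF m step_disc_facts(2) below_weight_measurable below_weight_bounds zero_le_one] .
    show "integrable rates (\<lambda>r. exp (- tree_rate s r * - (real_of_int k * s)))"
      by (rule integrable_tree_discount)
    fix r assume "r \<in> space rates"
    then have r: "r \<in> {1..2}" by simp
    have "hit_value 0 (step_disc s r) (below_weight s r) A k \<le> (\<lambda>y. exp (tree_rate s r * s * real_of_int y)) k"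
      by (rule hit_value_le_super[OF step_disc_facts(3,4)[OF r] below_weight_bounds[OF r] zero_le_one])
        (auto simp: below_weight_def step_disc_harmonic(1)[OF s r, simplified])
    then show "hit_value 0 (step_disc s r) (below_weight s r) A k \<le> exp (- tree_rate s r * - (real_of_int k * s))"
      by (simp add: mult_ac)
  qed
  finally show ?thesis .
qed

end

section \<open>An equilibrium of the tree model\<close>

text \<open>Solves the discounted one-step equation off the three sites 0, \<open>a\<close>,
  \<open>t\<close> with boundary values \<open>F\<close>, for \<open>t = a\<close> or
  \<open>t = a + 1\<close> and lattice exponent \<open>c\<close>.\<close>

definition bridge :: "real \<Rightarrow> (int \<Rightarrow> real) \<Rightarrow> int \<Rightarrow> int \<Rightarrow> int \<Rightarrow> real" where
  "bridge c F a t y =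
     (if y \<le> 0 then F 0 * exp (c * y)
      else if y \<le> a then F a * (sinh (c * y) / sinh (c * a)) + F 0 * (sinh (c * (a - y)) / sinh (c * a))
      else F t * exp (- c * (y - t)))"

context
  fixes s :: real
  assumes s: "0 < s"
begin

lemma step_disc_sinh:
  assumes r: "r \<in> {1..2}"
  defines "c \<equiv> tree_rate s r * s"
  shows "step_disc s r / 2 * (sinh (c * real_of_int (y + 1)) + sinh (c * real_of_int (y - 1))) = sinh (c * y)"
proof -
  have *: "sinh (c * real_of_int z) = (exp (c * real_of_int z) - exp (- c * real_of_int z)) / 2" for z
    by (simp add: sinh_field_def)
  have lin: "b / 2 * ((p - q) / 2 + (p' - q') / 2) = (b / 2 * (p + p') - b / 2 * (q + q')) / 2" for b p q p' q' :: real
    by (simp add: field_simps)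
  show ?thesis
    unfolding * lin unfolding c_def step_disc_harmonic[OF s r] ..
qed

lemma bridge_le_hit_value:
  assumes r: "r \<in> {1..2}" and F: "\<And>y. 0 \<le> F y" and a: "0 < a" "t = a \<or> t = a + 1"
  shows "bridge (tree_rate s r * s) F a t k \<le> hit_value 0 (step_disc s r) F {0, a, t} k"
proof -
  define c where "c = tree_rate s r * s"
  have c: "0 < c" using s r tree_rate_pos[of s r] by (simp add: c_def)
  have sa: "0 < sinh (c * real_of_int a)" using a c by simp
  let ?w = "bridge c F a t"
  let ?C = "F 0 + F a + F t"
  have FC: "0 \<le> F y \<and> F y \<le> ?C" if "y \<in> {0, a, t}" for y
    using that F[of 0] F[of a] F[of t] by auto
  have C: "0 \<le> ?C" using F by (intro add_nonneg_nonneg)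
  have at_0: "?w 0 = F 0" by (simp add: bridge_def)
  have at_a: "?w a = F a" using a sa c by (simp add: bridge_def)
  have at_t: "?w t = F t" using a at_a by (cases "t = a") (auto simp: bridge_def)
  \<comment> \<open>Adjacent formulas agree at the three sites. Hence the neighbours of a point off
    the set can be evaluated with the formula of its own region.\<close>
  have mid: "?w y = F a * (sinh (c * y) / sinh (c * a)) + F 0 * (sinh (c * (a - y)) / sinh (c * a))" if "0 \<le> y" "y \<le> a" for y
    using that sa by (cases "y = 0") (auto simp: bridge_def)
  have up: "?w y = F t * exp (- c * (y - t))" if "t \<le> y" for y
    using that at_t a by (cases "y = t") (auto simp: bridge_def)
  have low: "?w y = F 0 * exp (c * y)" if "y \<le> 0" for y
    using that by (simp add: bridge_def)
  have ratio: "0 \<le> sinh (c * z) / sinh (c * a) \<and> sinh (c * z) / sinh (c * a) \<le> 1" if "0 \<le> z" "z \<le> real_of_int a" for z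
    using that c sa by (auto intro!: divide_nonneg_nonneg simp: divide_le_eq_1)
  have bound: "?w y \<le> ?C" for y
  proof -
    consider "y \<le> 0" | "0 < y" "y \<le> a" | "a < y" by linarith
    then show ?thesis
    proof cases
      case 1
      then have "F 0 * exp (c * y) \<le> F 0 * 1" using c F by (intro mult_left_mono) (auto simp: mult_nonneg_nonpos)
      then show ?thesis using low[OF 1] F[of a] F[of t] by simp
    next
      case 2
      have "F a * (sinh (c * y) / sinh (c * a)) \<le> F a * 1"
        by (rule mult_left_mono[OF conjunct2[OF ratio] F]) (use 2 in auto)
      moreover have "F 0 * (sinh (c * (a - y)) / sinh (c * a)) \<le> F 0 * 1"
        by (rule mult_left_mono[OF conjunct2[OF ratio] F]) (use 2 in auto)
      ultimately show ?thesis using mid[of y] 2 F[of t] by simp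
    next
      case 3
      then have "t \<le> y" using a by auto
      then have "F t * exp (- c * (y - t)) \<le> F t * 1" using c F by (intro mult_left_mono) (auto simp: mult_nonneg_nonneg)
      then show ?thesis using up[OF \<open>t \<le> y\<close>] F[of a] F[of 0] by simp
    qed
  qed
  have harm: "?w y = step_disc s r / 2 * (?w (y + 1) + ?w (y - 1))" if "y \<notin> {0, a, t}" for y
  proof -
    consider "y < 0" | "0 < y" "y < a" | "t < y" using \<open>y \<notin> {0, a, t}\<close> a by fastforce
    then show ?thesis
    proof cases
      case 1
      then have "step_disc s r / 2 * (?w (y + 1) + ?w (y - 1))
        = F 0 * (step_disc s r / 2 * (exp (c * real_of_int (y + 1)) + exp (c * real_of_int (y - 1))))"
        using low[of "y + 1"] low[of "y - 1"] by (simp add: algebra_simps)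
      also have "\<dots> = ?w y"
        unfolding c_def step_disc_harmonic(1)[OF s r] using low[of y] 1 by (simp add: c_def)
      finally show ?thesis by simp
    next
      case 2
      have e: "a - y - 1 = a - (y + 1)" "a - y + 1 = a - (y - 1)" by simp_all
      have m1: "?w (y + 1) = F a * (sinh (c * real_of_int (y + 1)) / sinh (c * a)) + F 0 * (sinh (c * real_of_int (a - y - 1)) / sinh (c * a))"
        unfolding e by (rule mid) (use 2 in simp_all)
      have m2: "?w (y - 1) = F a * (sinh (c * real_of_int (y - 1)) / sinh (c * a)) + F 0 * (sinh (c * real_of_int (a - y + 1)) / sinh (c * a))"
        unfolding e by (rule mid) (use 2 in simp_all)
      have lin: "b / 2 * ((u * (p / d) + v * (q / d)) + (u * (p' / d) + v * (q' / d)))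
        = u / d * (b / 2 * (p + p')) + v / d * (b / 2 * (q' + q))" for b u v p q p' q' d :: real
        by (simp add: algebra_simps add_divide_distrib)
      have "step_disc s r / 2 * (?w (y + 1) + ?w (y - 1))
        = F a / sinh (c * a) * (step_disc s r / 2 * (sinh (c * real_of_int (y + 1)) + sinh (c * real_of_int (y - 1))))
        + F 0 / sinh (c * a) * (step_disc s r / 2 * (sinh (c * real_of_int (a - y + 1)) + sinh (c * real_of_int (a - y - 1))))"
        unfolding m1 m2 by (rule lin)
      also have "\<dots> = ?w y"
        unfolding c_def step_disc_sinh[OF r] using mid[of y] 2 by (simp add: c_def)
      finally show ?thesis by simp
    next
      case 3
      have "step_disc s r / 2 * (?w (y + 1) + ?w (y - 1))
        = F t * (step_disc s r / 2 * (exp (- c * real_of_int (y - t + 1)) + exp (- c * real_of_int (y - t - 1))))"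
        using up[of "y + 1"] up[of "y - 1"] 3 by (simp add: algebra_simps)
      also have "\<dots> = ?w y"
        unfolding c_def step_disc_harmonic(2)[OF s r] using up[of y] 3 by (simp add: c_def)
      finally show ?thesis by simp
    qed
  qed
  show ?thesis
    unfolding c_def[symmetric]
  proof (rule hit_value_ge_sub[OF step_disc_facts(3,4)[OF s r] FC C bound C])
    fix y assume "y \<in> {0, a, t}"
    then show "?w y \<le> F y" using at_0 at_a at_t by auto
  next
    fix y assume "y \<notin> {0, a, t}"
    then show "?w y \<le> step_disc s r / 2 * (?w (y + 1) + ?w (y - 1))" using harm by simp
  qed
qed

lemma tree_discount_mult_le:
  assumes "0 \<le> d" "0 \<le> e" shows "tree_discount s d * tree_discount s e \<le> tree_discount s (d + e)"
proof -
  have mono: "exp (- tree_rate s t * d) \<le> exp (- tree_rate s r * d)" if "0 \<le> d" "r \<le> t" for r t d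
    using tree_rate_mono[OF s that(2)] that by (simp add: mult_right_mono)
  show ?thesis
    using chebyshev_rates(2)[OF continuous_tree_discount mono integrable_tree_discount mono, of d e] assms
    by (simp add: tree_discount_def distrib_left flip: exp_add)
qed

lemma tree_J_grid:
  assumes F: "\<And>y. 0 \<le> f y" "\<And>y. f y \<le> C"
  shows "tree_J (s\<^sup>2) f (real_of_int k * s) ((\<lambda>y. real_of_int y * s) ` A)
      = (\<integral>r. hit_value 1 (step_disc s r) (\<lambda>y. f (real_of_int y * s)) A k \<partial>rates)"
    and "integrable rates (\<lambda>r. hit_value 1 (step_disc s r) (\<lambda>y. f (real_of_int y * s)) A k)"
proof -
  have A: "{y. real_of_int y * s \<in> (\<lambda>y. real_of_int y * s) ` A} = A" using s by auto
  have C: "0 \<le> C" using F[of 0] by simp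
  have Fb: "0 \<le> f (real_of_int y * s) \<and> f (real_of_int y * s) \<le> C" for y using F by simp
  note Fub = hit_value_Fubini[OF step_disc_measurable[OF step_disc_facts(1)[OF s]] step_disc_facts(2)[OF s] borel_measurable_const Fb C,
      where m = 1 and A = A and k = k]
  show "tree_J (s\<^sup>2) f (real_of_int k * s) ((\<lambda>y. real_of_int y * s) ` A)
      = (\<integral>r. hit_value 1 (step_disc s r) (\<lambda>y. f (real_of_int y * s)) A k \<partial>rates)"
    unfolding tree_J_def grid_floor_grid[OF s] tree_payoff_eq[OF s] A using Fub(3) by simp
  show "integrable rates (\<lambda>r. hit_value 1 (step_disc s r) (\<lambda>y. f (real_of_int y * s)) A k)"
    using Fub(2) by simp
qed

text \<open>Whether the grid point \<open>a + 1\<close> belongs to the equilibrium depends on whether stopping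
  there beats waiting for \<open>a\<close>.\<close>

lemma tree_equilibrium_exists:
  assumes f: "\<And>y. 0 \<le> f y" "\<And>y. f y \<le> C"
    and a: "0 < a"
    and origin: "\<And>S. tree_J (s\<^sup>2) f 0 S \<le> f 0"
    and below: "\<And>y :: int. y < 0 \<Longrightarrow> f (real_of_int y * s) \<le> f 0 * tree_discount s (- (real_of_int y * s))"
    and between: "\<And>y :: int. \<lbrakk>0 < y; y < a\<rbrakk> \<Longrightarrow> f (real_of_int y * s) \<le>
      (\<integral>r. f (real_of_int a * s) * (sinh (tree_rate s r * (real_of_int y * s)) / sinh (tree_rate s r * (real_of_int a * s)))
        + f 0 * (sinh (tree_rate s r * (real_of_int (a - y) * s)) / sinh (tree_rate s r * (real_of_int a * s))) \<partial>rates)"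
    and max: "f 0 \<le> f (real_of_int a * s)" "f (real_of_int (a + 1) * s) \<le> f (real_of_int a * s)"
    and above: "\<And>y :: int. a + 1 < y \<Longrightarrow>
      f (real_of_int y * s) \<le> f (real_of_int (a + 1) * s) * tree_discount s (real_of_int (y - (a + 1)) * s)"
  shows "tree_equilibria (s\<^sup>2) f \<noteq> {}"
proof -
  define F where "F y = f (real_of_int y * s)" for y
  define c where "c r = tree_rate s r * s" for r
  have F: "0 \<le> F y" "F y \<le> C" for y using f by (simp_all add: F_def)
  have F0: "F 0 = f 0" by (simp add: F_def)
  let ?S = "\<lambda>A. (\<lambda>y. real_of_int y * s) ` A"
  have J: "tree_J (s\<^sup>2) f (real_of_int k * s) (?S A) = (\<integral>r. hit_value 1 (step_disc s r) F A k \<partial>rates)"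
    and J_int: "integrable rates (\<lambda>r. hit_value 1 (step_disc s r) F A k)" for k A
    unfolding F_def using tree_J_grid[of f C, OF f] by blast+
  have cont_c: "continuous_on {1..2} c" unfolding c_def by (intro continuous_intros)
  have c_pos: "0 < c r" if "r \<in> {1..2}" for r using that s tree_rate_pos[of s r] by (simp add: c_def)
  define t where "t = (if F (a + 1) \<le> F a * tree_discount s s then a else a + 1)"
  let ?A = "{0, a, t}"
  have t: "t = a \<or> t = a + 1" by (simp add: t_def)
  have F_le: "F y \<le> F a" if "y \<in> ?A" for y
    using that t max by (auto simp: F_def)
  have lower: "(\<integral>r. bridge (c r) F a t k \<partial>rates) \<le> tree_J (s\<^sup>2) f (real_of_int k * s) (?S ?A)"
    if k: "k \<notin> ?A" and int: "integrable rates (\<lambda>r. bridge (c r) F a t k)" for k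
    unfolding J
  proof (rule integral_mono[OF int J_int])
    fix r assume "r \<in> space rates"
    then have r: "r \<in> {1..2}" by simp
    have Fb: "0 \<le> F y \<and> F y \<le> C" for y using F by simp
    have C: "0 \<le> C" using F[of 0] by simp
    \<comment> \<open>Off the set it is immaterial whether time 0 counts.\<close>
    have "hit_value 0 (step_disc s r) F ?A k = hit_value 1 (step_disc s r) F ?A k"
      unfolding hit_value_1[OF step_disc_facts(3,4)[OF s r] Fb C] by (rule hit_value_off[OF step_disc_facts(3,4)[OF s r] Fb C k])
    then show "bridge (c r) F a t k \<le> hit_value 1 (step_disc s r) F ?A k"
      using bridge_le_hit_value[where F = F and k = k, OF r F(1) a t] by (simp add: c_def)
  qed
  have outside: "f (real_of_int k * s) \<le> tree_J (s\<^sup>2) f (real_of_int k * s) (?S ?A)" if k: "k \<notin> ?A" for k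
  proof -
    consider "k < 0" | "0 < k" "k < a" | "t < k" using k a t by fastforce
    then show ?thesis
    proof cases
      case 1
      then have eq: "bridge (c r) F a t k = F 0 * exp (- tree_rate s r * - (real_of_int k * s))" for r
        by (simp add: bridge_def c_def mult_ac)
      have "f (real_of_int k * s) \<le> (\<integral>r. bridge (c r) F a t k \<partial>rates)"
        unfolding eq using below[OF 1] by (simp add: tree_discount_def F0)
      also have "\<dots> \<le> tree_J (s\<^sup>2) f (real_of_int k * s) (?S ?A)"
        by (rule lower[OF k]) (unfold eq, intro integrable_mult_right integrable_tree_discount)
      finally show ?thesis .
    next
      case 2
      then have eq: "bridge (c r) F a t k = f (real_of_int a * s) * (sinh (tree_rate s r * (real_of_int k * s)) / sinh (tree_rate s r * (real_of_int a * s)))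
        + f 0 * (sinh (tree_rate s r * (real_of_int (a - k) * s)) / sinh (tree_rate s r * (real_of_int a * s)))" for r
        by (simp add: bridge_def c_def F_def mult_ac)
      have "f (real_of_int k * s) \<le> (\<integral>r. bridge (c r) F a t k \<partial>rates)"
        unfolding eq by (rule between[OF 2])
      also have "\<dots> \<le> tree_J (s\<^sup>2) f (real_of_int k * s) (?S ?A)"
      proof (rule lower[OF k])
        have "continuous_on {1..2} (\<lambda>r. F a * (sinh (c r * k) / sinh (c r * a)) + F 0 * (sinh (c r * (a - k)) / sinh (c r * a)))"
          using cont_c a c_pos by (intro continuous_intros) fastforce+
        moreover have "bridge (c r) F a t k = F a * (sinh (c r * k) / sinh (c r * a)) + F 0 * (sinh (c r * (a - k)) / sinh (c r * a))" for r
          using 2 by (simp add: bridge_def)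
        ultimately show "integrable rates (\<lambda>r. bridge (c r) F a t k)"
          using integrable_rates by presburger
      qed
      finally show ?thesis .
    next
      case 3
      then have eq: "bridge (c r) F a t k = F t * exp (- tree_rate s r * (real_of_int (k - t) * s))" for r
        using t a by (auto simp: bridge_def c_def mult_ac)
      have "f (real_of_int k * s) \<le> F t * tree_discount s (real_of_int (k - t) * s)"
      proof (cases "t = a + 1")
        case True
        then show ?thesis using above[of k] 3 by (simp add: F_def)
      next
        case False
        then have ta: "t = a" and le: "F (a + 1) \<le> F a * tree_discount s s" using t by (auto simp: t_def split: if_splits)
        \<comment> \<open>Here \<open>a + 1\<close> is not in the set. The decay hypothesis leads
          from \<open>k\<close> to \<open>a + 1\<close>, the choice of \<open>t\<close> leads on to
          \<open>a\<close>, and the two discount factors merge by Chebyshev.\<close>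
        have "f (real_of_int k * s) \<le> F (a + 1) * tree_discount s (real_of_int (k - (a + 1)) * s)"
        proof (cases "k = a + 1")
          case True
          then show ?thesis by (simp add: F_def tree_discount_def rates.prob_space[simplified])
        next
          case False
          then show ?thesis using above[of k] 3 ta by (simp add: F_def)
        qed
        also have "\<dots> \<le> F a * tree_discount s s * tree_discount s (real_of_int (k - (a + 1)) * s)"
          using le by (intro mult_right_mono) (auto simp: tree_discount_def intro!: integral_nonneg_AE)
        also have "\<dots> = F a * (tree_discount s s * tree_discount s (real_of_int (k - (a + 1)) * s))" by simp
        also have "\<dots> \<le> F a * tree_discount s (s + real_of_int (k - (a + 1)) * s)"
          using 3 ta s F by (intro mult_left_mono tree_discount_mult_le) auto
        also have "s + real_of_int (k - (a + 1)) * s = real_of_int (k - t) * s"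
          using ta by (simp add: algebra_simps)
        finally show ?thesis using ta by simp
      qed
      also have "\<dots> = (\<integral>r. bridge (c r) F a t k \<partial>rates)"
        unfolding eq by (simp add: tree_discount_def)
      also have "\<dots> \<le> tree_J (s\<^sup>2) f (real_of_int k * s) (?S ?A)"
        by (rule lower[OF k]) (unfold eq, intro integrable_mult_right integrable_tree_discount)
      finally show ?thesis .
    qed
  qed
  have FA: "0 \<le> F y \<and> F y \<le> F a" if "y \<in> ?A" for y using F F_le that by simp
  \<comment> \<open>\<open>F a\<close> is the largest reward on the set, so nothing gained by
    continuing exceeds it; this settles the site \<open>a\<close>.\<close>
  have J_le: "tree_J (s\<^sup>2) f (real_of_int k * s) (?S ?A) \<le> F a" for k
    unfolding J
  proof (rule rates.integral_le_const[OF J_int], intro AE_I2)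
    fix r assume "r \<in> space rates"
    then have r: "r \<in> {1..2}" by simp
    show "hit_value 1 (step_disc s r) F ?A k \<le> F a"
      by (rule hit_value_bounds(2)[OF step_disc_facts(3,4)[OF s r] FA F(1)])
  qed
  have at_b: "tree_J (s\<^sup>2) f (real_of_int (a + 1) * s) (?S ?A) \<le> F (a + 1)" if tb: "t = a + 1"
  proof -
    let ?b = "step_disc s"
    have less: "F a * tree_discount s s \<le> F (a + 1)" using tb by (auto simp: t_def split: if_splits)
    have cosh: "?b r * (exp (c r) + exp (- c r)) = 2" if r: "r \<in> {1..2}" for r
      using step_disc_harmonic(1)[OF s r, of 0] by (simp add: c_def)
    have up: "hit_value 1 (?b r) F ?A (a + 1) \<le> ?b r / 2 * (F (a + 1) * exp (- c r) + F a)" if r: "r \<in> {1..2}" for r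
    proof -
      note b = step_disc_facts(3,4)[OF s r]
      \<comment> \<open>A supersolution for the two neighbours of \<open>a + 1\<close>: from the
        right the walk must come back to \<open>a + 1\<close>, and on the left no reward exceeds
        \<open>F a\<close>.\<close>
      define w where "w y = (if a + 1 \<le> y then F (a + 1) * exp (- c r * real_of_int (y - (a + 1))) else F a)" for y
      have "hit_value 0 (?b r) F ?A k \<le> w k" for k
      proof (rule hit_value_le_super[OF b FA F(1)])
        show "0 \<le> w y" for y using F by (simp add: w_def)
        show "F y \<le> w y" if "y \<in> ?A" for y
          using F_le[OF that] that a tb by (auto simp: w_def)
        fix y assume y: "y \<notin> ?A"
        then consider "y < a" | "a + 1 < y" using tb by fastforce
        then show "?b r / 2 * (w (y + 1) + w (y - 1)) \<le> w y"
        proof cases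
          case 1
          then show ?thesis using b F[of a] by (simp add: w_def mult_left_le_one_le)
        next
          case 2
          have "?b r / 2 * (w (y + 1) + w (y - 1)) = F (a + 1) * (?b r / 2 *
             (exp (- c r * real_of_int (y - (a + 1) + 1)) + exp (- c r * real_of_int (y - (a + 1) - 1))))"
            using 2 by (simp add: w_def algebra_simps)
          also have "\<dots> = w y"
            unfolding c_def step_disc_harmonic(2)[OF s r] using 2 by (simp add: w_def c_def)
          finally show ?thesis by simp
        qed
      qed
      note w = this
      have "hit_value 1 (?b r) F ?A (a + 1)
          = ?b r / 2 * (hit_value 0 (?b r) F ?A (a + 1 + 1) + hit_value 0 (?b r) F ?A (a + 1 - 1))"
        by (rule hit_value_1[OF b FA F(1)])
      also have "\<dots> \<le> ?b r / 2 * (w (a + 1 + 1) + w (a + 1 - 1))"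
        using b w by (intro mult_left_mono add_mono) auto
      finally show ?thesis by (simp add: w_def)
    qed
    \<comment> \<open>This factor increases in \<open>r\<close>, with
      \<open>?b r / 2 = exp (- c r) * ?p r\<close> and
      \<open>1 - ?p r = ?b r / 2 * exp (- c r)\<close>. The reversed Chebyshev inequality then
      bounds the step down to \<open>a\<close> by \<open>tree_discount s s\<close> times the mean of
      \<open>?p\<close>, and the choice \<open>t = a + 1\<close> makes that loss acceptable.\<close>
    let ?p = "\<lambda>r. ?b r / 2 * exp (c r)"
    have p_eq: "?p r = 1 / (1 + exp (- 2 * c r))" if r: "r \<in> {1..2}" for r
    proof -
      have "?b r * (exp (c r) * (1 + exp (- 2 * c r))) = 2"
        using cosh[OF r] by (simp add: distrib_left flip: exp_add)
      then show ?thesis by (simp add: field_simps add_pos_pos less_imp_neq[OF add_pos_pos, symmetric])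
    qed
    have cont_b: "continuous_on {1..2} ?b" by (rule continuous_step_disc[OF step_disc_facts(1)[OF s]])
    have p_int: "integrable rates ?p" by (intro integrable_rates continuous_intros cont_b cont_c) simp
    have b_int: "integrable rates ?b" by (rule integrable_rates[OF cont_b])
    have p_mono: "?p r \<le> ?p q" if "1 \<le> r" "r \<le> q" "q \<le> 2" for r q
    proof -
      have "c r \<le> c q" using tree_rate_mono[OF s that(2)] s by (simp add: c_def)
      then show ?thesis
        using that p_eq[of r] p_eq[of q] by (auto intro!: divide_left_mono mult_pos_pos add_pos_pos)
    qed
    have e_mono: "exp (- tree_rate s q * s) \<le> exp (- tree_rate s r * s)" if "1 \<le> r" "r \<le> q" "q \<le> 2" for r q
      using tree_rate_mono[OF s that(2)] s by simp
    have "(\<integral>r. ?b r / 2 \<partial>rates) = (\<integral>r. exp (- tree_rate s r * s) * ?p r \<partial>rates)"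
      by (intro Bochner_Integration.integral_cong refl) (simp add: c_def mult.assoc[symmetric] exp_minus)
    also have "\<dots> \<le> tree_discount s s * (\<integral>r. ?p r \<partial>rates)"
      unfolding tree_discount_def by (rule chebyshev_rates_opposite(2)[OF continuous_tree_discount e_mono p_int p_mono])
    finally have half: "(\<integral>r. ?b r / 2 \<partial>rates) \<le> tree_discount s s * (\<integral>r. ?p r \<partial>rates)" .
    have p_nn: "0 \<le> (\<integral>r. ?p r \<partial>rates)"
      using step_disc_facts(3)[OF s] by (intro integral_nonneg_AE AE_I2) simp
    have "tree_J (s\<^sup>2) f (real_of_int (a + 1) * s) (?S ?A) \<le> (\<integral>r. F (a + 1) * (1 - ?p r) + F a * (?b r / 2) \<partial>rates)"
      unfolding J
    proof (rule integral_mono[OF J_int])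
      show "integrable rates (\<lambda>r. F (a + 1) * (1 - ?p r) + F a * (?b r / 2))"
        using p_int b_int by simp
      fix r assume "r \<in> space rates"
      then have r: "r \<in> {1..2}" by simp
      have "?b r / 2 * exp (- c r) = 1 - ?p r" using cosh[OF r] by (simp add: field_simps)
      then have "?b r / 2 * (F (a + 1) * exp (- c r) + F a) = F (a + 1) * (1 - ?p r) + F a * (?b r / 2)"
        by (simp only: distrib_left) (simp add: mult_ac)
      then show "hit_value 1 (?b r) F ?A (a + 1) \<le> F (a + 1) * (1 - ?p r) + F a * (?b r / 2)"
        using up[OF r] by simp
    qed
    also have "\<dots> = F (a + 1) * (1 - (\<integral>r. ?p r \<partial>rates)) + F a * (\<integral>r. ?b r / 2 \<partial>rates)"
      using p_int b_int rates.prob_space by simp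
    also have "\<dots> \<le> F (a + 1) * (1 - (\<integral>r. ?p r \<partial>rates)) + F a * (tree_discount s s * (\<integral>r. ?p r \<partial>rates))"
      using half F by (intro add_left_mono mult_left_mono) auto
    also have "\<dots> \<le> F (a + 1) * (1 - (\<integral>r. ?p r \<partial>rates)) + F (a + 1) * (\<integral>r. ?p r \<partial>rates)"
      using mult_right_mono[OF less p_nn] by (simp add: mult.assoc)
    finally show ?thesis by (simp add: algebra_simps)
  qed
  have "?S ?A \<in> tree_equilibria (s\<^sup>2) f"
    unfolding tree_equilibria_def
  proof (intro CollectI conjI ballI)
    show "?S ?A \<subseteq> grid (s\<^sup>2)" using s by (auto simp: grid_def intro: exI[of _ "0 :: int"])
    show "f x \<le> tree_J (s\<^sup>2) f x (?S ?A)" if "x \<in> grid (s\<^sup>2) - ?S ?A" for x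
    proof -
      from that obtain k where "x = real_of_int k * s" "k \<notin> ?A" using s by (auto simp: grid_def)
      then show ?thesis using outside by simp
    qed
    show "tree_J (s\<^sup>2) f x (?S ?A) \<le> f x" if "x \<in> ?S ?A" for x
    proof -
      from that obtain k where k: "x = real_of_int k * s" "k \<in> ?A" by blast
      then consider "k = 0" | "k = a" | "k = a + 1" "t = a + 1" using t by fastforce
      then show ?thesis
      proof cases
        case 1
        then show ?thesis using k origin[of "?S ?A"] by simp
      next
        case 2
        then show ?thesis using k J_le[of a] by (simp add: F_def)
      next
        case 3
        then show ?thesis using k at_b by (simp add: F_def)
      qed
    qed
  qed
  then show ?thesis by blast
qed

end

section \<open>The reward on a fine grid\<close>

lemma sinh_diff_le:
  fixes p q :: real assumes "0 \<le> p" "p \<le> q" shows "sinh q - sinh p \<le> (q - p) * cosh q"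
proof -
  have "q * cosh q - sinh q \<ge> p * cosh q - sinh p"
  proof (rule DERIV_nonneg_imp_nondecreasing[OF assms(2)])
    fix z assume z: "p \<le> z" "z \<le> q"
    have "((\<lambda>z. z * cosh q - sinh z) has_real_derivative cosh q - cosh z) (at z)"
      by (auto intro!: derivative_eq_intros)
    moreover have "0 \<le> cosh q - cosh z"
      using z assms by (simp add: cosh_real_nonneg_le_iff)
    ultimately show "\<exists>D. ((\<lambda>z. z * cosh q - sinh z) has_real_derivative D) (at z) \<and> 0 \<le> D" by blast
  qed
  then show ?thesis by (simp add: algebra_simps)
qed

lemma cosh_1_le: "cosh (1::real) \<le> 7/4"
proof -
  have "exp (1::real) \<le> 3" by (rule exp_le)
  moreover have "exp (- 1 :: real) \<le> 1 / 2"
    using exp_ge_add_one_self[of "1::real"] by (simp add: exp_minus field_simps)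
  ultimately show ?thesis by (simp add: cosh_field_def)
qed

text \<open>Only the exit at 1/2 is kept. The slope 7/2 is twice the bound 7/4 for
  \<open>cosh 1\<close>, by \<open>sinh_diff_le\<close> and \<open>c / 2 \<le> sinh (c / 2)\<close>
  for \<open>c = sqrt (2 * r) \<le> 2\<close>.\<close>

lemma two_sided_ge:
  assumes "0 \<le> x" "x \<le> 1/2" shows "1 - 7/2 * (1/2 - x) \<le> two_sided x"
proof -
  have "(\<integral>r. 1 - 7/2 * (1/2 - x) \<partial>rates) \<le> two_sided x"
    unfolding two_sided_def
  proof (rule integral_mono[OF _ integrable_rates[OF continuous_two_sided]])
    fix r assume "r \<in> space rates"
    then have r: "r \<in> {1..2}" by simp
    define c where "c = sqrt (2 * r)"
    have c: "1 \<le> c" "c \<le> 2" using sqrt_2r_bounds[OF r] by (auto simp: c_def)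
    have pos: "0 < sinh (c / 2)" using c by simp
    have "cosh (c / 2) \<le> cosh 1" using c by (simp add: cosh_real_nonneg_le_iff)
    then have cosh: "cosh (c / 2) \<le> 7/4" using cosh_1_le by linarith
    have "c * x \<le> c / 2" using mult_left_mono[OF assms(2), of c] c by simp
    then have "sinh (c / 2) - sinh (c * x) \<le> (c / 2 - c * x) * cosh (c / 2)"
      using assms c by (intro sinh_diff_le) auto
    also have "\<dots> = (1/2 - x) * (c / 2) * (2 * cosh (c / 2))" by (simp add: algebra_simps)
    also have "\<dots> \<le> (1/2 - x) * sinh (c / 2) * (7/2)"
      using cosh c assms sinh_ge_self[of "c / 2"] by (intro mult_mono mult_left_mono) auto
    finally have le: "sinh (c / 2) - sinh (c * x) \<le> (1/2 - x) * sinh (c / 2) * (7/2)" .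
    have "(1 - 7/2 * e) * S = S - e * S * (7/2)" for e S :: real by (simp add: algebra_simps)
    with le have "(1 - 7/2 * (1/2 - x)) * sinh (c / 2) \<le> sinh (c * x)" by (simp only:)
    then have "1 - 7/2 * (1/2 - x) \<le> sinh (c * x) / sinh (c / 2)"
      using pos by (simp add: pos_le_divide_eq)
    moreover have "0 \<le> hit_discount (1/2) * (sinh (c * (1/2 - x)) / sinh (c / 2))"
      using pos c assms hit_discount_pos[of "1/2"] by (intro mult_nonneg_nonneg divide_nonneg_nonneg) auto
    ultimately show "1 - 7/2 * (1/2 - x) \<le> sinh (sqrt (2 * r) * x) / sinh (sqrt (2 * r) / 2)
      + hit_discount (1/2) * (sinh (sqrt (2 * r) * (1/2 - x)) / sinh (sqrt (2 * r) / 2))"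
      unfolding c_def by linarith
  qed simp
  then show ?thesis using rates.prob_space by simp
qed

lemma tree_S_star_origin:
  assumes "\<And>S. tree_J (s\<^sup>2) f 0 S < f 0" shows "0 \<in> tree_S_star (s\<^sup>2) f"
proof -
  have "0 \<in> grid (s\<^sup>2)" by (auto simp: grid_def intro: exI[of _ "0 :: int"])
  then show ?thesis
    using assms by (force simp: tree_S_star_def tree_equilibria_def not_le[symmetric])
qed

section \<open>Behaviour of the reward at 1/2 and the size of \<open>K1\<close> and
  \<open>K2\<close>\<close>

context
  fixes K1 K2 :: real and f :: "real \<Rightarrow> real"
  assumes K: "0 < K1" "0 < K2" and f: "f = explicit_reward K1 K2"
begin

lemma reward_bounds: "0 \<le> f y" "f y \<le> 1"
  using explicit_reward_nonneg[OF K] explicit_reward_le_1[OF K] by (simp_all add: f)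

lemma reward_half: "f (1/2) = 1"
  by (simp add: f explicit_reward_half[OF K])

lemma reward_0: "f 0 = hit_discount (1/2)"
  by (simp add: f explicit_reward_def)

lemma reward_left_ge:
  assumes "0 < x" "x \<le> 1/2" shows "1 - (7/2 + K1 * x) * (1/2 - x) \<le> f x"
proof -
  define g where "g = K1 * x * (1/2 - x)"
  have g: "0 \<le> g" using assms K by (simp add: g_def)
  have "(1 - (7/2 + p) * e) * (1 + p * e) = 1 - 7/2 * e - p * e * (p * e) - 7/2 * e * (p * e)" for p e :: real
    by (simp add: algebra_simps)
  from this[of "K1 * x" "1/2 - x"]
  have "(1 - (7/2 + K1 * x) * (1/2 - x)) * (1 + g) = 1 - 7/2 * (1/2 - x) - g * g - 7/2 * (1/2 - x) * g"
    unfolding g_def .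
  also have "\<dots> \<le> 1 - 7/2 * (1/2 - x)"
  proof -
    have "0 \<le> g * g" "0 \<le> 7/2 * (1/2 - x) * g" using g assms by simp_all
    then show ?thesis by linarith
  qed
  also have "\<dots> \<le> two_sided x" using two_sided_ge[of x] assms by simp
  finally have "1 - (7/2 + K1 * x) * (1/2 - x) \<le> two_sided x / (1 + g)"
    using g by (simp add: pos_le_divide_eq)
  then show ?thesis using assms by (simp add: f explicit_reward_def g_def)
qed

lemma reward_right_ge:
  assumes "1/2 < x" shows "1 - (K2 + 2) * (x - 1/2) \<le> f x"
proof -
  have "1 - (K2 + 2) * (x - 1/2) \<le> exp (- ((K2 + 2) * (x - 1/2)))"
    using exp_ge_add_one_self[of "- ((K2 + 2) * (x - 1/2))"] by linarith
  also have "\<dots> = exp (K2 * (1/2 - x)) * exp (- 2 * (x - 1/2))"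
    by (simp add: algebra_simps flip: exp_add)
  also have "\<dots> \<le> exp (K2 * (1/2 - x)) * hit_discount (x - 1/2)"
    using assms by (intro mult_left_mono hit_discount_ge_exp) auto
  finally show ?thesis using assms by (simp add: f explicit_reward_def)
qed

text \<open>Converts a steep left slope into a large constant: \<open>17 \<le> d\<close> forces
  \<open>27 \<le> K1\<close>.\<close>

lemma left_derivative_le:
  assumes "(f has_real_derivative d) (at_left (1/2))" shows "d \<le> 7/2 + K1 / 2"
proof (rule tendsto_upperbound)
  show "((\<lambda>y. (f y - f (1/2)) / (y - 1/2)) \<longlongrightarrow> d) (at_left (1/2))"
    using assms by (simp add: has_field_derivative_iff)
  have "\<forall>\<^sub>F y in at_left (1/2). (0::real) < y \<and> y < 1/2"
    unfolding eventually_at_left_field by (intro exI[of _ 0]) auto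
  then show "\<forall>\<^sub>F y in at_left (1/2). (f y - f (1/2)) / (y - 1/2) \<le> 7/2 + K1 / 2"
  proof eventually_elim
    case (elim y)
    have "(K1 * y) * (1/2 - y) \<le> (K1 / 2) * (1/2 - y)" using elim K by (intro mult_right_mono) auto
    then have "1 - (7/2 + K1 / 2) * (1/2 - y) \<le> f y" using reward_left_ge[of y] elim by (simp add: algebra_simps)
    then have "1 - f y \<le> (7/2 + K1 / 2) * (1/2 - y)" by simp
    then have "(1 - f y) / (1/2 - y) \<le> 7/2 + K1 / 2" using elim by (simp only: pos_divide_le_eq diff_gt_0_iff_gt)
    moreover have "(f y - f (1/2)) / (y - 1/2) = (1 - f y) / (1/2 - y)"
      unfolding reward_half by (metis minus_diff_eq minus_divide_divide)
    ultimately show ?case by simp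
  qed
qed simp

text \<open>With a right slope below -17 this forces \<open>K2\<close> above 15.\<close>

lemma right_derivative_ge:
  assumes "(f has_real_derivative d) (at_right (1/2))" shows "- (K2 + 2) \<le> d"
proof (rule tendsto_lowerbound)
  show "((\<lambda>y. (f y - f (1/2)) / (y - 1/2)) \<longlongrightarrow> d) (at_right (1/2))"
    using assms by (simp add: has_field_derivative_iff)
  have "\<forall>\<^sub>F y in at_right (1/2). (1/2::real) < y"
    by (rule eventually_at_right_less)
  then show "\<forall>\<^sub>F y in at_right (1/2). - (K2 + 2) \<le> (f y - f (1/2)) / (y - 1/2)"
  proof eventually_elim
    case (elim y)
    have "- (K2 + 2) * (y - 1/2) \<le> f y - f (1/2)" using reward_right_ge[OF elim] unfolding reward_half mult_minus_left by linarith
    then show ?case using elim by (simp only: pos_le_divide_eq diff_gt_0_iff_gt)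
  qed
qed simp

text \<open>The difference quotients on the two sides add up to
  \<open>(f (1/2 + e n) - f (1/2 - e n)) / e n\<close>, which tends to \<open>d1 + d2 < 0\<close>.
  Thus, of the two grid neighbours of 1/2, the left one is the better place to stop.\<close>

lemma reward_right_le_left:
  assumes d1: "(f has_real_derivative d1) (at_left (1/2))" and d2: "(f has_real_derivative d2) (at_right (1/2))"
    and less: "d2 < - d1"
    and e: "filterlim e (at_right 0) sequentially"
  shows "\<forall>\<^sub>F n in sequentially. f (1/2 + e n) \<le> f (1/2 - e n)"
proof -
  have pos: "\<forall>\<^sub>F n in sequentially. 0 < e n"
    using e by (simp add: filterlim_at eventually_conj_iff)
  have e0: "e \<longlonglongrightarrow> 0" using e by (simp add: filterlim_at)
  have right: "filterlim (\<lambda>n. 1/2 + e n) (at_right (1/2)) sequentially"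
    unfolding filterlim_at using pos e0 by (auto intro!: tendsto_eq_intros elim!: eventually_mono)
  have left: "filterlim (\<lambda>n. 1/2 - e n) (at_left (1/2)) sequentially"
    unfolding filterlim_at using pos e0 by (auto intro!: tendsto_eq_intros elim!: eventually_mono)
  have "(\<lambda>n. (f (1/2 + e n) - f (1/2)) / ((1/2 + e n) - 1/2)) \<longlonglongrightarrow> d2"
    by (rule filterlim_compose[OF d2[unfolded has_field_derivative_iff] right])
  moreover have "(\<lambda>n. (f (1/2 - e n) - f (1/2)) / ((1/2 - e n) - 1/2)) \<longlonglongrightarrow> d1"
    by (rule filterlim_compose[OF d1[unfolded has_field_derivative_iff] left])
  ultimately have "(\<lambda>n. (f (1/2 + e n) - f (1/2)) / ((1/2 + e n) - 1/2)
      + (f (1/2 - e n) - f (1/2)) / ((1/2 - e n) - 1/2)) \<longlonglongrightarrow> d2 + d1"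
    by (rule tendsto_add)
  moreover have "d2 + d1 < 0" using less by simp
  ultimately have "\<forall>\<^sub>F n in sequentially. (f (1/2 + e n) - f (1/2)) / ((1/2 + e n) - 1/2)
      + (f (1/2 - e n) - f (1/2)) / ((1/2 - e n) - 1/2) < 0"
    by (rule order_tendstoD(2))
  with pos show ?thesis
  proof eventually_elim
    case (elim n)
    then have "(f (1/2 + e n) - f (1/2 - e n)) / e n < 0" by (simp add: field_simps)
    then show ?case using elim(1) by (simp add: divide_less_0_iff)
  qed
qed

lemma reward_below:
  assumes s: "0 < s" and y: "y \<le> 0"
  shows "f (real_of_int y * s) \<le> f 0 * tree_discount s (- (real_of_int y * s))"
proof -
  have x: "real_of_int y * s \<le> 0" using assms by (simp add: mult_nonpos_nonneg)
  have "exp (real_of_int y * s) * hit_discount (- (real_of_int y * s)) \<le> 1 * tree_discount s (- (real_of_int y * s))"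
    using x s hit_discount_pos[of "- (real_of_int y * s)"] by (intro mult_mono tree_discount_ge) auto
  then show ?thesis
    using x hit_discount_pos[of "1/2"] by (simp add: reward_0 f explicit_reward_def mult_ac)
qed

section \<open>The reward on a grid that has 1/2 midway between two points\<close>

context
  fixes s :: real and a :: int
  assumes s: "0 < s" "s \<le> 1/10000" and a: "real_of_int a * s = 1/2 - s / 2"
begin

lemma grid_around_half: "real_of_int (a + 1) * s = 1/2 + s / 2"
  using a by (simp add: algebra_simps)

lemma left_neighbour_pos: "0 < a"
proof -
  have "0 < real_of_int a * s" using a s by simp
  then show ?thesis using s by (simp add: zero_less_mult_iff)
qed

lemma reward_above:
  assumes y: "0 < y" and small: "s < K1 / 4" "s + s\<^sup>2 < K2"
  shows "f (real_of_int y * s) * tree_discount s (real_of_int y * s) < f 0"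
proof -
  define x where "x = real_of_int y * s"
  have x: "0 < x" using y s by (simp add: x_def)
  have td: "tree_discount s x \<le> exp (s\<^sup>2 * x) * hit_discount x"
    using x s by (intro tree_discount_le) auto
  have u: "0 < hit_discount (1/2)" "0 < hit_discount x" using hit_discount_pos x by auto
  consider "y \<le> a" | "a + 1 \<le> y" by linarith
  then have "f x * (exp (s\<^sup>2 * x) * hit_discount x) < f 0"
  proof cases
    case 1
    then have "x \<le> 1/2 - s / 2" using s mult_right_mono[of "real_of_int y" "real_of_int a" s] a by (simp add: x_def)
    then have x2: "s / 2 \<le> 1/2 - x" by simp
    define g where "g = K1 * x * (1/2 - x)"
    have g: "0 < g" unfolding g_def using K x x2 s by (intro mult_pos_pos) auto
    have "s\<^sup>2 * x \<le> 1 * (1/2)" using x x2 s by (intro mult_mono) (auto simp: power_le_one)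
    then have "exp (s\<^sup>2 * x) \<le> 1 + 2 * (s\<^sup>2 * x)"
      using exp_bound_lemma[of "s\<^sup>2 * x"] x by simp
    also have "\<dots> < 1 + g"
    proof -
      \<comment> \<open>Order \<open>s\<^sup>2\<close> against order \<open>s\<close>: the excess of
        the grid discount is beaten by the denominator, which sees a distance of at least
        \<open>s / 2\<close> from 1/2.\<close>
      have "2 * s\<^sup>2 < K1 * (s / 2)" using small s by (simp add: power2_eq_square)
      also have "\<dots> \<le> K1 * (1/2 - x)" using K x2 by (intro mult_left_mono) auto
      finally have "2 * s\<^sup>2 * x < K1 * (1/2 - x) * x" using x by (intro mult_strict_right_mono)
      then show ?thesis by (simp add: g_def mult_ac)
    qed
    finally have e: "exp (s\<^sup>2 * x) < 1 + g" .
    have "two_sided x * hit_discount x \<le> hit_discount (1/2 - x) * hit_discount x"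
      using x x2 s u by (intro mult_right_mono two_sided_le) auto
    also have "\<dots> \<le> hit_discount (1/2)" using hit_discount_mult_le[of "1/2 - x" x] x x2 s by simp
    finally have ts: "two_sided x * hit_discount x \<le> hit_discount (1/2)" .
    have "f x * (exp (s\<^sup>2 * x) * hit_discount x) = (two_sided x * hit_discount x) * (exp (s\<^sup>2 * x) / (1 + g))"
      using x x2 s by (simp add: f explicit_reward_def g_def)
    also have "\<dots> \<le> hit_discount (1/2) * (exp (s\<^sup>2 * x) / (1 + g))"
      using ts g by (intro mult_right_mono) auto
    also have "\<dots> < hit_discount (1/2) * 1"
      using e g u by (intro mult_strict_left_mono) auto
    finally show ?thesis by (simp add: reward_0)
  next
    case 2
    then have "1/2 + s / 2 \<le> x"
      using s mult_right_mono[of "real_of_int (a + 1)" "real_of_int y" s] grid_around_half by (simp add: x_def del: of_int_add)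
    then have x2: "s / 2 \<le> x - 1/2" by simp
    have "f x = exp (K2 * (1/2 - x)) * hit_discount (x - 1/2)"
      using x2 s by (simp add: f explicit_reward_def)
    also have "\<dots> \<le> exp (K2 * (1/2 - x)) * 1"
      using x2 s by (intro mult_left_mono hit_discount_le_1) auto
    finally have fx: "f x \<le> exp (K2 * (1/2 - x))" by simp
    have "f x * (exp (s\<^sup>2 * x) * hit_discount x) \<le> exp (K2 * (1/2 - x)) * (exp (s\<^sup>2 * x) * hit_discount (1/2))"
      using fx reward_bounds u x2 s by (intro mult_mono hit_discount_antimono) auto
    also have "\<dots> = exp (K2 * (1/2 - x) + s\<^sup>2 * x) * hit_discount (1/2)" by (simp add: exp_add)
    also have "\<dots> < 1 * hit_discount (1/2)"
    proof (rule mult_strict_right_mono[OF _ u(1)])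
      \<comment> \<open>The exponent equals
        \<open>s\<^sup>2 / 2 - (K2 - s\<^sup>2) * (x - 1/2)\<close>, and \<open>x - 1/2\<close> is
        at least \<open>s / 2\<close>; this is where \<open>s + s\<^sup>2 < K2\<close> is
        used.\<close>
      have "s\<^sup>2 < s * (K2 - s\<^sup>2)" using small s by (simp add: power2_eq_square)
      also have "s * (K2 - s\<^sup>2) \<le> 2 * (x - 1/2) * (K2 - s\<^sup>2)"
        using x2 small s by (intro mult_right_mono) auto
      finally have "K2 * (1/2 - x) + s\<^sup>2 * x < 0" by (simp add: algebra_simps)
      then show "exp (K2 * (1/2 - x) + s\<^sup>2 * x) < 1" by simp
    qed
    finally show ?thesis by (simp add: reward_0)
  qed
  moreover have "f x * tree_discount s x \<le> f x * (exp (s\<^sup>2 * x) * hit_discount x)"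
    using td reward_bounds by (intro mult_left_mono) auto
  ultimately show ?thesis by (simp add: x_def)
qed

lemma tree_origin:
  assumes "s < K1 / 4" "s + s\<^sup>2 < K2" shows "tree_J (s\<^sup>2) f 0 S < f 0"
  using reward_bounds reward_below[OF s(1)] reward_above[OF _ assms] hit_discount_pos[of "1/2"]
  by (intro tree_J_origin_less[OF s(1), where C = 1]) (auto simp: reward_0)

text \<open>The point has distance \<open>d + s / 2\<close> from 1/2, and
  \<open>hit_discount (d + s / 2)\<close> is at least the product of the separate factors, the wrong
  direction. The factor \<open>exp (- K2 * d)\<close> compensates: by \<open>1 \<le> K2\<close> and
  \<open>s \<le> d\<close> it is at most \<open>exp (- s)\<close>, a lower bound of
  \<open>hit_discount (s / 2)\<close>.\<close>

lemma reward_beyond: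
  assumes y: "a + 1 < y" and K2: "1 \<le> K2"
  shows "f (real_of_int y * s) \<le> f (real_of_int (a + 1) * s) * tree_discount s (real_of_int (y - (a + 1)) * s)"
proof -
  define d where "d = real_of_int (y - (a + 1)) * s"
  have "1 * s \<le> real_of_int (y - (a + 1)) * s" using y s by (intro mult_right_mono) auto
  then have d: "s \<le> d" by (simp add: d_def)
  have x: "real_of_int y * s = 1/2 + (d + s / 2)"
    using grid_around_half by (simp add: d_def algebra_simps)
  have "hit_discount (d + s / 2) \<le> (\<integral>r. exp (- s / 2) * exp (- sqrt (2 * r) * d) \<partial>rates)"
    unfolding hit_discount_def
  proof (rule integral_mono[OF integrable_hit_integrand])
    show "integrable rates (\<lambda>r. exp (- s / 2) * exp (- sqrt (2 * r) * d))"
      using integrable_hit_integrand by simp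
    fix r assume "r \<in> space rates"
    then have "1 * (s / 2) \<le> sqrt (2 * r) * (s / 2)" using s sqrt_2r_bounds[of r] by (intro mult_right_mono) auto
    then show "exp (- sqrt (2 * r) * (d + s / 2)) \<le> exp (- s / 2) * exp (- sqrt (2 * r) * d)"
      by (simp add: distrib_left flip: exp_add)
  qed
  then have u: "hit_discount (d + s / 2) \<le> exp (- s / 2) * hit_discount d"
    by (simp add: hit_discount_def)
  have "f (real_of_int y * s) = exp (- K2 * (s / 2)) * (exp (- K2 * d) * hit_discount (d + s / 2))"
    unfolding x using d s by (simp add: f explicit_reward_def algebra_simps flip: exp_add)
  also have "\<dots> \<le> exp (- K2 * (s / 2)) * (exp (- K2 * d) * (exp (- s / 2) * hit_discount d))"
    using u by (intro mult_left_mono) auto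
  also have "\<dots> = exp (- K2 * (s / 2)) * (exp (- K2 * d - s / 2) * hit_discount d)"
    by (simp add: mult.assoc[symmetric] flip: exp_add)
  also have "\<dots> \<le> exp (- K2 * (s / 2)) * (hit_discount (s / 2) * tree_discount s d)"
  proof (intro mult_left_mono mult_mono tree_discount_ge)
    have "1 * s \<le> K2 * d" using K2 d s by (intro mult_mono) auto
    then have "exp (- K2 * d - s / 2) \<le> exp (- 2 * (s / 2))" using s by simp
    then show "exp (- K2 * d - s / 2) \<le> hit_discount (s / 2)"
      using hit_discount_ge_exp[of "s / 2"] s by linarith
  qed (use s d hit_discount_pos[of d] hit_discount_pos[of "s / 2"] in auto)
  also have "\<dots> = f (real_of_int (a + 1) * s) * tree_discount s d"
    unfolding grid_around_half using s by (simp add: f explicit_reward_def)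
  finally show ?thesis by (simp add: d_def)
qed

text \<open>Moving the right end of the interval from 1/2 to \<open>\<alpha>\<close> and still
  paying 1 there can only help, since on the original interval the value at \<open>\<alpha>\<close>
  is at most 1.\<close>

lemma two_sided_split_le:
  assumes r: "r \<in> {1..2}" and x: "0 \<le> x" "x \<le> real_of_int a * s" and b: "0 \<le> b" "b \<le> 1"
  defines "\<alpha> \<equiv> real_of_int a * s" and "c \<equiv> sqrt (2 * r)"
  shows "sinh (c * x) / sinh (c / 2) + b * (sinh (c * (1/2 - x)) / sinh (c / 2))
    \<le> sinh (c * x) / sinh (c * \<alpha>) + b * (sinh (c * (\<alpha> - x)) / sinh (c * \<alpha>))"
proof -
  have c: "1 \<le> c" using sqrt_2r_bounds[OF r] by (auto simp: c_def)
  have \<alpha>: "0 < \<alpha>" "\<alpha> + s / 2 = 1/2" using a s by (auto simp: \<alpha>_def)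
  have pos: "0 < sinh (c / 2)" "0 < sinh (c * \<alpha>)" using c \<alpha> by auto
  have half: "c / 2 = c * \<alpha> + c * (s / 2)" using \<alpha>(2) by (metis distrib_left mult_1_right times_divide_eq_right)
  \<comment> \<open>After division by \<open>sinh (c / 2) * sinh (c * \<alpha>)\<close>: a path
    leaving the longer interval at 0 either avoids \<open>\<alpha>\<close> or visits it
    first.\<close>
  have id: "sinh (c * (1/2 - x)) * sinh (c * \<alpha>) = sinh (c / 2) * sinh (c * (\<alpha> - x)) + sinh (c * (s / 2)) * sinh (c * x)"
  proof -
    have e: "c * (1/2 - x) = (c * \<alpha> + c * (s / 2)) - c * x" "c * (\<alpha> - x) = c * \<alpha> - c * x"
      using half by (simp_all add: algebra_simps)
    show ?thesis
      unfolding half e by (simp add: sinh_field_def field_simps flip: exp_add)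
  qed
  \<comment> \<open>The value at \<open>\<alpha>\<close> on the original interval is at most
    1.\<close>
  have super: "sinh (c * \<alpha>) + b * sinh (c * (s / 2)) \<le> sinh (c / 2)"
  proof -
    have "b * sinh (c * (s / 2)) \<le> 1 * sinh (c * (s / 2))" using b c s by (intro mult_right_mono) auto
    also have "\<dots> \<le> cosh (c * \<alpha>) * sinh (c * (s / 2))"
      using c s by (intro mult_right_mono cosh_real_ge_1) auto
    finally have 1: "b * sinh (c * (s / 2)) \<le> cosh (c * \<alpha>) * sinh (c * (s / 2))" .
    have "sinh (c * \<alpha>) * 1 \<le> sinh (c * \<alpha>) * cosh (c * (s / 2))"
      using pos by (intro mult_left_mono cosh_real_ge_1) auto
    then show ?thesis unfolding half sinh_add using 1 by simp
  qed
  have clear: "(u / p + b * (v / p)) * (p * q) = u * q + b * (v * q)" "(u / q + b * (v / q)) * (p * q) = u * p + b * p * v"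
    if "0 < p" "0 < q" for u v p q :: real
    using that by (simp_all add: field_simps)
  have "(sinh (c * x) / sinh (c / 2) + b * (sinh (c * (1/2 - x)) / sinh (c / 2))) * (sinh (c / 2) * sinh (c * \<alpha>))
      = sinh (c * x) * sinh (c * \<alpha>) + b * (sinh (c * (1/2 - x)) * sinh (c * \<alpha>))"
    by (rule clear(1)[OF pos])
  also have "\<dots> = sinh (c * x) * (sinh (c * \<alpha>) + b * sinh (c * (s / 2))) + b * sinh (c / 2) * sinh (c * (\<alpha> - x))"
    unfolding id by (simp add: algebra_simps)
  also have "\<dots> \<le> sinh (c * x) * sinh (c / 2) + b * sinh (c / 2) * sinh (c * (\<alpha> - x))"
    using super c x by (intro add_right_mono mult_left_mono) auto
  also have "\<dots> = (sinh (c * x) / sinh (c * \<alpha>) + b * (sinh (c * (\<alpha> - x)) / sinh (c * \<alpha>))) * (sinh (c / 2) * sinh (c * \<alpha>))"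
    by (rule clear(2)[OF pos, symmetric])
  finally show ?thesis using pos by (simp only: mult_le_cancel_right_pos mult_pos_pos)
qed

text \<open>Compares both hyperbolic sines with their arguments; 4/7 is the reciprocal of the bound
  7/4 for \<open>cosh 1\<close>.\<close>

lemma sinh_ratio_ge:
  assumes r: "r \<in> {1..2}" and x: "0 \<le> x" "x \<le> \<alpha>" and \<alpha>: "0 < \<alpha>" "\<alpha> \<le> 1/2"
  shows "4/7 * (x / \<alpha>) \<le> sinh (sqrt (2 * r) * x) / sinh (sqrt (2 * r) * \<alpha>)"
proof -
  define c where "c = sqrt (2 * r)"
  have c: "1 \<le> c" "c \<le> 2" using sqrt_2r_bounds[OF r] by (auto simp: c_def)
  have pos: "0 < sinh (c * \<alpha>)" using c \<alpha> by simp
  have "c * \<alpha> \<le> 2 * (1/2)" using c \<alpha> by (intro mult_mono) auto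
  then have "cosh (c * \<alpha>) \<le> cosh 1" using c \<alpha> by (simp add: cosh_real_nonneg_le_iff)
  then have "cosh (c * \<alpha>) \<le> 7/4" using cosh_1_le by linarith
  then have "c * \<alpha> * cosh (c * \<alpha>) \<le> c * \<alpha> * (7/4)" using c \<alpha> by (intro mult_left_mono) auto
  moreover have "0 \<le> c * \<alpha>" using c \<alpha> by simp
  ultimately have "sinh (c * \<alpha>) \<le> c * \<alpha> * (7/4)" using sinh_le_mult_cosh[of "c * \<alpha>"] by linarith
  then have "4/7 * (x / \<alpha>) * sinh (c * \<alpha>) \<le> 4/7 * (x / \<alpha>) * (c * \<alpha> * (7/4))"
    using x \<alpha> by (intro mult_left_mono) auto
  also have "\<dots> = c * x" using \<alpha> by simp
  also have "\<dots> \<le> sinh (c * x)" using sinh_ge_self[of "c * x"] c x by simp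
  finally show ?thesis using pos by (simp add: c_def pos_le_divide_eq)
qed

text \<open>Replacing the reward \<open>1\<close> at \<open>1/2\<close> by the reward at the grid point next to it costs at most
  \<open>(1 - f (a s)) x / (a s)\<close>. This is dominated by the denominator \<open>1 + K1 x (1/2 - x)\<close> of the
  reward, also at the neighbour of \<open>a s\<close>, because \<open>K1\<close> is large.\<close>

lemma reward_between:
  assumes y: "0 < y" "y < a" and K1: "27 \<le> K1" and s_small: "s * (7 + K1) \<le> 1/5"
  shows "f (real_of_int y * s) \<le>
      (\<integral>r. f (real_of_int a * s) * (sinh (tree_rate s r * (real_of_int y * s)) / sinh (tree_rate s r * (real_of_int a * s)))
        + f 0 * (sinh (tree_rate s r * (real_of_int (a - y) * s)) / sinh (tree_rate s r * (real_of_int a * s))) \<partial>rates)"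
proof -
  define x \<alpha> where "x = real_of_int y * s" and "\<alpha> = real_of_int a * s"
  define fa where "fa = f \<alpha>"
  let ?c = "\<lambda>r. sqrt (2 * r)"
  let ?S = "\<lambda>r. sinh (?c r * x) / sinh (?c r * \<alpha>)" and ?T = "\<lambda>r. sinh (?c r * (\<alpha> - x)) / sinh (?c r * \<alpha>)"
  have \<alpha>: "\<alpha> = 1/2 - s / 2" "0 < \<alpha>" "1/3 \<le> \<alpha>" "\<alpha> \<le> 1/2" using a s by (auto simp: \<alpha>_def)
  have x: "0 < x" "x \<le> \<alpha> - s"
  proof -
    show "0 < x" using y s by (simp add: x_def)
    have "real_of_int y * s \<le> (real_of_int a - 1) * s" using y s by (intro mult_right_mono) auto
    then show "x \<le> \<alpha> - s" by (simp add: x_def \<alpha>_def algebra_simps)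
  qed
  have fa1: "0 \<le> fa" "fa \<le> 1" using reward_bounds by (auto simp: fa_def)
  have f0: "0 \<le> f 0" "f 0 \<le> 1" using reward_bounds by auto
  have fa_ge: "1 - fa \<le> (7/4 + K1 * \<alpha> / 2) * s"
  proof -
    have "1/2 - \<alpha> = s / 2" using \<alpha>(1) by simp
    from reward_left_ge[OF \<alpha>(2,4), unfolded this]
    have "1 - (7/2 + K1 * \<alpha>) * (s / 2) \<le> fa" unfolding fa_def .
    then show ?thesis by (simp add: algebra_simps)
  qed
  \<comment> \<open>As \<open>\<alpha> \<le> 1/2\<close>, the loss is at most
    \<open>(7 + K1) * s / 4\<close>, which is at most 1/20.\<close>
  have fa95: "19/20 \<le> fa"
  proof -
    have "K1 * \<alpha> / 2 \<le> K1 / 4" using K \<alpha> by simp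
    then have "(7/4 + K1 * \<alpha> / 2) * s \<le> (7/4 + K1 / 4) * s" using s by (intro mult_right_mono) auto
    then show ?thesis using fa_ge s_small by (simp add: algebra_simps)
  qed
  have contS: "continuous_on {1..2} ?S" "continuous_on {1..2} ?T"
    by (rule continuous_sinh_ratio[OF \<alpha>(2)])+
  \<comment> \<open>\<open>G\<close> is formed with the Brownian exponents. The grid exponents are
    smaller, which enlarges the exit weights, so \<open>G\<close> lies below the grid value.\<close>
  define G where "G = (\<integral>r. fa * ?S r + f 0 * ?T r \<partial>rates)"
  have intG: "integrable rates (\<lambda>r. fa * ?S r + f 0 * ?T r)"
    by (intro integrable_rates continuous_on_add continuous_on_mult continuous_on_const contS)
  have ratio_c: "0 \<le> sinh (?c r * z) / sinh (?c r * \<alpha>)" if "r \<in> {1..2}" "0 \<le> z" for r z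
    using that \<alpha> by (intro divide_nonneg_nonneg) auto
  have G_le: "G \<le> (\<integral>r. fa * (sinh (tree_rate s r * x) / sinh (tree_rate s r * \<alpha>))
        + f 0 * (sinh (tree_rate s r * (\<alpha> - x)) / sinh (tree_rate s r * \<alpha>)) \<partial>rates)"
    unfolding G_def
  proof (rule integral_mono[OF intG])
    have "sinh (tree_rate s r * \<alpha>) \<noteq> 0" if "r \<in> {1..2}" for r
      using tree_rate_pos[OF s(1), of r] \<alpha>(2) that by simp
    then show "integrable rates (\<lambda>r. fa * (sinh (tree_rate s r * x) / sinh (tree_rate s r * \<alpha>))
        + f 0 * (sinh (tree_rate s r * (\<alpha> - x)) / sinh (tree_rate s r * \<alpha>)))"
      by (intro integrable_rates continuous_intros) auto
    fix r assume "r \<in> space rates"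
    then have r: "r \<in> {1..2}" by simp
    have ratio: "sinh (?c r * z) / sinh (?c r * \<alpha>) \<le> sinh (tree_rate s r * z) / sinh (tree_rate s r * \<alpha>)"
      if "0 \<le> z" "z \<le> \<alpha>" for z
      using sinh_divide_antimono[of z \<alpha> "tree_rate s r" "?c r"] that \<alpha> r tree_rate_pos[OF s(1), of r] tree_rate_le[OF s(1), of r]
      by (simp add: mult.commute)
    show "fa * ?S r + f 0 * ?T r \<le> fa * (sinh (tree_rate s r * x) / sinh (tree_rate s r * \<alpha>))
        + f 0 * (sinh (tree_rate s r * (\<alpha> - x)) / sinh (tree_rate s r * \<alpha>))"
      using fa1 f0 x s by (intro add_mono mult_left_mono ratio) auto
  qed
  have ts_le: "two_sided x \<le> G + (1 - fa) * (x / \<alpha>)"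
  proof -
    have "two_sided x \<le> (\<integral>r. (fa * ?S r + f 0 * ?T r) + (1 - fa) * (x / \<alpha>) \<partial>rates)"
      unfolding two_sided_def
    proof (rule integral_mono[OF integrable_rates[OF continuous_two_sided]])
      show "integrable rates (\<lambda>r. (fa * ?S r + f 0 * ?T r) + (1 - fa) * (x / \<alpha>))"
        using intG by simp
      fix r assume "r \<in> space rates"
      then have r: "r \<in> {1..2}" by simp
      have "\<alpha> * sinh (?c r * x) \<le> x * sinh (?c r * \<alpha>)"
        using x s r by (intro sinh_mult_le_mult_sinh) auto
      then have "sinh (?c r * x) \<le> x * sinh (?c r * \<alpha>) / \<alpha>"
        unfolding pos_le_divide_eq[OF \<alpha>(2)] by (simp only: mult.commute)
      moreover have "0 < sinh (?c r * \<alpha>)" using \<alpha>(2) r by simp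
      ultimately have "?S r \<le> x / \<alpha>" by (simp only: pos_divide_le_eq times_divide_eq_left)
      then have "(1 - fa) * ?S r \<le> (1 - fa) * (x / \<alpha>)" using fa1 by (intro mult_left_mono) auto
      moreover have "sinh (?c r * x) / sinh (?c r / 2) + f 0 * (sinh (?c r * (1/2 - x)) / sinh (?c r / 2)) \<le> ?S r + f 0 * ?T r"
        unfolding \<alpha>_def using x s f0 by (intro two_sided_split_le r) (auto simp: \<alpha>_def)
      ultimately show "sinh (?c r * x) / sinh (?c r / 2) + hit_discount (1/2) * (sinh (?c r * (1/2 - x)) / sinh (?c r / 2))
        \<le> (fa * ?S r + f 0 * ?T r) + (1 - fa) * (x / \<alpha>)"
        unfolding reward_0 left_diff_distrib by linarith
    qed
    then show ?thesis using intG rates.prob_space by (simp add: G_def)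
  qed
  have G_ge: "p \<le> G" if "\<And>r. r \<in> {1..2} \<Longrightarrow> p \<le> fa * ?S r + f 0 * ?T r" for p
    unfolding G_def using that by (intro rates.integral_ge_const[OF intG]) auto
  have assoc: "\<alpha> * (K1 * (1/2 - x) * G) = \<alpha> * K1 * ((1/2 - x) * G)" by simp
  \<comment> \<open>Given \<open>ts_le\<close>, it remains to bound
    \<open>(1 - fa) / \<alpha>\<close> by \<open>K1 * (1/2 - x) * G\<close>. Near
    \<open>\<alpha>\<close> the gap \<open>1/2 - x\<close> is only of order \<open>s\<close>, but
    \<open>G\<close> is at least 1/2; farther left the gap is at least 1/60 and a crude bound for
    \<open>G\<close> suffices.\<close>
  have main: "(7/4 + K1 * \<alpha> / 2) * s \<le> \<alpha> * (K1 * (1/2 - x) * G)"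
  proof (cases "19/20 * \<alpha> \<le> x")
    case True
    have "1/2 \<le> G"
    proof (rule G_ge)
      fix r :: real assume r: "r \<in> {1..2}"
      have "19/20 \<le> x / \<alpha>" using True \<alpha> by (simp add: pos_le_divide_eq)
      then have "4/7 * (19/20) \<le> ?S r"
        using sinh_ratio_ge[OF r, of x \<alpha>] x \<alpha> s by linarith
      then have "19/20 * (4/7 * (19/20)) \<le> fa * ?S r" using fa95 by (intro mult_mono) auto
      moreover have "0 \<le> f 0 * ?T r" using f0 ratio_c[OF r, of "\<alpha> - x"] x s by (intro mult_nonneg_nonneg) auto
      ultimately show "1/2 \<le> fa * ?S r + f 0 * ?T r" by linarith
    qed
    moreover have "3/2 * s \<le> 1/2 - x" using x \<alpha> by simp
    ultimately have "3/2 * s * (1/2) \<le> (1/2 - x) * G" using s by (intro mult_mono) auto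
    then have "\<alpha> * K1 * (3/2 * s * (1/2)) \<le> \<alpha> * K1 * ((1/2 - x) * G)"
      using \<alpha> K by (intro mult_left_mono) auto
    moreover have "(7/4 + K1 * \<alpha> / 2) * s \<le> \<alpha> * K1 * (3/2 * s * (1/2))"
    proof -
      \<comment> \<open>With gap at least \<open>3/2 * s\<close> and \<open>G\<close> at least 1/2,
        the comparison becomes \<open>7/4 \<le> \<alpha> * K1 / 4\<close>, and the size of
        \<open>K1\<close> gives \<open>9 \<le> \<alpha> * K1\<close>.\<close>
      have "1/3 * 27 \<le> \<alpha> * K1" using \<alpha> K1 by (intro mult_mono) auto
      then have "7/4 + K1 * \<alpha> / 2 \<le> \<alpha> * K1 * (3/4)" by (simp add: mult.commute)
      then have "(7/4 + K1 * \<alpha> / 2) * s \<le> \<alpha> * K1 * (3/4) * s" using s by (intro mult_right_mono) auto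
      then show ?thesis by (simp add: mult_ac)
    qed
    ultimately show ?thesis unfolding assoc by linarith
  next
    case False
    have "1/120 \<le> G"
    proof (rule G_ge)
      fix r :: real assume r: "r \<in> {1..2}"
      have "1/20 \<le> (\<alpha> - x) / \<alpha>" using False \<alpha> by (simp add: pos_le_divide_eq)
      then have T: "4/7 * (1/20) \<le> ?T r"
        using sinh_ratio_ge[OF r, of "\<alpha> - x" \<alpha>] x \<alpha> s by linarith
      have "1/3 \<le> f 0"
      proof -
        have "exp (- 1 :: real) = 1 / exp 1" by (simp add: exp_minus field_simps)
        also have "\<dots> \<ge> 1 / 3" using exp_le by (intro divide_left_mono) auto
        finally show ?thesis using hit_discount_ge_exp[of "1/2"] by (simp add: reward_0)
      qed
      then have "1/3 * (4/7 * (1/20)) \<le> f 0 * ?T r" using T by (intro mult_mono) auto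
      moreover have "0 \<le> fa * ?S r" using fa1 ratio_c[OF r, of x] x by (intro mult_nonneg_nonneg) auto
      ultimately show "1/120 \<le> fa * ?S r + f 0 * ?T r" by linarith
    qed
    moreover have "1/60 \<le> 1/2 - x" using False \<alpha> s by simp
    ultimately have "1/60 * (1/120) \<le> (1/2 - x) * G" by (intro mult_mono) auto
    then have "\<alpha> * K1 * (1/60 * (1/120)) \<le> \<alpha> * K1 * ((1/2 - x) * G)"
      using \<alpha> K by (intro mult_left_mono) auto
    moreover have "(7/4 + K1 * \<alpha> / 2) * s \<le> \<alpha> * K1 * (1/60 * (1/120))"
    proof -
      have "1/3 * 27 \<le> \<alpha> * K1" using \<alpha> K1 by (intro mult_mono) auto
      \<comment> \<open>25/36 is 1/2 plus 7/36, the latter absorbing 7/4 because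
        \<open>9 \<le> \<alpha> * K1\<close>. Next, \<open>s \<le> 1/10000\<close> brings the
        product below 1/7200.\<close>
      then have "7/4 + K1 * \<alpha> / 2 \<le> \<alpha> * K1 * (25/36)" by (simp add: mult.commute)
      then have "(7/4 + K1 * \<alpha> / 2) * s \<le> \<alpha> * K1 * (25/36) * (1/10000)" using s \<alpha> K by (intro mult_mono) auto
      also have "\<dots> \<le> \<alpha> * K1 * (1/60 * (1/120))" using \<alpha> K by (simp add: mult_left_le)
      finally show ?thesis .
    qed
    ultimately show ?thesis unfolding assoc by linarith
  qed
  have "two_sided x \<le> G * (1 + K1 * x * (1/2 - x))"
  proof -
    have "(1 - fa) / \<alpha> \<le> K1 * (1/2 - x) * G"
      using main fa_ge \<alpha> by (simp add: pos_divide_le_eq mult.commute)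
    then have "x * ((1 - fa) / \<alpha>) \<le> x * (K1 * (1/2 - x) * G)" using x by (intro mult_left_mono) auto
    moreover have "(1 - fa) * (x / \<alpha>) = x * ((1 - fa) / \<alpha>)" by simp
    moreover have "G * (1 + K1 * x * (1/2 - x)) = G + x * (K1 * (1/2 - x) * G)" by (simp add: distrib_left)
    ultimately show ?thesis using ts_le by linarith
  qed
  moreover have "0 < 1 + K1 * x * (1/2 - x)" using x \<alpha> s K by (intro add_pos_nonneg mult_nonneg_nonneg) auto
  ultimately have "f x \<le> G"
    using x \<alpha> s by (simp add: f explicit_reward_def pos_divide_le_eq)
  also note G_le
  finally show ?thesis
    by (simp add: x_def \<alpha>_def fa_def algebra_simps)
qed

lemma tree_equilibria_nonempty:
  assumes K: "27 \<le> K1" "1 \<le> K2" and s_small: "s * (7 + K1) \<le> 1/5"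
    and le: "f (1/2 + s / 2) \<le> f (1/2 - s / 2)"
  shows "tree_equilibria (s\<^sup>2) f \<noteq> {}"
proof (rule tree_equilibrium_exists[OF s(1) reward_bounds left_neighbour_pos])
  have "s * s \<le> s * 1" using s by (intro mult_left_mono) auto
  then have "s + s\<^sup>2 < K2" using s K unfolding power2_eq_square by linarith
  moreover have "s < K1 / 4" using s K by simp
  ultimately show "tree_J (s\<^sup>2) f 0 S \<le> f 0" for S
    using tree_origin by (simp add: less_imp_le)
  show "f 0 \<le> f (real_of_int a * s)"
  proof -
    \<comment> \<open>The origin earns at most 2/3, while the neighbour of 1/2 earns at least
      \<open>1 - (7 + K1) * s / 4\<close>, hence at least 19/20.\<close>
    have "exp (- (1/2) :: real) \<le> 2/3"
      using exp_ge_add_one_self[of "1/2 :: real"] by (simp add: exp_minus field_simps)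
    then have "f 0 \<le> 2/3" using hit_discount_le_exp[of "1/2"] by (simp add: reward_0)
    moreover have "1 - (7/2 + K1 * (1/2 - s / 2)) * (s / 2) \<le> f (1/2 - s / 2)"
      using reward_left_ge[of "1/2 - s / 2"] s by simp
    moreover have "(7/2 + K1 * (1/2 - s / 2)) * (s / 2) \<le> (7/2 + K1 / 2) * (s / 2)"
      using s K by (intro mult_right_mono) (auto simp: algebra_simps)
    ultimately show ?thesis using s_small unfolding a by (simp add: algebra_simps)
  qed
  show "f (real_of_int (a + 1) * s) \<le> f (real_of_int a * s)"
    unfolding grid_around_half a by (rule le)
qed (use reward_below[OF s(1)] reward_between[OF _ _ K(1) s_small] reward_beyond[OF _ K(2)] in auto)

end

text \<open>Every equilibrium contains 0, so each payoff from \<open>x\<close> is at most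
  \<open>f 0\<close> times the factor for reaching 0. Rounding \<open>x\<close> down to the grid
  only lengthens the way.\<close>

lemma tree_V_le:
  assumes s: "0 < s" and x: "x < 0" and ne: "tree_equilibria (s\<^sup>2) f \<noteq> {}"
    and origin: "0 \<in> tree_S_star (s\<^sup>2) f"
  shows "tree_V (s\<^sup>2) f x \<le> hit_discount (1/2) * (exp (s\<^sup>2 * - x) * hit_discount (- x))"
  unfolding tree_V_def
proof (rule cSUP_least[OF ne])
  fix S assume "S \<in> tree_equilibria (s\<^sup>2) f"
  then have S: "0 \<in> S" using origin by (auto simp: tree_S_star_def)
  define k where "k = \<lfloor>x / s\<rfloor>"
  have "real_of_int k \<le> x / s" by (simp add: k_def)
  then have kx: "real_of_int k * s \<le> x" using s by (simp add: pos_le_divide_eq)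
  have "x / s < 0" using s x by (simp add: divide_neg_pos)
  then have k: "k \<le> 0" by (simp add: k_def)
  have mono: "tree_discount s (- (real_of_int k * s)) \<le> tree_discount s (- x)"
    unfolding tree_discount_def
  proof (rule integral_mono[OF integrable_tree_discount integrable_tree_discount])
    fix r assume "r \<in> space rates"
    then have "0 < tree_rate s r" using s by (intro tree_rate_pos) auto
    then show "exp (- tree_rate s r * - (real_of_int k * s)) \<le> exp (- tree_rate s r * - x)"
      using kx by simp
  qed
  have "tree_J0 (s\<^sup>2) f x S = tree_payoff 0 (s\<^sup>2) f (real_of_int k * s) S"
    using s by (simp add: tree_J0_def grid_floor_def k_def)
  also have "\<dots> \<le> f 0 * tree_discount s (- (real_of_int k * s))"
    using reward_bounds reward_below[OF s] S k by (intro tree_J0_below_le[OF s, where C = 1]) auto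
  also have "\<dots> \<le> f 0 * (exp (s\<^sup>2 * - x) * hit_discount (- x))"
    using mono tree_discount_le[OF s, of "- x"] x reward_bounds by (intro mult_left_mono) auto
  finally show "tree_J0 (s\<^sup>2) f x S \<le> hit_discount (1/2) * (exp (s\<^sup>2 * - x) * hit_discount (- x))"
    by (simp add: reward_0)
qed

end

section \<open>The limit along the step sizes \<open>h n\<close>\<close>

theorem proposition4p1:
  fixes M :: "'a measure" and B :: "real \<Rightarrow> 'a \<Rightarrow> real"
    and K1 K2 d0 d1 d2 :: real and f :: "real \<Rightarrow> real" and h :: "nat \<Rightarrow> real"
  assumes "standard_brownian_motion M B"
    and "K1 > 0" and "K2 > 0"
    and "f = reward M B K1 K2"
    and "(f has_real_derivative d0) (at_right 0)" and "d0 \<le> -17"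
    and "(f has_real_derivative d1) (at_left (1/2))" and "d1 \<ge> 17"
    and "(f has_real_derivative d2) (at_right (1/2))" and "d2 < - d1"
    and "h = (\<lambda>n. 1 / 3 ^ (2 * n))"
  shows "S_star M B f = {1/2}
    \<and> (\<forall>x. V M B f x = f0 M B x)
    \<and> (\<forall>\<^sub>F n in sequentially. 0 \<in> tree_S_star (h n) f)
    \<and> (\<forall>x<0. limsup (\<lambda>n. ereal (tree_V (h n) f x)) < ereal (V M B f x))"
proof -
  interpret brownian M B by unfold_locales (rule assms(1))
  note K = assms(2,3)
  have f: "f = explicit_reward K1 K2" using assms(4) reward_eq by simp
  define s :: "nat \<Rightarrow> real" where "s n = 1 / 3 ^ n" for n
  have h: "h n = (s n)\<^sup>2" for n
    using assms(11) by (simp add: s_def power_mult power_divide power2_eq_square flip: power_mult_distrib)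
  have s_pos: "0 < s n" for n by (simp add: s_def)
  have s_lim: "s \<longlonglongrightarrow> 0"
    unfolding s_def using LIMSEQ_inverse_realpow_zero[of 3] by (simp add: inverse_eq_divide)
  \<comment> \<open>Since \<open>3 ^ n\<close> is odd, this index belongs to the grid point half a
    step to the left of 1/2.\<close>
  define a where "a n = ((3::int) ^ n - 1) div 2" for n :: nat
  have a: "real_of_int (a n) * s n = 1/2 - s n / 2" for n
  proof -
    have "2 * a n = 3 ^ n - 1" unfolding a_def by simp
    then have "2 * real_of_int (a n) = 3 ^ n - 1"
      by (metis of_int_1 of_int_diff of_int_mult of_int_numeral of_int_power)
    then show ?thesis by (simp add: s_def field_simps)
  qed
  have K1: "27 \<le> K1" using left_derivative_le[OF K f assms(7)] assms(8) by simp
  have K2: "1 \<le> K2" using right_derivative_ge[OF K f assms(9)] assms(8,10) by simp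
  have ev: "\<forall>\<^sub>F n in sequentially. s n < e" if "0 < e" for e
    using order_tendstoD(2)[OF s_lim that] .
  have lim2: "(\<lambda>n. s n + (s n)\<^sup>2) \<longlonglongrightarrow> 0"
    using tendsto_add[OF s_lim tendsto_power[OF s_lim, of 2]] by simp
  have "filterlim (\<lambda>n. s n / 2) (at_right 0) sequentially"
    unfolding filterlim_at using s_pos less_imp_neq[OF s_pos] tendsto_divide[OF s_lim tendsto_const, of 2] by auto
  note le = reward_right_le_left[OF K f assms(7,9,10) this]
  have large: "\<forall>\<^sub>F n in sequentially. 0 \<in> tree_S_star (h n) f \<and> tree_equilibria (h n) f \<noteq> {}"
  proof -
    \<comment> \<open>The second threshold is what \<open>s * (7 + K1) \<le> 1/5\<close> demands of
      the step size.\<close>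
    have "0 < K1 / 4" "0 < 1 / (5 * (7 + K1))" using K by simp_all
    from ev[OF this(1)] ev[OF this(2)] ev[of "1/10000", simplified] order_tendstoD(2)[OF lim2 K(2)] le
    show ?thesis
    proof eventually_elim
      case (elim n)
      then have sn: "0 < s n" "s n \<le> 1/10000" using s_pos by auto
      note ctx = K f sn a
      have "s n * (7 + K1) \<le> 1/5" using elim K by (simp add: field_simps)
      then have "tree_equilibria ((s n)\<^sup>2) f \<noteq> {}"
        using elim K1 K2 by (intro tree_equilibria_nonempty[OF ctx]) auto
      moreover have "0 \<in> tree_S_star ((s n)\<^sup>2) f"
        using elim by (intro tree_S_star_origin tree_origin[OF ctx]) auto
      ultimately show ?case by (simp add: h)
    qed
  qed
  have V: "V M B f x = hit_discount \<bar>x - 1/2\<bar>" for x by (rule V_eq[OF K f])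
  have "limsup (\<lambda>n. ereal (tree_V (h n) f x)) < ereal (V M B f x)" if x: "x < 0" for x
  proof -
    let ?b = "\<lambda>n. hit_discount (1/2) * (exp ((s n)\<^sup>2 * - x) * hit_discount (- x))"
    have "\<forall>\<^sub>F n in sequentially. ereal (tree_V (h n) f x) \<le> ereal (?b n)"
      using large by eventually_elim (use tree_V_le[OF K f s_pos x] h in auto)
    then have "limsup (\<lambda>n. ereal (tree_V (h n) f x)) \<le> limsup (\<lambda>n. ereal (?b n))"
      by (rule Limsup_mono)
    also have "\<dots> = ereal (hit_discount (1/2) * (exp (0\<^sup>2 * - x) * hit_discount (- x)))"
      by (intro lim_imp_Limsup tendsto_intros s_lim) simp
    also have "\<dots> < ereal (hit_discount (1/2 + - x))"
      using hit_discount_mult_less[of "1/2" "- x"] x by simp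
    also have "\<dots> = ereal (V M B f x)" using x by (simp add: V)
    finally show ?thesis .
  qed
  with S_star_eq[OF K f] V f0_eq large show ?thesis
    by (auto elim: eventually_mono)
qed

end
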